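(* There are at least two inequivalent ternary self-dual $[76,38,18]$ codes; that is, there exist two self-dual linear codes over $\mathbb{F}_3$ of length $76$, dimension $38$ and minimum distance $18$ that are not equivalent to each other.
   Context: A ternary $[n,k,d]$ code is a $k$-dimensional linear subspace $C$ of $\mathbb{F}_3^n$ whose minimum (Hamming) distance, i.e. the minimum number of nonzero coordinates of a nonzero codeword, is exactly $d$. The code $C$ is self-dual if $C = C^{\perp}$, where $C^{\perp}$ is the orthogonal complement with respect to the standard inner product $\sum_i x_i y_i$. Two ternary codes of the same length are equivalent if one is obtained from the other by a monomial transformation, i.e. by permuting coordinates and multiplying coordinates by nonzero elements of $\mathbb{F}_3$. *)

theory Defs
  imports "HOL-Analysis.Cartesian_Space" "HOL-Library.Numeral_Type"
begin

(* The library type finite_3 carries the field structure of integers modulo 3,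
   its three elements being 0, 1 and 2 = -1. *)
type_synonym F3 = "Enum.finite_3"

definition hamming_weight :: "'a::zero ^ 'n \<Rightarrow> nat" where
  "hamming_weight x = card {i. x $ i \<noteq> 0}"

(* Meaningful only for codes with a nonzero codeword; otherwise this is Min {}. *)
definition minimum_distance :: "('a::zero ^ 'n) set \<Rightarrow> nat" where
  "minimum_distance C = Min (hamming_weight ` (C - {0}))"

definition code_with_parameters :: "nat \<Rightarrow> nat \<Rightarrow> nat \<Rightarrow> ('a::field ^ 'n) set \<Rightarrow> bool" where
  "code_with_parameters n k d C \<longleftrightarrow>
     CARD('n) = n \<and> vec.subspace C \<and> vec.dim C = k \<and> minimum_distance C = d"

definition dual_code :: "('a::comm_ring_1 ^ 'n) set \<Rightarrow> ('a ^ 'n) set" where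
  "dual_code C = {x. \<forall>y\<in>C. (\<Sum>i\<in>UNIV. x $ i * y $ i) = 0}"

definition self_dual :: "('a::comm_ring_1 ^ 'n) set \<Rightarrow> bool" where
  "self_dual C \<longleftrightarrow> C = dual_code C"

definition monomial_map :: "('n \<Rightarrow> 'n) \<Rightarrow> ('n \<Rightarrow> 'a::field) \<Rightarrow> 'a ^ 'n \<Rightarrow> 'a ^ 'n" where
  "monomial_map p c x = (\<chi> i. c i * x $ p i)"

definition equivalent_codes :: "('a::field ^ 'n) set \<Rightarrow> ('a ^ 'n) set \<Rightarrow> bool" where
  "equivalent_codes C D \<longleftrightarrow>
     (\<exists>p c. bij p \<and> (\<forall>i. c i \<noteq> 0) \<and> D = monomial_map p c ` C)"

end

(*
  Let R be the ring of 19 x 19 circulants over F_3 and let a, b in R satisfy a a* + b b = -1, b* = b,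
  where * is the transpose. The words (w, x, a w - b x, b w + a* x) in R^4 form a self-dual code, so all
  weights are divisible by 3, and the minimum distance is 18 as soon as some word has weight 18 and no
  nonzero word has weight at most 15. A Klein four-group of symmetries permutes the four blocks, so in a
  word of weight at most 15 the first block may be taken to be the lightest. Then either its weight is at
  most 2 and another block has weight at most 4 (or the weights are 0 and 5), or its weight is 3 and the
  second or the third block has weight at most 4. As a and b are invertible, the first block and any other
  one determine the word, and since a and b are fixed by r -> 7 r one of the two blocks may be replaced by
  a representative s of an orbit of affine maps. It remains to see that the 38 remaining coordinates of
  the word are not too close to zero, i.e. that two families of vectors in F_3^38 keep a distance: by the
  pigeonhole principle close vectors nearly agree on one of three or four windows, and trees branching on
  the coordinates of such a window leave few pairs to compare.

  The map r -> 7 r of order 3 acts on such a code, so modulo 3 the number of words of weight 75 is the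
  number of invariant ones. Two choices of (a, b) give different residues; thus their weight
  distributions differ and the codes are not equivalent.
*)

theory Submission
  imports Defs
begin

section \<open>Separating sets of ternary words\<close>

text \<open>The size of the checks shapes the proof: with one block of weight 3 and another of
  weight 3 or 4, about five million pairs per window remain even after one block is reduced to
  representatives. Invariance of \<open>a\<close> and \<open>b\<close> under 7 serves twice: it
  enlarges the 19 translations to a group of 57 maps, which cuts the 3876 subsets of size 4 down to
  72, and it supplies the automorphism of order 3 for the final count. The bounds are arranged
  around one budget \<open>n = 6 - wt s\<close>. If \<open>wt t = 3\<close>, total weight at most 15
  leaves a distance of at most \<open>6 + n\<close>; without counting \<open>t\<close> it leaves at
  most \<open>9 + n\<close>. The constants 6 and 9 do not depend on \<open>wt s\<close>, so a single
  tree can hold representatives of all sizes. Weight 75 is used because it is the largest multiple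
  of 3 below 76. Such a word has a single zero, so if it is invariant, each of its first two blocks
  is one of 192 vectors, and all pairs can be run through.\<close>

abbreviation "Z \<equiv> finite_3.a\<^sub>1"
abbreviation "P \<equiv> finite_3.a\<^sub>2"
abbreviation "M \<equiv> finite_3.a\<^sub>3"

lemma F3_constants: "(0::F3) = Z" "(1::F3) = P" "(2::F3) = M" "(-1::F3) = M"
  by (simp_all add: zero_finite_3_def one_finite_3_def uminus_finite_3_def)

lemma F3_plus: "Z + x = x" "x + Z = x" "P + P = M" "P + M = Z" "M + P = Z" "M + M = P"
  by (cases x; simp add: plus_finite_3_def)+

lemma F3_uminus: "- Z = Z" "- P = M" "- M = P"
  by (simp_all add: uminus_finite_3_def)

lemma all_F3: "(\<forall>x::F3. Q x) \<longleftrightarrow> Q Z \<and> Q P \<and> Q M"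
  by (metis finite_3.exhaust)

definition add :: "F3 list \<Rightarrow> F3 list \<Rightarrow> F3 list" where
  "add l m = map2 (+) l m"

definition neg :: "F3 list \<Rightarrow> F3 list" where
  "neg l = map uminus l"

lemma add_eval:
  "add [] m = []" "add (x # l) [] = []"
  "add (Z # l) (Z # m) = Z # add l m" "add (Z # l) (P # m) = P # add l m" "add (Z # l) (M # m) = M # add l m"
  "add (P # l) (Z # m) = P # add l m" "add (P # l) (P # m) = M # add l m" "add (P # l) (M # m) = Z # add l m"
  "add (M # l) (Z # m) = M # add l m" "add (M # l) (P # m) = Z # add l m" "add (M # l) (M # m) = P # add l m"
  by (simp_all add: add_def F3_plus)

lemma neg_eval: "neg [] = []" "neg (Z # l) = Z # neg l" "neg (P # l) = M # neg l" "neg (M # l) = P # neg l"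
  by (simp_all add: neg_def F3_uminus)

definition hdist :: "F3 list \<Rightarrow> F3 list \<Rightarrow> nat" where
  "hdist l m = length (filter (\<lambda>(x, y). x \<noteq> y) (zip l m))"

lemma hdist_simps [simp]:
  "hdist [] m = 0" "hdist l [] = 0"
  "hdist (x # l) (y # m) = (if x = y then hdist l m else Suc (hdist l m))"
  by (simp_all add: hdist_def)

definition far :: "nat \<Rightarrow> F3 list \<Rightarrow> F3 list \<Rightarrow> bool" where
  "far n l m = (n < hdist l m)"

text \<open>The bound is counted down, so a comparison ends at the mismatch that settles it. No rule
  covers \<open>[]\<close>: there \<open>far\<close> is false, and a failing check stays
  unproved.\<close>

lemma far_eval:
  "far n (Z # l) (Z # m) = far n l m" "far n (P # l) (P # m) = far n l m" "far n (M # l) (M # m) = far n l m"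
  "far 0 (Z # l) (P # m) = True" "far 0 (Z # l) (M # m) = True" "far 0 (P # l) (Z # m) = True"
  "far 0 (P # l) (M # m) = True" "far 0 (M # l) (Z # m) = True" "far 0 (M # l) (P # m) = True"
  "far (Suc n) (Z # l) (P # m) = far n l m" "far (Suc n) (Z # l) (M # m) = far n l m"
  "far (Suc n) (P # l) (Z # m) = far n l m" "far (Suc n) (P # l) (M # m) = far n l m"
  "far (Suc n) (M # l) (Z # m) = far n l m" "far (Suc n) (M # l) (P # m) = far n l m"
  by (simp_all add: far_def)

section \<open>Trees of words and the separation test\<close>

datatype 'a bag = E | U 'a | J "'a bag" "'a bag"

definition join :: "'a bag \<Rightarrow> 'a bag \<Rightarrow> 'a bag" where
  "join x y = (if x = E then y else if y = E then x else J x y)"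

lemma join_eval:
  "join E y = y" "join (U i) E = U i" "join (J a b) E = J a b"
  "join (U i) (U j) = J (U i) (U j)" "join (U i) (J a b) = J (U i) (J a b)"
  "join (J a b) (U i) = J (J a b) (U i)" "join (J a b) (J c d) = J (J a b) (J c d)"
  by (simp_all add: join_def)

lemma set_bag_join [simp]: "set_bag (join x y) = set_bag x \<union> set_bag y"
  by (auto simp: join_def)

text \<open>The constructor records which of the three branches may be nonempty, so evaluation never
  visits an absent branch.\<close>

datatype 'a split = InZ 'a | InP 'a | InM 'a | InZP 'a 'a | InZM 'a 'a | InPM 'a 'a | InZPM 'a 'a 'a

fun branch :: "F3 \<Rightarrow> 'a bag split \<Rightarrow> 'a bag" where
  "branch c (InZ x) = (if c = Z then x else E)"
| "branch c (InP y) = (if c = P then y else E)"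
| "branch c (InM z) = (if c = M then z else E)"
| "branch c (InZP x y) = (if c = Z then x else if c = P then y else E)"
| "branch c (InZM x z) = (if c = Z then x else if c = M then z else E)"
| "branch c (InPM y z) = (if c = P then y else if c = M then z else E)"
| "branch c (InZPM x y z) = (if c = Z then x else if c = P then y else z)"

fun merge :: "'a bag split \<Rightarrow> 'a bag split \<Rightarrow> 'a bag split" where
  "merge (InZ x) (InZ u) = InZ (J x u)"
| "merge (InZ x) (InP v) = InZP x v"
| "merge (InZ x) (InM w) = InZM x w"
| "merge (InZ x) (InZP u v) = InZP (J x u) v"
| "merge (InZ x) (InZM u w) = InZM (J x u) w"
| "merge (InZ x) (InPM v w) = InZPM x v w"
| "merge (InZ x) (InZPM u v w) = InZPM (J x u) v w"
| "merge (InP y) (InZ u) = InZP u y"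
| "merge (InP y) (InP v) = InP (J y v)"
| "merge (InP y) (InM w) = InPM y w"
| "merge (InP y) (InZP u v) = InZP u (J y v)"
| "merge (InP y) (InZM u w) = InZPM u y w"
| "merge (InP y) (InPM v w) = InPM (J y v) w"
| "merge (InP y) (InZPM u v w) = InZPM u (J y v) w"
| "merge (InM z) (InZ u) = InZM u z"
| "merge (InM z) (InP v) = InPM v z"
| "merge (InM z) (InM w) = InM (J z w)"
| "merge (InM z) (InZP u v) = InZPM u v z"
| "merge (InM z) (InZM u w) = InZM u (J z w)"
| "merge (InM z) (InPM v w) = InPM v (J z w)"
| "merge (InM z) (InZPM u v w) = InZPM u v (J z w)"
| "merge (InZP x y) (InZ u) = InZP (J x u) y"
| "merge (InZP x y) (InP v) = InZP x (J y v)"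
| "merge (InZP x y) (InM w) = InZPM x y w"
| "merge (InZP x y) (InZP u v) = InZP (J x u) (J y v)"
| "merge (InZP x y) (InZM u w) = InZPM (J x u) y w"
| "merge (InZP x y) (InPM v w) = InZPM x (J y v) w"
| "merge (InZP x y) (InZPM u v w) = InZPM (J x u) (J y v) w"
| "merge (InZM x z) (InZ u) = InZM (J x u) z"
| "merge (InZM x z) (InP v) = InZPM x v z"
| "merge (InZM x z) (InM w) = InZM x (J z w)"
| "merge (InZM x z) (InZP u v) = InZPM (J x u) v z"
| "merge (InZM x z) (InZM u w) = InZM (J x u) (J z w)"
| "merge (InZM x z) (InPM v w) = InZPM x v (J z w)"
| "merge (InZM x z) (InZPM u v w) = InZPM (J x u) v (J z w)"
| "merge (InPM y z) (InZ u) = InZPM u y z"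
| "merge (InPM y z) (InP v) = InPM (J y v) z"
| "merge (InPM y z) (InM w) = InPM y (J z w)"
| "merge (InPM y z) (InZP u v) = InZPM u (J y v) z"
| "merge (InPM y z) (InZM u w) = InZPM u y (J z w)"
| "merge (InPM y z) (InPM v w) = InPM (J y v) (J z w)"
| "merge (InPM y z) (InZPM u v w) = InZPM u (J y v) (J z w)"
| "merge (InZPM x y z) (InZ u) = InZPM (J x u) y z"
| "merge (InZPM x y z) (InP v) = InZPM x (J y v) z"
| "merge (InZPM x y z) (InM w) = InZPM x y (J z w)"
| "merge (InZPM x y z) (InZP u v) = InZPM (J x u) (J y v) z"
| "merge (InZPM x y z) (InZM u w) = InZPM (J x u) y (J z w)"
| "merge (InZPM x y z) (InPM v w) = InZPM x (J y v) (J z w)"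
| "merge (InZPM x y z) (InZPM u v w) = InZPM (J x u) (J y v) (J z w)"

lemma set_bag_branch_merge [simp]:
  "set_bag (branch c (merge p q)) = set_bag (branch c p) \<union> set_bag (branch c q)"
  by (induction p q rule: merge.induct; cases c) auto

fun tsplit :: "(F3 list \<times> F3 list) bag \<Rightarrow> (F3 list \<times> F3 list) bag split" where
  "tsplit (U (x # l, y # m)) =
    (case x + y of Z \<Rightarrow> InZ (U (l, m)) | P \<Rightarrow> InP (U (l, m)) | M \<Rightarrow> InM (U (l, m)))"
| "tsplit (J a b) = merge (tsplit a) (tsplit b)"
| "tsplit _ = InZ E"

fun ssplit :: "(nat \<times> F3 list) bag \<Rightarrow> (nat \<times> F3 list) bag split" where
  "ssplit (U (0, x # l)) =
    (case x of Z \<Rightarrow> InZ (U (0, l)) | P \<Rightarrow> InP (U (0, l)) | M \<Rightarrow> InM (U (0, l)))"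
| "ssplit (U (Suc n, x # l)) =
    (case x of Z \<Rightarrow> InZPM (U (Suc n, l)) (U (n, l)) (U (n, l))
             | P \<Rightarrow> InZPM (U (n, l)) (U (Suc n, l)) (U (n, l))
             | M \<Rightarrow> InZPM (U (n, l)) (U (n, l)) (U (Suc n, l)))"
| "ssplit (J a b) = merge (ssplit a) (ssplit b)"
| "ssplit _ = InZ E"

lemma tsplit_eval:
  "tsplit (J a b) = merge (tsplit a) (tsplit b)"
  "tsplit (U (Z # l, Z # m)) = InZ (U (l, m))"
  "tsplit (U (Z # l, P # m)) = InP (U (l, m))"
  "tsplit (U (Z # l, M # m)) = InM (U (l, m))"
  "tsplit (U (P # l, Z # m)) = InP (U (l, m))"
  "tsplit (U (P # l, P # m)) = InM (U (l, m))"
  "tsplit (U (P # l, M # m)) = InZ (U (l, m))"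
  "tsplit (U (M # l, Z # m)) = InM (U (l, m))"
  "tsplit (U (M # l, P # m)) = InZ (U (l, m))"
  "tsplit (U (M # l, M # m)) = InP (U (l, m))"
  by (simp_all add: F3_plus)

lemma ssplit_eval:
  "ssplit (J a b) = merge (ssplit a) (ssplit b)"
  "ssplit (U (0, Z # l)) = InZ (U (0, l))"
  "ssplit (U (0, P # l)) = InP (U (0, l))"
  "ssplit (U (0, M # l)) = InM (U (0, l))"
  "ssplit (U (Suc n, Z # l)) = InZPM (U (Suc n, l)) (U (n, l)) (U (n, l))"
  "ssplit (U (Suc n, P # l)) = InZPM (U (n, l)) (U (Suc n, l)) (U (n, l))"
  "ssplit (U (Suc n, M # l)) = InZPM (U (n, l)) (U (n, l)) (U (Suc n, l))"
  by simp_all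

lemma tsplit_sound:
  "(v, w) \<in> set_bag T \<Longrightarrow> add v w = c # u
    \<Longrightarrow> \<exists>v' w'. (v', w') \<in> set_bag (branch c (tsplit T)) \<and> add v' w' = u"
proof (induction T rule: tsplit.induct)
  case (1 x l y m)
  then show ?case by (auto simp: add_def split: finite_3.splits)
next
  case (2 a b)
  then show ?case by auto
qed (auto simp: add_def)

lemma ssplit_sound:
  "(n, x # l) \<in> set_bag S \<Longrightarrow> (n, l) \<in> set_bag (branch x (ssplit S))"
  "(Suc n, x # l) \<in> set_bag S \<Longrightarrow> x \<noteq> c \<Longrightarrow> (n, l) \<in> set_bag (branch c (ssplit S))"
  by (induction S rule: ssplit.induct) (auto split: finite_3.splits; metis finite_3.exhaust)+

text \<open>
  An entry \<open>(n, l)\<close> of the first tree stands for all words that differ from \<open>l\<close> in at most \<open>n\<close> of the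
  first \<open>d\<close> places, where \<open>n\<close> decreases along the branches that deviate from \<open>l\<close>; an entry \<open>(v, w)\<close> of the
  second one stands for \<open>v + w\<close>, a sum that is only computed where it is needed. All trees are
  evaluated by rewriting, which is why the functions come with equations for constructor patterns.
\<close>

primrec sep :: "nat \<Rightarrow> nat \<Rightarrow> (nat \<times> F3 list) bag \<Rightarrow> (F3 list \<times> F3 list) bag \<Rightarrow> bool" where
  "sep c 0 S T = (\<forall>(n, l)\<in>set_bag S. \<forall>(v, w)\<in>set_bag T. far (c + n) l (add v w))"
| "sep c (Suc d) S T = (\<forall>x. sep c d (branch x (ssplit S)) (branch x (tsplit T)))"

text \<open>A mismatch lowers the budget and the remaining distance by one each, so the required
  excess \<open>c\<close> of distance over budget is invariant during the descent. The window only
  decides which pairs meet at a leaf; the leaf compares all remaining coordinates.\<close>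

lemma sep_sound:
  "sep c d S T \<Longrightarrow> (n, l) \<in> set_bag S \<Longrightarrow> (v, w) \<in> set_bag T \<Longrightarrow> add v w = u
    \<Longrightarrow> length l = length u \<Longrightarrow> d \<le> length l \<Longrightarrow> hdist (take d l) (take d u) \<le> n
    \<Longrightarrow> c + n < hdist l u"
proof (induction d arbitrary: S T n l v w u)
  case 0
  then show ?case by (auto simp: far_def)
next
  case (Suc d)
  obtain x l' where l: "l = x # l'" using Suc.prems by (cases l) auto
  obtain y u' where u: "u = y # u'" using Suc.prems l by (cases u) auto
  have sep: "sep c d (branch y (ssplit S)) (branch y (tsplit T))" using Suc.prems(1) by simp
  obtain v' w' where vw: "(v', w') \<in> set_bag (branch y (tsplit T))" "add v' w' = u'"
    using tsplit_sound Suc.prems(3,4) u by blast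
  show ?case
  proof (cases "x = y")
    case True
    have "(n, l') \<in> set_bag (branch y (ssplit S))" using ssplit_sound(1) Suc.prems(2) l True by blast
    from Suc.IH[OF sep this vw] show ?thesis using Suc.prems l u True by simp
  next
    case False
    then obtain k where k: "n = Suc k" using Suc.prems(7) l u by (cases n) auto
    have "(k, l') \<in> set_bag (branch y (ssplit S))" using ssplit_sound(2) Suc.prems(2) l k False by blast
    from Suc.IH[OF sep this vw] show ?thesis using Suc.prems l u k False by simp
  qed
qed

text \<open>Takes the trees already split, so that rewriting computes each splitting once and then
  selects the branches common to both sides.\<close>

definition sep_split where
  "sep_split c d s t = (\<forall>x. sep c d (branch x s) (branch x t))"

lemma sep_empty: "sep c d E T" "sep c d S E"
  by (induction d arbitrary: S T) (auto simp: all_F3)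

lemma sep_split_eval:
  "sep_split c d (InZ x) (InZ u) = sep c d x u"
  "sep_split c d (InZ x) (InP v) = True"
  "sep_split c d (InZ x) (InM w) = True"
  "sep_split c d (InZ x) (InZP u v) = sep c d x u"
  "sep_split c d (InZ x) (InZM u w) = sep c d x u"
  "sep_split c d (InZ x) (InPM v w) = True"
  "sep_split c d (InZ x) (InZPM u v w) = sep c d x u"
  "sep_split c d (InP y) (InZ u) = True"
  "sep_split c d (InP y) (InP v) = sep c d y v"
  "sep_split c d (InP y) (InM w) = True"
  "sep_split c d (InP y) (InZP u v) = sep c d y v"
  "sep_split c d (InP y) (InZM u w) = True"
  "sep_split c d (InP y) (InPM v w) = sep c d y v"
  "sep_split c d (InP y) (InZPM u v w) = sep c d y v"
  "sep_split c d (InM z) (InZ u) = True"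
  "sep_split c d (InM z) (InP v) = True"
  "sep_split c d (InM z) (InM w) = sep c d z w"
  "sep_split c d (InM z) (InZP u v) = True"
  "sep_split c d (InM z) (InZM u w) = sep c d z w"
  "sep_split c d (InM z) (InPM v w) = sep c d z w"
  "sep_split c d (InM z) (InZPM u v w) = sep c d z w"
  "sep_split c d (InZP x y) (InZ u) = sep c d x u"
  "sep_split c d (InZP x y) (InP v) = sep c d y v"
  "sep_split c d (InZP x y) (InM w) = True"
  "sep_split c d (InZP x y) (InZP u v) = (sep c d x u \<and> sep c d y v)"
  "sep_split c d (InZP x y) (InZM u w) = sep c d x u"
  "sep_split c d (InZP x y) (InPM v w) = sep c d y v"
  "sep_split c d (InZP x y) (InZPM u v w) = (sep c d x u \<and> sep c d y v)"
  "sep_split c d (InZM x z) (InZ u) = sep c d x u"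
  "sep_split c d (InZM x z) (InP v) = True"
  "sep_split c d (InZM x z) (InM w) = sep c d z w"
  "sep_split c d (InZM x z) (InZP u v) = sep c d x u"
  "sep_split c d (InZM x z) (InZM u w) = (sep c d x u \<and> sep c d z w)"
  "sep_split c d (InZM x z) (InPM v w) = sep c d z w"
  "sep_split c d (InZM x z) (InZPM u v w) = (sep c d x u \<and> sep c d z w)"
  "sep_split c d (InPM y z) (InZ u) = True"
  "sep_split c d (InPM y z) (InP v) = sep c d y v"
  "sep_split c d (InPM y z) (InM w) = sep c d z w"
  "sep_split c d (InPM y z) (InZP u v) = sep c d y v"
  "sep_split c d (InPM y z) (InZM u w) = sep c d z w"
  "sep_split c d (InPM y z) (InPM v w) = (sep c d y v \<and> sep c d z w)"
  "sep_split c d (InPM y z) (InZPM u v w) = (sep c d y v \<and> sep c d z w)"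
  "sep_split c d (InZPM x y z) (InZ u) = sep c d x u"
  "sep_split c d (InZPM x y z) (InP v) = sep c d y v"
  "sep_split c d (InZPM x y z) (InM w) = sep c d z w"
  "sep_split c d (InZPM x y z) (InZP u v) = (sep c d x u \<and> sep c d y v)"
  "sep_split c d (InZPM x y z) (InZM u w) = (sep c d x u \<and> sep c d z w)"
  "sep_split c d (InZPM x y z) (InPM v w) = (sep c d y v \<and> sep c d z w)"
  "sep_split c d (InZPM x y z) (InZPM u v w) = (sep c d x u \<and> sep c d y v \<and> sep c d z w)"
  by (simp_all add: sep_split_def all_F3 sep_empty)

lemma sep_eval:
  "sep c d E T = True" "sep c d (U i) E = True" "sep c d (J a b) E = True"
  "sep c (Suc d) (U i) (U j) = sep_split c d (ssplit (U i)) (tsplit (U j))"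
  "sep c (Suc d) (U i) (J t u) = sep_split c d (ssplit (U i)) (tsplit (J t u))"
  "sep c (Suc d) (J a b) (U j) = sep_split c d (ssplit (J a b)) (tsplit (U j))"
  "sep c (Suc d) (J a b) (J t u) = sep_split c d (ssplit (J a b)) (tsplit (J t u))"
  "sep c 0 (U (n, l)) (U (v, w)) = far (c + n) l (add v w)"
  "sep c 0 (U i) (J t u) = (sep c 0 (U i) t \<and> sep c 0 (U i) u)"
  "sep c 0 (J a b) (U j) = (sep c 0 a (U j) \<and> sep c 0 b (U j))"
  "sep c 0 (J a b) (J t u) = (sep c 0 a (J t u) \<and> sep c 0 b (J t u))"
  by (simp_all add: sep_empty sep_split_def ball_Un ball_conj_distrib case_prod_unfold conj_ac)

text \<open>The last row of a sum is left unadded in the pair, so all sums with the same earlier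
  rows share that partial sum. Each set of rows occurs once for every choice of signs.\<close>

fun tsums :: "nat \<Rightarrow> F3 list \<Rightarrow> (F3 list \<times> F3 list) list \<Rightarrow> (F3 list \<times> F3 list) bag" where
  "tsums 0 v rs = U (v, map (\<lambda>_. 0) v)"
| "tsums (Suc k) v [] = E"
| "tsums (Suc k) v ((r, r') # rs) = join
    (if k = 0 then J (U (v, r)) (U (v, r')) else join (tsums k (add v r) rs) (tsums k (add v r') rs))
    (tsums (Suc k) v rs)"

lemma tsums_eval:
  "tsums (Suc k) v [] = E"
  "tsums (Suc 0) v ((r, r') # rs) = join (J (U (v, r)) (U (v, r'))) (tsums (Suc 0) v rs)"
  "tsums (Suc (Suc k)) v ((r, r') # rs) =
    join (join (tsums (Suc k) (add v r) rs) (tsums (Suc k) (add v r') rs)) (tsums (Suc (Suc k)) v rs)"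
  by simp_all

fun ssums :: "nat \<Rightarrow> F3 list \<Rightarrow> (F3 list \<times> F3 list) list \<Rightarrow> (nat \<times> F3 list) bag" where
  "ssums n v [] = U (n, v)"
| "ssums n v ((r, r') # rs) = J (ssums n (add v r) rs) (ssums n (add v r') rs)"

text \<open>The first row of a representative enters with the positive sign only, because vectors
  are normalized up to sign. The number \<open>n\<close> becomes the budget of every word.\<close>

fun sreps :: "nat \<Rightarrow> (F3 list \<times> F3 list) list \<Rightarrow> nat list list \<Rightarrow> (nat \<times> F3 list) bag list" where
  "sreps n rs [] = []"
| "sreps n rs (is # iss) = ssums n (fst (rs ! hd is)) (map ((!) rs) (tl is)) # sreps n rs iss"

fun pairs :: "'a bag list \<Rightarrow> 'a bag list" where
  "pairs (x # y # xs) = J x y # pairs xs" | "pairs [x] = [x]" | "pairs [] = []"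

text \<open>The number \<open>k\<close> of rounds affects only the shape: pairing keeps the tree
  balanced, and the final fold collects what is left.\<close>

primrec build :: "nat \<Rightarrow> 'a bag list \<Rightarrow> 'a bag" where
  "build 0 xs = foldr join xs E" | "build (Suc k) xs = build k (pairs xs)"

primrec pairneg :: "F3 list list \<Rightarrow> (F3 list \<times> F3 list) list" where
  "pairneg [] = []" | "pairneg (r # rs) = (r, neg r) # pairneg rs"

primrec circ :: "nat \<Rightarrow> F3 list \<Rightarrow> F3 list \<Rightarrow> F3 list list" where
  "circ 0 p r = []" | "circ (Suc n) p r = (p @ r) # circ n (rotate1 p) (rotate1 r)"

text \<open>Brings a window to the front, since the trees branch on leading coordinates.\<close>

definition turn :: "nat \<Rightarrow> F3 list list \<Rightarrow> F3 list list" where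
  "turn k rs = map (\<lambda>l. drop k l @ take k l) rs"

definition "zeros = replicate 38 Z"

lemmas eval_rules = add_eval neg_eval join_eval merge.simps tsplit_eval ssplit_eval
  far_eval sep_eval sep_split_eval tsums_eval ssums.simps sreps.simps pairs.simps build.simps pairneg.simps circ.simps turn_def
  list.map append.simps rotate1.simps drop0 take0 drop_Suc_Cons take_Suc_Cons drop_Nil take_Nil fst_conv
  foldr.simps comp_apply id_apply
  nth_Cons_0 nth_Cons_Suc list.sel replicate.simps zeros_def add_0_left add_Suc One_nat_def eval_nat_numeral BitM.simps simp_thms(21)

text \<open>The default simplifier setup replaces 0 and 1 in \<open>F3\<close> by constructors, out of reach of ring lemmas.\<close>

declare zero_finite_3_def [simp del] one_finite_3_def [simp del]

section \<open>Linear combinations of rows and soundness of their enumeration\<close>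

definition comb :: "(nat \<Rightarrow> F3) \<Rightarrow> F3 list list \<Rightarrow> F3 list" where
  "comb c rs = map (\<lambda>j. \<Sum>i<length rs. c i * rs ! i ! j) [0..<38]"

lemma length_comb [simp]: "length (comb c rs) = 38"
  by (simp add: comb_def)

lemma nth_comb: "j < 38 \<Longrightarrow> comb c rs ! j = (\<Sum>i<length rs. c i * rs ! i ! j)"
  by (simp add: comb_def)

lemma length_add [simp]: "length (add l m) = min (length l) (length m)"
  by (simp add: add_def)

lemma nth_add: "j < length l \<Longrightarrow> j < length m \<Longrightarrow> add l m ! j = l ! j + m ! j"
  by (simp add: add_def)

lemma length_neg [simp]: "length (neg l) = length l"
  by (simp add: neg_def)

lemma nth_neg: "j < length l \<Longrightarrow> neg l ! j = - l ! j"
  by (simp add: neg_def)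

lemma pairneg_map: "pairneg rs = map (\<lambda>r. (r, neg r)) rs"
  by (induction rs) auto

lemma length_zeros [simp]: "length zeros = 38"
  by (simp add: zeros_def)

lemma nth_zeros: "j < 38 \<Longrightarrow> zeros ! j = 0"
  by (simp add: zeros_def F3_constants)

lemma F3_cases: obtains "(x::F3) = 0" | "x = 1" | "x = -1"
  by (cases x) (auto simp: zero_finite_3_def one_finite_3_def uminus_finite_3_def)

lemma tsums_sound:
  assumes "length v = 38" "\<forall>r\<in>set rs. length r = 38" "card {i. i < length rs \<and> c i \<noteq> 0} = k"
  shows "\<exists>(v', w)\<in>set_bag (tsums k v (pairneg rs)). add v' w = add v (comb c rs)"
  using assms
proof (induction rs arbitrary: v k c)
  case Nil
  then have "k = 0" by simp
  then show ?case using Nil.prems(1) by (auto simp: nth_add nth_comb intro!: nth_equalityI)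
next
  case (Cons r rs)
  define d where "d i = c (Suc i)" for i
  have split: "{i. i < length (r # rs) \<and> c i \<noteq> 0} =
      (if c 0 = 0 then {} else {0}) \<union> Suc ` {i. i < length rs \<and> d i \<noteq> 0}"
    by (auto simp: d_def image_iff less_Suc_eq_0_disj)
  have card: "card {i. i < length (r # rs) \<and> c i \<noteq> 0} =
      (if c 0 = 0 then 0 else 1) + card {i. i < length rs \<and> d i \<noteq> 0}"
    unfolding split by (subst card_Un_disjoint) (auto simp: card_image)
  have comb: "comb c (r # rs) ! j = c 0 * r ! j + comb d rs ! j" if "j < 38" for j
    using that by (simp add: nth_comb d_def sum.lessThan_Suc_shift del: sum.lessThan_Suc)
  have lr: "length r = 38" and lrs: "\<forall>r\<in>set rs. length r = 38" using Cons.prems by auto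
  show ?case
  proof (cases k)
    case 0
    then have z: "c i = 0" if "i < length (r # rs)" for i
      using Cons.prems(3) that by auto
    have "comb c (r # rs) = map (\<lambda>_. 0) v"
      by (rule nth_equalityI) (use Cons.prems(1) z in \<open>auto simp: nth_comb\<close>)
    then show ?thesis using 0 by simp
  next
    case (Suc k')
    show ?thesis
    proof (cases "c 0 = 0")
      case True
      have "card {i. i < length rs \<and> d i \<noteq> 0} = Suc k'" using Cons.prems(3) card True Suc by simp
      from Cons.IH[OF Cons.prems(1) lrs this]
      obtain v' w where "(v', w) \<in> set_bag (tsums (Suc k') v (pairneg rs))" "add v' w = add v (comb d rs)"
        by auto
      moreover have "add v (comb d rs) = add v (comb c (r # rs))"
        by (rule nth_equalityI) (use Cons.prems(1) True comb in \<open>auto simp: nth_add\<close>)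
      ultimately show ?thesis unfolding Suc by (intro bexI[of _ "(v', w)"]) auto
    next
      case False
      define r' where "r' = (if c 0 = 1 then r else neg r)"
      have lr': "length r' = 38" using lr by (simp add: r'_def)
      have r': "r' ! j = c 0 * r ! j" if "j < 38" for j
        using False that lr by (cases "c 0" rule: F3_cases) (auto simp: r'_def nth_neg)
      have cd: "card {i. i < length rs \<and> d i \<noteq> 0} = k'" using Cons.prems(3) card False Suc by simp
      show ?thesis
      proof (cases k')
        \<comment> \<open>No further row occurs: the enumeration ends with the unadded pair
          \<open>(v, r')\<close> instead of recursing.\<close>
        case 0
        then have "d i = 0" if "i < length rs" for i using cd that by auto
        then have "comb d rs ! j = 0" if "j < 38" for j using that by (simp add: nth_comb)
        then have "add v r' = add v (comb c (r # rs))"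
          by (intro nth_equalityI) (use Cons.prems(1) lr' comb r' in \<open>auto simp: nth_add\<close>)
        then show ?thesis unfolding Suc using 0 by (intro bexI[of _ "(v, r')"]) (auto simp: r'_def)
      next
        case (Suc k'')
        have "length (add v r') = 38" using Cons.prems(1) lr' by simp
        from Cons.IH[OF this lrs cd]
        obtain v' w where "(v', w) \<in> set_bag (tsums k' (add v r') (pairneg rs))"
          "add v' w = add (add v r') (comb d rs)" by auto
        moreover have "add (add v r') (comb d rs) = add v (comb c (r # rs))"
          by (rule nth_equalityI) (use Cons.prems(1) lr' comb r' in \<open>auto simp: nth_add\<close>)
        ultimately show ?thesis unfolding \<open>k = Suc k'\<close> using Suc
          by (intro bexI[of _ "(v', w)"]) (auto simp: r'_def split: if_splits)
      qed
    qed
  qed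
qed

lemma ssums_sound:
  assumes "length v = 38" "\<forall>i\<in>set is. i < length rs \<and> length (rs ! i) = 38 \<and> c i \<noteq> 0"
  shows "\<exists>l. (n, l) \<in> set_bag (ssums n v (map ((!) (pairneg rs)) is)) \<and> length l = 38
    \<and> (\<forall>j<38. l ! j = v ! j + (\<Sum>i\<leftarrow>is. c i * rs ! i ! j))"
  using assms
proof (induction "is" arbitrary: v)
  case Nil
  then show ?case by auto
next
  case (Cons i "is")
  define r' where "r' = (if c i = 1 then rs ! i else neg (rs ! i))"
  have lr: "length (rs ! i) = 38" and lr': "length r' = 38" and ci: "c i \<noteq> 0" and il: "i < length rs"
    using Cons.prems(2) by (auto simp: r'_def)
  have r': "r' ! j = c i * rs ! i ! j" if "j < 38" for j
    using ci that lr by (cases "c i" rule: F3_cases) (auto simp: r'_def nth_neg)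
  have "length (add v r') = 38" using Cons.prems(1) lr' by simp
  from Cons.IH[OF this] Cons.prems(2)
  obtain l where l: "(n, l) \<in> set_bag (ssums n (add v r') (map ((!) (pairneg rs)) is))" "length l = 38"
    "\<forall>j<38. l ! j = add v r' ! j + (\<Sum>i\<leftarrow>is. c i * rs ! i ! j)" by auto
  have "pairneg rs ! i = (rs ! i, neg (rs ! i))" using il by (simp add: pairneg_map)
  then have "(n, l) \<in> set_bag (ssums n v (map ((!) (pairneg rs)) (i # is)))"
    using l(1) by (auto simp: r'_def split: if_splits)
  moreover have "l ! j = v ! j + (\<Sum>i\<leftarrow>i # is. c i * rs ! i ! j)" if "j < 38" for j
    using l(3) that Cons.prems(1) lr' r' by (simp add: nth_add)
  ultimately show ?case using l(2) by blast
qed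

lemma set_bag_pairs: "\<Union> (set_bag ` set (pairs xs)) = \<Union> (set_bag ` set xs)"
  by (induction xs rule: pairs.induct) auto

lemma set_bag_build: "set_bag (build k xs) = \<Union> (set_bag ` set xs)"
proof (induction k arbitrary: xs)
  case 0
  then show ?case by (induction xs) auto
qed (simp add: set_bag_pairs)

lemma set_sreps: "set (sreps n rs ps) = (\<lambda>is. ssums n (fst (rs ! hd is)) (map ((!) rs) (tl is))) ` set ps"
  by (induction n rs ps rule: sreps.induct) auto

text \<open>Distinctness turns the sum along the index list into a sum over the support of
  \<open>c\<close>; the condition \<open>c i = 1\<close> matches the fixed sign of the first
  row.\<close>

lemma sreps_sound:
  assumes "(i # is) \<in> set ps" "distinct (i # is)" "set (i # is) = {i. i < length rs \<and> c i \<noteq> 0}"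
    "\<forall>r\<in>set rs. length r = 38" "c i = 1"
  shows "(n, comb c rs) \<in> \<Union> (set_bag ` set (sreps n (pairneg rs) ps))"
proof -
  have il: "i < length rs" using assms(3) by auto
  have f: "fst (pairneg rs ! i) = rs ! i" using il by (simp add: pairneg_map)
  have "length (rs ! i) = 38" using il assms(4) by auto
  moreover have "\<forall>i\<in>set is. i < length rs \<and> length (rs ! i) = 38 \<and> c i \<noteq> 0"
  proof
    fix k assume "k \<in> set is"
    then have "k \<in> {i. i < length rs \<and> c i \<noteq> 0}" unfolding assms(3)[symmetric] by simp
    then show "k < length rs \<and> length (rs ! k) = 38 \<and> c k \<noteq> 0" using assms(4) by simp
  qed
  ultimately obtain l where l: "(n, l) \<in> set_bag (ssums n (rs ! i) (map ((!) (pairneg rs)) is))" "length l = 38"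
    "\<forall>j<38. l ! j = rs ! i ! j + (\<Sum>i\<leftarrow>is. c i * rs ! i ! j)" using ssums_sound[of "rs ! i" "is" rs c n] by blast
  have "l = comb c rs"
  proof (rule nth_equalityI)
    fix j assume "j < length l"
    then have j: "j < 38" using l(2) by simp
    have "comb c rs ! j = (\<Sum>k<length rs. c k * rs ! k ! j)" using j by (simp add: nth_comb)
    also have "\<dots> = (\<Sum>k\<in>set (i # is). c k * rs ! k ! j)"
      unfolding assms(3) by (rule sum.mono_neutral_right) auto
    also have "\<dots> = (\<Sum>k\<leftarrow>i # is. c k * rs ! k ! j)"
      using assms(2) by (rule sum_list_distinct_conv_sum_set[symmetric])
    finally show "l ! j = comb c rs ! j" using l(3) j assms(5) by simp
  qed (use l in simp)
  then show ?thesis using l(1) assms(1) f by (force simp: set_sreps)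
qed

section \<open>Windows and cyclic shifts of a word\<close>

lemma hdist_append:
  "length a = length c \<Longrightarrow> hdist (a @ b) (c @ d) = hdist a c + hdist b d"
  by (simp add: hdist_def)

lemma hdist_conv_card:
  "length l = n \<Longrightarrow> length m = n \<Longrightarrow> hdist l m = card {j. j < n \<and> l ! j \<noteq> m ! j}"
  by (auto simp: hdist_def length_filter_conv_card intro!: arg_cong[where f = card])

definition spin :: "nat \<Rightarrow> 'a list \<Rightarrow> 'a list" where
  "spin k l = drop k l @ take k l"

lemma turn_spin: "turn k rs = map (spin k) rs"
  by (simp add: turn_def spin_def)

lemma length_spin [simp]: "length (spin k l) = length l"
  by (simp add: spin_def)

lemma comb_turn:
  assumes "\<forall>r\<in>set rs. length r = 38"
  shows "comb c (turn k rs) = spin k (comb c rs)"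
proof (rule nth_equalityI)
  fix j assume "j < length (comb c (turn k rs))"
  then have j: "j < 38" by simp
  \<comment> \<open>\<open>drop\<close> and \<open>take\<close> treat a shift beyond the end as a
    shift by 38; \<open>j'\<close> is the position from which entry \<open>j\<close> is
    taken.\<close>
  define k' where "k' = min k 38"
  define j' where "j' = (if j < 38 - k' then k' + j else j - (38 - k'))"
  have "spin k l ! j = l ! j'" if "length l = 38" for l :: "F3 list"
    using that j by (auto simp: spin_def nth_append k'_def j'_def min_def)
  moreover have "j' < 38" using j by (auto simp: j'_def k'_def)
  ultimately show "comb c (turn k rs) ! j = spin k (comb c rs) ! j"
    using assms j by (auto simp: nth_comb turn_spin intro!: sum.cong)
qed simp

lemma hdist_spin: "length l = length m \<Longrightarrow> hdist (spin k l) (spin k m) = hdist l m"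
  by (simp add: spin_def hdist_append) (metis add.commute append_take_drop_id hdist_append length_take)

lemma take_spin: "k + d \<le> length l \<Longrightarrow> take d (spin k l) = take d (drop k l)"
  by (simp add: spin_def)

lemma hdist_three:
  assumes "length l = 38" "length m = 38"
  shows "hdist l m = hdist (take 13 (spin 0 l)) (take 13 (spin 0 m)) + hdist (take 13 (spin 13 l)) (take 13 (spin 13 m))
    + hdist (take 12 (spin 26 l)) (take 12 (spin 26 m))"
proof -
  have split: "x = take 13 x @ take 13 (drop 13 x) @ take 12 (drop 26 x)" if "length x = 38" for x :: "F3 list"
    by (rule nth_equalityI) (use that in \<open>auto simp: nth_append\<close>)
  show ?thesis
    by (subst split[OF assms(1)], subst split[OF assms(2)]) (simp add: assms hdist_append take_spin)
qed

lemma hdist_four: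
  assumes "length l = 38" "length m = 38"
  shows "hdist l m = hdist (take 10 (spin 0 l)) (take 10 (spin 0 m)) + hdist (take 10 (spin 10 l)) (take 10 (spin 10 m))
    + hdist (take 9 (spin 20 l)) (take 9 (spin 20 m)) + hdist (take 9 (spin 29 l)) (take 9 (spin 29 m))"
proof -
  have split: "x = take 10 x @ take 10 (drop 10 x) @ take 9 (drop 20 x) @ take 9 (drop 29 x)" if "length x = 38" for x :: "F3 list"
    by (rule nth_equalityI) (use that in \<open>auto simp: nth_append\<close>)
  show ?thesis
    by (subst split[OF assms(1)], subst split[OF assms(2)]) (simp add: assms hdist_append take_spin)
qed

section \<open>The ring of circulants\<close>

lemma of_nat_19_eq: "(of_nat i :: 19) = of_nat j \<longleftrightarrow> i mod 19 = j mod 19"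
proof -
  have *: "(of_nat i :: 19) = of_nat j \<longleftrightarrow> i mod 19 = j mod 19" if "j \<le> i" for i j
  proof -
    have "(of_nat i :: 19) = of_nat j \<longleftrightarrow> (of_nat (i - j) :: 19) = 0"
      using that by (simp add: of_nat_diff)
    also have "\<dots> \<longleftrightarrow> 19 dvd i - j" by (simp add: of_nat_eq_0_iff_char_dvd)
    also have "\<dots> \<longleftrightarrow> i mod 19 = j mod 19" using that by (simp add: mod_eq_dvd_iff_nat)
    finally show ?thesis .
  qed
  show ?thesis using *[of i j] *[of j i] by (cases "j \<le> i") auto
qed

lemma of_nat_19_mod [simp]: "(of_nat (i mod 19) :: 19) = of_nat i"
  by (simp add: of_nat_19_eq)

lemma bij_of_nat_19: "bij_betw (of_nat :: nat \<Rightarrow> 19) {..<19} UNIV"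
proof -
  have inj: "inj_on (of_nat :: nat \<Rightarrow> 19) {..<19}"
    by (auto simp: inj_on_def of_nat_19_eq)
  then have "card ((of_nat :: nat \<Rightarrow> 19) ` {..<19}) = CARD(19)" by (simp add: card_image)
  then have "(of_nat :: nat \<Rightarrow> 19) ` {..<19} = UNIV" by (intro card_subset_eq) auto
  then show ?thesis using inj by (simp add: bij_betw_def)
qed

lemma bij_minus_of_nat_19: "bij_betw (\<lambda>i. - of_nat i :: 19) {..<19} UNIV"
proof -
  have "bij_betw (uminus :: 19 \<Rightarrow> 19) UNIV UNIV"
    by (rule bij_betw_byWitness[where f' = uminus]) auto
  from bij_betw_trans[OF bij_of_nat_19 this] show ?thesis by (simp add: comp_def)
qed

definition residue :: "19 \<Rightarrow> nat" where
  "residue = inv_into {..<19} of_nat"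

lemma residue_less [simp]: "residue r < 19"
  and of_nat_residue [simp]: "of_nat (residue r) = r"
proof -
  have "r \<in> of_nat ` {..<19}" using bij_of_nat_19 by (simp add: bij_betw_def)
  then show "residue r < 19" "of_nat (residue r) = r"
    unfolding residue_def using inv_into_into[of r of_nat "{..<19}"] f_inv_into_f[of r of_nat "{..<19}"] by auto
qed

lemma residue_of_nat: "i < 19 \<Longrightarrow> residue (of_nat i) = i"
  using of_nat_19_eq[of "residue (of_nat i)" i] by simp

definition of_trits :: "F3 list \<Rightarrow> F3 ^ 19" where
  "of_trits l = (\<chi> r. l ! residue r)"

definition trits :: "F3 ^ 19 \<Rightarrow> F3 list" where
  "trits x = map (\<lambda>i. x $ of_nat i) [0..<19]"

lemma length_trits [simp]: "length (trits x) = 19"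
  by (simp add: trits_def)

lemma nth_trits: "i < 19 \<Longrightarrow> trits x ! i = x $ of_nat i"
  by (simp add: trits_def)

lemma trits_of_trits: "length l = 19 \<Longrightarrow> trits (of_trits l) = l"
  by (rule nth_equalityI) (auto simp: nth_trits of_trits_def residue_of_nat)

lemma of_trits_trits: "of_trits (trits x) = x"
  by (simp add: of_trits_def nth_trits vec_eq_iff)

lemma trits_inject: "trits x = trits y \<longleftrightarrow> x = y"
  by (metis of_trits_trits)

text \<open>The product of \<open>F3[X]/(X^19 - 1)\<close>; equivalently, the circulant with first
  column \<open>p\<close> applied to \<open>x\<close>.\<close>

definition conv :: "F3 ^ 19 \<Rightarrow> F3 ^ 19 \<Rightarrow> F3 ^ 19" (infixl "\<star>" 70) where
  "p \<star> x = (\<chi> r. \<Sum>i\<in>UNIV. x $ i * p $ (r - i))"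

lemma conv_nth: "(p \<star> x) $ r = (\<Sum>i\<in>UNIV. x $ i * p $ (r - i))"
  by (simp add: conv_def)

lemma conv_commute: "p \<star> q = q \<star> p"
proof -
  have "(\<Sum>i\<in>UNIV. q $ i * p $ (r - i)) = (\<Sum>i\<in>UNIV. p $ i * q $ (r - i))" for r
    by (rule sum.reindex_bij_witness[of _ "\<lambda>i. r - i" "\<lambda>i. r - i"]) (auto simp: mult.commute)
  then show ?thesis by (simp add: conv_def vec_eq_iff)
qed

lemma conv_assoc: "p \<star> q \<star> x = p \<star> (q \<star> x)"
proof -
  have "(\<Sum>i\<in>UNIV. x $ i * (\<Sum>j\<in>UNIV. q $ j * p $ (r - i - j)))
      = (\<Sum>j\<in>UNIV. (\<Sum>i\<in>UNIV. x $ i * q $ (j - i)) * p $ (r - j))" for r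
  proof -
    have shift: "(\<Sum>j\<in>UNIV. q $ j * p $ (r - i - j)) = (\<Sum>j\<in>UNIV. q $ (j - i) * p $ (r - j))" for i
      by (rule sum.reindex_bij_witness[of _ "\<lambda>j. j - i" "\<lambda>j. j + i"]) (auto simp: algebra_simps)
    have "(\<Sum>i\<in>UNIV. x $ i * (\<Sum>j\<in>UNIV. q $ j * p $ (r - i - j)))
        = (\<Sum>i\<in>UNIV. x $ i * (\<Sum>j\<in>UNIV. q $ (j - i) * p $ (r - j)))"
      by (simp add: shift)
    also have "\<dots> = (\<Sum>j\<in>UNIV. \<Sum>i\<in>UNIV. x $ i * (q $ (j - i) * p $ (r - j)))"
      by (subst sum.swap) (simp add: sum_distrib_left)
    finally show ?thesis by (simp add: sum_distrib_right mult.assoc)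
  qed
  then show ?thesis by (simp add: vec_eq_iff conv_nth)
qed

lemma conv_left_commute: "p \<star> (q \<star> x) = q \<star> (p \<star> x)"
  by (metis conv_assoc conv_commute)

lemmas conv_ac = conv_assoc conv_commute conv_left_commute

lemma conv_add_right: "p \<star> (x + y) = p \<star> x + p \<star> y"
  by (simp add: vec_eq_iff conv_nth distrib_right sum.distrib)

lemma conv_uminus_right: "p \<star> (- x) = - (p \<star> x)"
  by (simp add: vec_eq_iff conv_nth sum_negf)

lemma conv_diff_right: "p \<star> (x - y) = p \<star> x - p \<star> y"
  by (simp add: vec_eq_iff conv_nth left_diff_distrib sum_subtractf)

lemma conv_add_left: "(p + q) \<star> x = p \<star> x + q \<star> x"
  and conv_uminus_left: "(- p) \<star> x = - (p \<star> x)"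
  and conv_diff_left: "(p - q) \<star> x = p \<star> x - q \<star> x"
  by (simp_all add: conv_add_right conv_uminus_right conv_diff_right conv_commute[of _ x])

lemma conv_zero_right [simp]: "p \<star> 0 = 0"
  by (simp add: vec_eq_iff conv_nth)

lemmas conv_algebra = conv_add_right conv_uminus_right conv_diff_right
  conv_add_left conv_uminus_left conv_diff_left

definition unit :: "F3 ^ 19" where
  "unit = axis 0 1"

lemma conv_unit [simp]: "unit \<star> x = x"
proof -
  have "(\<Sum>i\<in>UNIV. unit $ i * x $ (r - i)) = (\<Sum>i\<in>{0}. unit $ i * x $ (r - i))" for r
    by (rule sum.mono_neutral_right) (auto simp: unit_def axis_def)
  then show ?thesis by (subst conv_commute) (simp add: vec_eq_iff conv_nth unit_def axis_def)
qed

definition affine :: "19 \<Rightarrow> 19 \<Rightarrow> F3 ^ 19 \<Rightarrow> F3 ^ 19" where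
  "affine m c x = (\<chi> r. x $ (m * r + c))"

lemma affine_nth: "affine m c x $ r = x $ (m * r + c)"
  by (simp add: affine_def)

lemma affine_linear:
  "affine m c (x + y) = affine m c x + affine m c y" "affine m c (x - y) = affine m c x - affine m c y"
  "affine m c (- x) = - affine m c x" "affine m c 0 = 0"
  by (simp_all add: affine_def vec_eq_iff)

lemma bij_affine:
  assumes "m * m' = (1::19)"
  shows "bij (\<lambda>r. m * r + c)"
proof -
  have "m' * (m * r) = r" "m * (m' * r) = r" for r
    using assms by (metis mult.assoc mult.commute mult_1)+
  then show ?thesis
    by (intro bij_betw_byWitness[where f' = "\<lambda>r. m' * (r - c)"]) simp_all
qed

text \<open>Circulants commute with translations, so the shift \<open>c\<close> is absorbed by
  \<open>x\<close> alone, while the multiplier has to act on both factors.\<close>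

lemma affine_conv:
  assumes "m * m' = (1::19)"
  shows "affine m c (p \<star> x) = affine m 0 p \<star> affine m c x"
proof -
  have "(\<Sum>i\<in>UNIV. x $ i * p $ (m * r + c - i)) = (\<Sum>i\<in>UNIV. x $ (m * i + c) * p $ (m * (r - i)))" for r
    using sum.reindex_bij_betw[OF bij_affine[OF assms, of c], of "\<lambda>i. x $ i * p $ (m * r + c - i)"]
    by (simp add: algebra_simps)
  then show ?thesis by (simp add: vec_eq_iff conv_nth affine_nth)
qed

abbreviation wt :: "F3 ^ 19 \<Rightarrow> nat" where "wt \<equiv> hamming_weight"

lemma wt_affine: "m * m' = (1::19) \<Longrightarrow> wt (affine m c x) = wt x"
proof -
  assume "m * m' = 1"
  from bij_affine[OF this, of c] have "bij_betw (\<lambda>r. m * r + c) {r. x $ (m * r + c) \<noteq> 0} {r. x $ r \<noteq> 0}"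
    by (auto simp: bij_betw_def inj_on_def bij_def)
  then show ?thesis unfolding hamming_weight_def affine_nth by (rule bij_betw_same_card)
qed

lemma wt_uminus [simp]: "hamming_weight (- x :: F3 ^ 'n) = hamming_weight x"
  by (simp add: hamming_weight_def)

lemma wt_eq_0 [simp]: "hamming_weight x = 0 \<longleftrightarrow> x = (0 :: F3 ^ 'n::finite)"
  by (auto simp: hamming_weight_def vec_eq_iff)

lemma wt_0 [simp]: "hamming_weight (0 :: F3 ^ 'n::finite) = 0"
  by simp

lemma length_circ [simp]: "length (circ n p r) = n"
  by (induction n arbitrary: p r) auto

lemma nth_circ: "i < n \<Longrightarrow> circ n p r ! i = rotate i p @ rotate i r"
proof (induction n arbitrary: p r i)
  case (Suc n)
  then show ?case by (cases i) (auto simp: rotate_def funpow_swap1)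
qed simp

lemma length_circ_row: "\<forall>l\<in>set (circ 19 (trits p) (trits r)). length l = 38"
  by (auto simp: in_set_conv_nth nth_circ)

text \<open>Row \<open>i\<close> of a circulant is the cyclic shift by \<open>i\<close> to the left, so it belongs to the residue \<open>-i\<close>.\<close>

lemma comb_circ: "comb (\<lambda>i. x $ (- of_nat i)) (circ 19 (trits p) (trits r)) = trits (p \<star> x) @ trits (r \<star> x)"
proof (rule nth_equalityI)
  fix j assume "j < length (comb (\<lambda>i. x $ (- of_nat i)) (circ 19 (trits p) (trits r)))"
  then have j: "j < 38" by simp
  have rot: "rotate i (trits p) ! k = p $ (of_nat k - (- of_nat i))" if "k < 19" for k i p
    using that by (simp add: nth_rotate nth_trits add.commute flip: of_nat_add)
  have sum: "(\<Sum>i<19. x $ (- of_nat i) * rotate i (trits p) ! k) = (p \<star> x) $ of_nat k" if "k < 19" for k p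
    unfolding conv_nth using sum.reindex_bij_betw[OF bij_minus_of_nat_19, of "\<lambda>i. x $ i * p $ (of_nat k - i)"]
    by (simp add: rot that)
  show "comb (\<lambda>i. x $ (- of_nat i)) (circ 19 (trits p) (trits r)) ! j = (trits (p \<star> x) @ trits (r \<star> x)) ! j"
  proof (cases "j < 19")
    case True
    then show ?thesis using j by (simp add: nth_comb nth_circ nth_append nth_trits sum)
  next
    case False
    then have "j - 19 < 19" using j by simp
    with False show ?thesis using j by (simp add: nth_comb nth_circ nth_append nth_trits sum)
  qed
qed simp

lemma card_residues: "card {i. i < 19 \<and> Q (of_nat i :: 19)} = card {r. Q r}"
  and card_minus_residues: "card {i. i < 19 \<and> Q (- of_nat i :: 19)} = card {r. Q r}"
proof -
  have "bij_betw f {i. i < 19 \<and> Q (f i)} {r. Q r}" if "bij_betw f {..<19} UNIV" for f :: "nat \<Rightarrow> 19"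
    using that by (auto simp: bij_betw_def inj_on_def)
  from bij_betw_same_card[OF this[OF bij_of_nat_19]] bij_betw_same_card[OF this[OF bij_minus_of_nat_19]]
  show "card {i. i < 19 \<and> Q (of_nat i :: 19)} = card {r. Q r}"
    "card {i. i < 19 \<and> Q (- of_nat i :: 19)} = card {r. Q r}" by auto
qed

lemma hdist_trits: "hdist (trits x) (trits y) = wt (x - y)"
proof -
  have "hdist (trits x) (trits y) = card {i. i < 19 \<and> (x - y) $ (of_nat i :: 19) \<noteq> 0}"
    by (subst hdist_conv_card[of _ 19]) (auto simp: nth_trits intro!: arg_cong[where f = card])
  also have "\<dots> = wt (x - y)" unfolding hamming_weight_def by (rule card_residues)
  finally show ?thesis .
qed

section \<open>Orbits of small subsets\<close>

text \<open>
  Representatives of the subsets of the residues modulo 19 of size 2, 3 and 4 under the maps \<open>r \<mapsto> m r + c\<close>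
  with \<open>m \<in> {1, 7, 11}\<close>, the subgroup generated by 7.
\<close>

definition reps2 :: "nat list list" where
  "reps2 = [
    [0, 1], [0, 2], [0, 4]]"

definition reps3 :: "nat list list" where
  "reps3 = [
    [0, 1, 2], [0, 1, 3], [0, 1, 4], [0, 1, 5], [0, 1, 6], [0, 1, 7], [0, 1, 8], [0, 1, 9], [0, 1, 10],
    [0, 1, 12], [0, 1, 14], [0, 1, 15], [0, 1, 16], [0, 1, 17], [0, 2, 4], [0, 2, 5], [0, 2, 6], [0, 2, 15],
    [0, 2, 16], [0, 4, 10], [0, 4, 13]]"

definition reps4 :: "nat list list" where
  "reps4 = [
    [0, 1, 2, 3], [0, 1, 2, 4], [0, 1, 2, 5], [0, 1, 2, 6], [0, 1, 2, 7], [0, 1, 2, 8], [0, 1, 2, 9],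
    [0, 1, 2, 10], [0, 1, 2, 11], [0, 1, 2, 12], [0, 1, 2, 13], [0, 1, 2, 14], [0, 1, 2, 15], [0, 1, 2, 16],
    [0, 1, 2, 17], [0, 1, 3, 4], [0, 1, 3, 5], [0, 1, 3, 6], [0, 1, 3, 7], [0, 1, 3, 8], [0, 1, 3, 9],
    [0, 1, 3, 10], [0, 1, 3, 12], [0, 1, 3, 13], [0, 1, 3, 14], [0, 1, 3, 15], [0, 1, 3, 16], [0, 1, 3, 17],
    [0, 1, 4, 5], [0, 1, 4, 6], [0, 1, 4, 7], [0, 1, 4, 8], [0, 1, 4, 10], [0, 1, 4, 11], [0, 1, 4, 13],
    [0, 1, 4, 14], [0, 1, 4, 15], [0, 1, 4, 16], [0, 1, 4, 17], [0, 1, 5, 6], [0, 1, 5, 7], [0, 1, 5, 8],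
    [0, 1, 5, 9], [0, 1, 5, 10], [0, 1, 5, 11], [0, 1, 5, 14], [0, 1, 5, 15], [0, 1, 6, 7], [0, 1, 6, 9],
    [0, 1, 6, 10], [0, 1, 6, 12], [0, 1, 6, 15], [0, 1, 6, 16], [0, 1, 7, 8], [0, 1, 7, 10], [0, 1, 7, 11],
    [0, 1, 7, 13], [0, 1, 7, 15], [0, 1, 7, 17], [0, 1, 9, 13], [0, 1, 9, 14], [0, 1, 10, 14], [0, 1, 10, 15],
    [0, 1, 10, 16], [0, 1, 12, 17], [0, 1, 14, 16], [0, 1, 14, 17], [0, 1, 15, 17], [0, 2, 4, 6],
    [0, 2, 5, 15], [0, 2, 6, 15], [0, 2, 6, 16]]"

text \<open>Completeness of a list of representatives as a tree search: words over \<open>Z\<close>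
  and \<open>P\<close> are indicators of \<open>k\<close>-subsets of \<open>d\<close> places, and an
  empty branch is acceptable only where no such subset exists.\<close>

primrec full :: "nat \<Rightarrow> nat \<Rightarrow> (nat \<times> F3 list) bag \<Rightarrow> bool" where
  "full k 0 T = (k = 0 \<longrightarrow> set_bag T \<noteq> {})"
| "full k (Suc d) T = (full k d (branch Z (ssplit T)) \<and> (0 < k \<longrightarrow> full (k - 1) d (branch P (ssplit T))))"

definition full_split :: "nat \<Rightarrow> nat \<Rightarrow> (nat \<times> F3 list) bag split \<Rightarrow> bool" where
  "full_split k d t = (full k d (branch Z t) \<and> (0 < k \<longrightarrow> full (k - 1) d (branch P t)))"

lemma full_E: "full k d E = (d < k)"
proof (induction d arbitrary: k)
  case (Suc d)
  have "full k (Suc d) E = (full k d E \<and> (0 < k \<longrightarrow> full (k - 1) d E))" by simp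
  also have "\<dots> = (Suc d < k)" unfolding Suc.IH by linarith
  finally show ?case .
qed simp

lemma full_eval:
  "full k d E = (d < k)"
  "full 0 0 (U i) = True" "full 0 0 (J a b) = (full 0 0 a \<or> full 0 0 b)" "full (Suc k) 0 (U i) = True" "full (Suc k) 0 (J a b) = True"
  "full k (Suc d) (U i) = full_split k d (ssplit (U i))"
  "full k (Suc d) (J a b) = full_split k d (ssplit (J a b))"
  "full_split 0 d (InZ x) = full 0 d x"
  "full_split 0 d (InP y) = full 0 d E"
  "full_split 0 d (InZP x y) = full 0 d x"
  "full_split (Suc k) d (InZ x) = (full (Suc k) d x \<and> full k d E)"
  "full_split (Suc k) d (InP y) = (full (Suc k) d E \<and> full k d y)"
  "full_split (Suc k) d (InZP x y) = (full (Suc k) d x \<and> full k d y)"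
  by (simp_all only: full_E) (simp_all add: full_split_def full_E)

lemma branch_P: "branch P (InZ x) = E" "branch P (InP y) = y" "branch P (InZP x y) = y"
  by simp_all

text \<open>With all budgets 0 the splitting follows each word exactly, so the trees of the
  separation test can be reused as plain sets of words.\<close>

lemma set_bag_branch_ssplit:
  "\<forall>z\<in>set_bag T. fst z = 0 \<and> snd z \<noteq> [] \<Longrightarrow>
    set_bag (branch x (ssplit T)) = {(0, m) | m. (0, x # m) \<in> set_bag T}"
proof (induction T)
  case (U z)
  then obtain y m where z: "z = (0, y # m)" by (cases z; cases "snd z") auto
  show ?case unfolding z by (cases y; cases x) auto
next
  case (J a b)
  then have "set_bag (branch x (ssplit a)) = {(0, m) | m. (0, x # m) \<in> set_bag a}"
    "set_bag (branch x (ssplit b)) = {(0, m) | m. (0, x # m) \<in> set_bag b}" by simp_all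
  then show ?case by auto
qed simp

lemma full_sound:
  assumes "full k d T" "length l = d" "set l \<subseteq> {Z, P}" "length (filter (\<lambda>x. x = P) l) = k" "fst ` set_bag T \<subseteq> {0}"
    "\<forall>(n, l)\<in>set_bag T. length l = d"
  shows "(0, l) \<in> set_bag T"
  using assms
proof (induction d arbitrary: k T l)
  case 0
  then obtain n m where x: "(n, m) \<in> set_bag T" by auto
  then have "n = 0" using 0(5) by (metis fst_conv image_subset_iff singletonD)
  moreover have "m = []" using 0(6) x by auto
  ultimately show ?case using 0(2) x by simp
next
  case (Suc d)
  then obtain x l' where l: "l = x # l'" by (cases l) auto
  have branch: "set_bag (branch x (ssplit T)) = {(0, m) | m. (0, x # m) \<in> set_bag T}"
    using Suc.prems(5,6) by (intro set_bag_branch_ssplit) force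
  have T': "fst ` set_bag (branch x (ssplit T)) \<subseteq> {0}" "\<forall>(n, l)\<in>set_bag (branch x (ssplit T)). length l = d"
    unfolding branch using Suc.prems(6) by auto
  have "(0, l') \<in> set_bag (branch x (ssplit T))"
  proof (cases "x = P")
    case True
    then show ?thesis using Suc.prems l T' by (intro Suc.IH[where k = "k - 1"]) auto
  next
    case False
    then show ?thesis using Suc.prems l T' by (intro Suc.IH[where k = k]) auto
  qed
  then show ?case unfolding branch l by simp
qed

definition indicator_trits :: "nat list \<Rightarrow> F3 list" where
  "indicator_trits is = foldr (\<lambda>i l. l[i := P]) is (replicate 19 Z)"

primrec orbit_rotations :: "nat \<Rightarrow> F3 list \<Rightarrow> (nat \<times> F3 list) bag" where
  "orbit_rotations 0 l = E"
| "orbit_rotations (Suc n) l = join (U (0, l)) (orbit_rotations n (rotate1 l))"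

definition permute :: "nat list \<Rightarrow> F3 list \<Rightarrow> F3 list" where
  "permute is l = map ((!) l) is"

definition "times7 = [0, 7, 14, 2, 9, 16, 4, 11, 18, 6, 13, 1, 8, 15, 3, 10, 17, 5, 12 :: nat]"

text \<open>Applying \<open>times7\<close> twice gives the multiplier 49, which is 11; with the 19
  rotations this yields the images under all 57 maps.\<close>

primrec orbits :: "nat list list \<Rightarrow> (nat \<times> F3 list) bag list" where
  "orbits [] = []"
| "orbits (is # iss) = (let l = indicator_trits is; m = permute times7 l in
    join (orbit_rotations 19 l) (join (orbit_rotations 19 m) (orbit_rotations 19 (permute times7 m)))) # orbits iss"

lemmas cover_rules = join_eval merge.simps ssplit_eval full_eval indicator_trits_def orbit_rotations.simps permute_def
  times7_def orbits.simps Let_def list_update_code rotate1.simps append.simps list.map foldr.simps comp_apply id_apply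
  nth_Cons_0 nth_Cons_Suc replicate.simps pairs.simps build.simps One_nat_def eval_nat_numeral BitM.simps simp_thms(21)
  branch_P less_Suc0 Suc_less_eq zero_less_Suc not_less0 simp_thms(22,29)

definition of_indices :: "nat list \<Rightarrow> F3 ^ 19" where
  "of_indices is = (\<chi> r. if r \<in> of_nat ` set is then 1 else 0)"

lemma indicator_trits: "set is \<subseteq> {..<19} \<Longrightarrow> indicator_trits is = trits (of_indices is)"
proof -
  assume "set is \<subseteq> {..<19}"
  then have "length (indicator_trits is) = 19 \<and> (\<forall>k<19. indicator_trits is ! k = (if k \<in> set is then P else Z))"
    by (induction "is") (auto simp: indicator_trits_def nth_list_update)
  moreover have "of_nat k \<in> (of_nat ` set is :: 19 set) \<longleftrightarrow> k \<in> set is" if "k < 19" for k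
    using that \<open>set is \<subseteq> {..<19}\<close> by (force simp: of_nat_19_eq)
  ultimately show ?thesis
    by (intro nth_equalityI) (auto simp: nth_trits of_indices_def F3_constants)
qed

lemma rotate1_trits: "rotate1 (trits x) = trits (affine 1 1 x)"
proof (rule nth_equalityI)
  fix k assume "k < length (rotate1 (trits x))"
  then have "k < 19" by simp
  then show "rotate1 (trits x) ! k = trits (affine 1 1 x) ! k"
    by (simp add: nth_rotate1 nth_trits affine_nth add.commute)
qed simp

lemma affine_affine: "affine m c (affine m' c' x) = affine (m' * m) (m' * c + c') x"
  by (simp add: affine_def vec_eq_iff algebra_simps)

lemma orbit_rotations_trits:
  "set_bag (orbit_rotations n (trits x)) = (\<lambda>k. (0, trits (affine 1 (of_nat k) x))) ` {..<n}"
proof (induction n arbitrary: x)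
  case (Suc n)
  have "affine 1 0 x = x" by (simp add: affine_def)
  then show ?case
    by (simp add: rotate1_trits Suc.IH affine_affine lessThan_Suc_eq_insert_0 image_image add.commute)
qed simp

lemma permute_times7: "permute times7 (trits x) = trits (affine 7 0 x)"
proof (rule nth_equalityI)
  fix k assume k: "k < length (permute times7 (trits x))"
  then have k: "k < 19" by (simp add: permute_def times7_def)
  have "times7 = map (\<lambda>k. 7 * k mod 19) [0..<19]" by (simp add: times7_def upt_rec)
  then have "times7 ! k = map (\<lambda>k. 7 * k mod 19) [0..<19] ! k" by (rule arg_cong)
  then have t: "times7 ! k = 7 * k mod 19" using k by (simp del: upt_rec_numeral)
  have len: "length times7 = 19" by (simp add: times7_def)
  have "permute times7 (trits x) ! k = trits x ! (7 * k mod 19)" using k len t by (simp add: permute_def)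
  also have "\<dots> = x $ of_nat (7 * k)" by (simp add: nth_trits)
  finally show "permute times7 (trits x) ! k = trits (affine 7 0 x) ! k"
    using k by (simp add: nth_trits affine_nth)
qed (simp add: permute_def times7_def)

lemma orbits_sound:
  assumes "(n, l) \<in> \<Union> (set_bag ` set (orbits reps))" "\<forall>is\<in>set reps. set is \<subseteq> {..<19}"
  shows "n = 0 \<and> (\<exists>is\<in>set reps. \<exists>m\<in>{1, 7, 11}. \<exists>c. l = trits (affine m c (of_indices is)))"
  using assms
proof (induction reps)
  case (Cons "is" reps)
  have "set is \<subseteq> {..<19}" using Cons.prems(2) by simp
  moreover have "(49 :: 19) = 11" by simp
  ultimately have head: "set_bag (hd (orbits (is # reps))) \<subseteq>
      {(0, trits (affine m c (of_indices is))) | m c. m \<in> {1, 7, 11}}"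
    by (auto simp: Let_def indicator_trits permute_times7 orbit_rotations_trits affine_affine
        simp del: orbit_rotations.simps)
  have "(n, l) \<in> set_bag (hd (orbits (is # reps))) \<or> (n, l) \<in> \<Union> (set_bag ` set (orbits reps))"
    using Cons.prems(1) by (auto simp: Let_def)
  then show ?case
  proof
    assume "(n, l) \<in> set_bag (hd (orbits (is # reps)))"
    then show ?thesis using head by auto
  next
    assume "(n, l) \<in> \<Union> (set_bag ` set (orbits reps))"
    from Cons.IH[OF this] Cons.prems(2) show ?thesis by auto
  qed
qed simp

text \<open>A translation moves some element of the subset to 0. This accounts for the leading
  \<open>P\<close> and leaves one element fewer to place among the other 18 residues.\<close>

lemma cover2: "full 1 18 (branch P (ssplit (build 4 (orbits reps2))))"
  by (simp only: cover_rules reps2_def)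

lemma cover3: "full 2 18 (branch P (ssplit (build 4 (orbits reps3))))"
  by (simp only: cover_rules reps3_def)

lemma cover4: "full 3 18 (branch P (ssplit (build 6 (orbits reps4))))"
  by (simp only: cover_rules reps4_def)

definition reps :: "nat \<Rightarrow> nat list list" where
  "reps w = (if w = 1 then [[0]] else if w = 2 then reps2 else if w = 3 then reps3 else reps4)"

lemma reps_valid:
  assumes "1 \<le> w" "w \<le> 4" "is \<in> set (reps w)"
  shows "length is = w \<and> hd is = 0 \<and> distinct is \<and> set is \<subseteq> {..<19}"
proof -
  have "list_all (\<lambda>is. length is = 2 \<and> hd is = 0 \<and> distinct is \<and> set is \<subseteq> {..<19}) reps2"
    "list_all (\<lambda>is. length is = 3 \<and> hd is = 0 \<and> distinct is \<and> set is \<subseteq> {..<19}) reps3"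
    "list_all (\<lambda>is. length is = 4 \<and> hd is = 0 \<and> distinct is \<and> set is \<subseteq> {..<19}) reps4"
    by (simp_all add: reps2_def reps3_def reps4_def)
  moreover have "w = 1 \<or> w = 2 \<or> w = 3 \<or> w = 4" using assms by linarith
  ultimately show ?thesis using assms(3) by (auto simp: reps_def list_all_iff)
qed

lemma orbits_cover_aux:
  fixes B :: "19 set"
  assumes full: "full w 18 (branch P (ssplit (build k (orbits rs))))" and card: "card B = Suc w"
    and rs: "\<forall>is\<in>set rs. set is \<subseteq> {..<19}"
  shows "\<exists>is\<in>set rs. \<exists>m\<in>{1, 7, 11}. \<exists>c. \<forall>i. i \<in> B \<longleftrightarrow> m * i + c \<in> of_nat ` set is"
proof -
  define T where "T = build k (orbits rs)"
  obtain b where b: "b \<in> B" using card by fastforce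
  \<comment> \<open>Translating by \<open>- b\<close> brings 0 into the set, so its indicator word
    begins with \<open>P\<close>.\<close>
  define x :: "F3 ^ 19" where "x = (\<chi> r. if r + b \<in> B then 1 else 0)"
  have T: "\<exists>is\<in>set rs. \<exists>m\<in>{1, 7, 11}. \<exists>c. l = trits (affine m c (of_indices is))" "n = 0"
    if "(n, l) \<in> set_bag T" for n l
    using orbits_sound[OF _ rs, of n l] that by (simp_all add: T_def set_bag_build)
  have branch: "set_bag (branch P (ssplit T)) = {(0, m) | m. (0, P # m) \<in> set_bag T}"
  proof (rule set_bag_branch_ssplit, intro ballI)
    fix z assume "z \<in> set_bag T"
    with T[of "fst z" "snd z"] show "fst z = 0 \<and> snd z \<noteq> []"
      by (auto simp: trits_def)
  qed
  obtain l where l: "trits x = P # l"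
  proof -
    have "trits x = hd (trits x) # tl (trits x)" by (simp add: trits_def upt_rec)
    moreover have "hd (trits x) = x $ 0" by (simp add: trits_def upt_rec)
    ultimately show ?thesis using b that[of "tl (trits x)"] by (simp add: x_def F3_constants)
  qed
  have len: "length l = 18" using arg_cong[OF l, of length] by simp
  have "length (filter (\<lambda>z. z = P) (trits x)) = card {i. i < 19 \<and> of_nat i + b \<in> B}"
    by (auto simp: length_filter_conv_card nth_trits x_def F3_constants split: if_splits intro!: arg_cong[where f = card])
  also have "\<dots> = card {r. r + b \<in> B}" by (rule card_residues)
  also have "\<dots> = card B"
    by (rule bij_betw_same_card[of "\<lambda>r. r + b"], rule bij_betw_byWitness[where f' = "\<lambda>r. r - b"]) auto
  finally have "length (filter (\<lambda>z. z = P) l) = w" using l card by simp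
  moreover have "set l \<subseteq> {Z, P}"
  proof -
    have "set (trits x) \<subseteq> {Z, P}" by (auto simp: trits_def x_def F3_constants)
    then show ?thesis using l by simp
  qed
  moreover have "fst ` set_bag (branch P (ssplit T)) \<subseteq> {0}" unfolding branch by auto
  moreover have "\<forall>(n, l)\<in>set_bag (branch P (ssplit T)). length l = 18"
  proof -
    have "length m = 18" if "(0, P # m) \<in> set_bag T" for m
      using T(1)[OF that] by (metis length_trits length_Cons add_2_eq_Suc' diff_Suc_1 numeral_eq_Suc pred_numeral_simps(3) Suc_inject)
    then show ?thesis unfolding branch by auto
  qed
  ultimately have "(0, l) \<in> set_bag (branch P (ssplit T))"
    using full len unfolding T_def[symmetric] by (intro full_sound[where k = w]) auto
  then have "(0, trits x) \<in> set_bag T" unfolding branch l by simp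
  from T(1)[OF this] obtain "is" m c where "is": "is \<in> set rs" "m \<in> {1, 7, 11}" "x = affine m c (of_indices is)"
    by (auto simp: trits_inject)
  have "i \<in> B \<longleftrightarrow> m * i + (c - m * b) \<in> of_nat ` set is" for i
  proof -
    have "i \<in> B \<longleftrightarrow> x $ (i - b) = 1" by (simp add: x_def)
    also have "\<dots> \<longleftrightarrow> m * (i - b) + c \<in> of_nat ` set is" by (simp add: "is"(3) affine_nth of_indices_def)
    finally show ?thesis by (simp add: algebra_simps)
  qed
  then show ?thesis using "is"(1,2) by blast
qed

lemma orbits_cover:
  fixes B :: "19 set"
  assumes "1 \<le> card B" "card B \<le> 4"
  shows "\<exists>is\<in>set (reps (card B)). \<exists>m\<in>{1, 7, 11}. \<exists>c. \<forall>i. i \<in> B \<longleftrightarrow> m * i + c \<in> of_nat ` set is"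
proof -
  have valid: "\<forall>is\<in>set (reps (card B)). set is \<subseteq> {..<19}" using reps_valid[OF assms] by blast
  consider "card B = 1" | "card B = Suc 1" | "card B = Suc 2" | "card B = Suc 3" using assms by linarith
  then show ?thesis
  proof cases
    case 1
    then obtain b where "B = {b}" by (auto simp: card_1_singleton_iff)
    then show ?thesis by (auto simp: reps_def intro!: exI[of _ "- b"])
  next
    case 2
    with valid show ?thesis using orbits_cover_aux[OF cover2 2] by (simp add: reps_def)
  next
    case 3
    with valid show ?thesis using orbits_cover_aux[OF cover3 3] by (simp add: reps_def)
  next
    case 4
    with valid show ?thesis using orbits_cover_aux[OF cover4 4] by (simp add: reps_def)
  qed
qed

text \<open>Row \<open>i\<close> carries the coefficient at \<open>- i\<close>, hence the sign in
  the support. Every representative starts with 0, and the coefficient there is scaled to 1.\<close>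

definition normal :: "F3 ^ 19 \<Rightarrow> bool" where
  "normal s \<longleftrightarrow> s $ 0 = 1 \<and> (\<exists>is\<in>set (reps (wt s)). {i. i < 19 \<and> s $ (- of_nat i) \<noteq> 0} = set is)"

lemma normalize:
  assumes "1 \<le> wt s" "wt s \<le> 4"
  obtains m m' c e where "m \<in> {1, 7, 11}" "m * m' = 1" "e = 1 \<or> e = -1" "normal (e *s affine m c s)"
proof -
  define B where "B = {i. s $ (- i) \<noteq> 0}"
  have "card B = wt s" unfolding B_def hamming_weight_def
    by (rule bij_betw_same_card[of uminus], rule bij_betw_byWitness[where f' = uminus]) auto
  then have "\<exists>is\<in>set (reps (wt s)). \<exists>m\<in>{1, 7, 11}. \<exists>c. \<forall>i. i \<in> B \<longleftrightarrow> m * i + c \<in> of_nat ` set is"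
    using orbits_cover[of B] assms by simp
  then obtain "is" m c where
    "is": "is \<in> set (reps (wt s))" "m \<in> {1, 7, 11}" "\<forall>i. i \<in> B \<longleftrightarrow> m * i + c \<in> of_nat ` set is" by blast
  \<comment> \<open>The inverse of \<open>m\<close>: 7 times 11 is 77, which is 1 modulo 19.\<close>
  define m' where "m' = (if m = 1 then 1 else if m = 7 then 11 else 7 :: 19)"
  have m': "m' \<in> {1, 7, 11}" "m' * m = 1" using "is"(2) by (auto simp: m'_def)
  \<comment> \<open>The entry of \<open>x\<close> at \<open>- j\<close> is the entry of
    \<open>s\<close> at \<open>- (m' * j - m' * c)\<close>, and
    \<open>m * (m' * j - m' * c) + c = j\<close>.\<close>
  define x where "x = affine m' (m' * c) s"
  note valid = reps_valid[OF assms "is"(1)]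
  have x: "x $ (- j) \<noteq> 0 \<longleftrightarrow> j \<in> of_nat ` set is" for j
  proof -
    have "x $ (- j) \<noteq> 0 \<longleftrightarrow> m' * j - m' * c \<in> B" by (simp add: x_def B_def affine_nth algebra_simps)
    also have "\<dots> \<longleftrightarrow> m * m' * j - m * m' * c + c \<in> of_nat ` set is" using "is"(3)[rule_format, of "m' * j - m' * c"] by (simp add: algebra_simps)
    finally show ?thesis using m'(2) by (simp add: mult.commute)
  qed
  have x0: "x $ 0 \<noteq> 0" using x[of 0] valid assms(1)
    by (metis image_eqI list.set_sel(1) list.size(3) minus_zero not_one_le_zero of_nat_0)
  \<comment> \<open>Nonzero elements of \<open>F3\<close> are their own inverses, so scaling by the
    entry itself turns it into 1.\<close>
  define e where "e = x $ 0"
  have e: "e = 1 \<or> e = -1" using x0 F3_cases unfolding e_def by blast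
  then have ee: "e * e = 1" and e0: "e \<noteq> 0" by auto
  have wt: "wt (e *s x) = wt s"
  proof -
    have "wt (e *s x) = wt x" using e0 by (simp add: hamming_weight_def)
    then show ?thesis using wt_affine[OF m'(2)] by (simp add: x_def)
  qed
  have "normal (e *s x)"
    unfolding normal_def wt
  proof (intro conjI bexI[OF _ "is"(1)])
    show "(e *s x) $ 0 = 1" using ee by (simp add: e_def)
    show "{i. i < 19 \<and> (e *s x) $ (- of_nat i) \<noteq> 0} = set is"
    proof -
      have "of_nat i \<in> (of_nat ` set is :: 19 set) \<longleftrightarrow> i \<in> set is" if "i < 19" for i
        using that valid by (force simp: of_nat_19_eq)
      then show ?thesis using e0 x valid by auto
    qed
  qed
  then show ?thesis using that m' e unfolding x_def by blast
qed

section \<open>Separation of combinations of rows\<close>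

definition rows :: "nat \<Rightarrow> F3 list \<Rightarrow> F3 list \<Rightarrow> (F3 list \<times> F3 list) list" where
  "rows k p r = pairneg (turn k (circ 19 p r))"

text \<open>The budgets 2 and 3 are \<open>6 - wt s\<close> for supports of size 4 and 3. A distance
  above \<open>12 - wt s\<close> together with \<open>wt t = 3\<close> makes the total exceed
  15.\<close>

definition apart3 :: "nat \<Rightarrow> nat \<Rightarrow> F3 list \<Rightarrow> F3 list \<Rightarrow> F3 list \<Rightarrow> F3 list \<Rightarrow> bool" where
  "apart3 k d p q r u = sep 6 d
    (build 7 (sreps 2 (rows k q u) reps4 @ sreps 3 (rows k q u) reps3))
    (tsums 3 zeros (rows k p r))"

text \<open>Nine plus the budget is \<open>15 - wt s\<close>, so the total exceeds 15 without
  counting \<open>t\<close>. In the second tree, single rows of \<open>q\<close> and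
  \<open>u\<close> represent a fifth nonzero entry beside \<open>s\<close>; the other entries are
  zero and the sums of one or two rows of \<open>p\<close> and \<open>r\<close>.\<close>

definition apart2 :: "nat \<Rightarrow> nat \<Rightarrow> F3 list \<Rightarrow> F3 list \<Rightarrow> F3 list \<Rightarrow> F3 list \<Rightarrow> bool" where
  "apart2 k d p q r u = sep 9 d
    (build 7 (sreps 2 (rows k q u) reps4 @ sreps 3 (rows k q u) reps3 @ sreps 4 (rows k q u) reps2))
    (join (U (zeros, zeros)) (join (tsums 1 zeros (rows k q u)) (join (tsums 1 zeros (rows k p r)) (tsums 2 zeros (rows k p r)))))"

definition apart1 :: "F3 list \<Rightarrow> F3 list \<Rightarrow> F3 list \<Rightarrow> F3 list \<Rightarrow> bool" where
  "apart1 p q r u = sep 14 0 (build 0 (sreps 0 (rows 0 q u) [[0]])) (join (U (zeros, zeros)) (tsums 1 zeros (rows 0 p r)))"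

definition far_heavy :: "F3 ^ 19 \<Rightarrow> F3 ^ 19 \<Rightarrow> F3 ^ 19 \<Rightarrow> F3 ^ 19 \<Rightarrow> bool" where
  "far_heavy p q r u \<longleftrightarrow> (\<forall>(k, d)\<in>{(0, 13), (13, 13), (26, 12)}. apart3 k d (trits p) (trits q) (trits r) (trits u))"

definition far_light :: "F3 ^ 19 \<Rightarrow> F3 ^ 19 \<Rightarrow> F3 ^ 19 \<Rightarrow> F3 ^ 19 \<Rightarrow> bool" where
  "far_light p q r u \<longleftrightarrow> apart1 (trits p) (trits q) (trits r) (trits u) \<and>
    (\<forall>(k, d)\<in>{(0, 10), (10, 10), (20, 9), (29, 9)}. apart2 k d (trits p) (trits q) (trits r) (trits u))"

lemma circ_comb_spin:
  "comb (\<lambda>i. x $ (- of_nat i)) (turn k (circ 19 (trits p) (trits r))) = spin k (trits (p \<star> x) @ trits (r \<star> x))"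
  by (simp add: comb_turn[OF length_circ_row] comb_circ)

lemma length_turned_row: "\<forall>l\<in>set (turn k (circ 19 (trits p) (trits r))). length l = 38"
  using length_circ_row by (auto simp: turn_spin)

lemma sreps_normal:
  assumes "normal s" "1 \<le> wt s" "wt s \<le> 4"
  shows "(n, spin k (trits (q \<star> s) @ trits (u \<star> s))) \<in>
    \<Union> (set_bag ` set (sreps n (rows k (trits q) (trits u)) (reps (wt s))))"
proof -
  obtain "is" where "is": "is \<in> set (reps (wt s))" "{i. i < 19 \<and> s $ (- of_nat i) \<noteq> 0} = set is"
    and s0: "s $ 0 = 1" using assms(1) by (auto simp: normal_def)
  note valid = reps_valid[OF assms(2,3) "is"(1)]
  obtain js where js: "is = 0 # js" using valid assms(2) by (cases "is") auto
  have "length (turn k (circ 19 (trits q) (trits u))) = 19" by (simp add: turn_spin)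
  then have "(n, comb (\<lambda>i. s $ (- of_nat i)) (turn k (circ 19 (trits q) (trits u)))) \<in>
      \<Union> (set_bag ` set (sreps n (pairneg (turn k (circ 19 (trits q) (trits u)))) (reps (wt s))))"
    using "is" valid s0 unfolding js by (intro sreps_sound[OF _ _ _ length_turned_row]) auto
  then show ?thesis by (simp add: rows_def circ_comb_spin)
qed

lemma tsums_rows:
  "\<exists>(v, w)\<in>set_bag (tsums (wt t) zeros (rows k (trits p) (trits r))). add v w = spin k (trits (p \<star> t) @ trits (r \<star> t))"
proof -
  let ?c = "\<lambda>i. t $ (- of_nat i)" and ?rs = "turn k (circ 19 (trits p) (trits r))"
  have "card {i. i < length ?rs \<and> ?c i \<noteq> 0} = wt t"
    unfolding hamming_weight_def by (simp add: turn_spin card_minus_residues[of "\<lambda>r. t $ r \<noteq> 0"])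
  from tsums_sound[OF length_zeros length_turned_row this]
  obtain v w where vw: "(v, w) \<in> set_bag (tsums (wt t) zeros (pairneg ?rs))" "add v w = add zeros (comb ?c ?rs)" by auto
  have "add zeros (comb ?c ?rs) = comb ?c ?rs"
    by (rule nth_equalityI) (auto simp: nth_add nth_zeros)
  then show ?thesis using vw unfolding rows_def circ_comb_spin by (intro bexI[of _ "(v, w)"]) auto
qed

lemma hdist_blocks:
  "hdist (trits x @ trits y) (trits x' @ trits y') = wt (x - x') + wt (y - y')"
  by (simp add: hdist_append hdist_trits)

text \<open>Pigeonhole: more than \<open>n\<close> mismatches in each of the three windows would
  give a distance of at least \<open>3 * n + 3\<close>, which exceeds \<open>6 + n\<close> once
  \<open>n\<close> is at least 2.\<close>

lemma sep_three_windows: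
  assumes "\<forall>(k, d)\<in>{(0, 13), (13, 13), (26, 12)}. sep 6 d (S k) (T k)"
    and "\<And>k. (n, spin k l) \<in> set_bag (S k)" "\<And>k. \<exists>(v, w)\<in>set_bag (T k). add v w = spin k m"
    and "length l = 38" "length m = 38" "2 \<le> n"
  shows "6 + n < hdist l m"
proof (rule ccontr)
  assume near: "\<not> ?thesis"
  then have "\<exists>(k, d)\<in>{(0, 13), (13, 13), (26, 12)}. hdist (take d (spin k l)) (take d (spin k m)) \<le> n"
    using hdist_three[OF assms(4,5)] assms(6) by auto
  then obtain k d where kd: "(k, d) \<in> {(0, 13), (13, 13), (26, 12)}" "hdist (take d (spin k l)) (take d (spin k m)) \<le> n"
    by auto
  obtain v w where vw: "(v, w) \<in> set_bag (T k)" "add v w = spin k m" using assms(3) by blast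
  have "6 + n < hdist (spin k l) (spin k m)"
    using assms(1) kd assms(4,5) by (intro sep_sound[OF _ assms(2) vw]) auto
  then show False using near assms(4,5) by (simp add: hdist_spin)
qed

text \<open>The larger excess 9 calls for a fourth window: \<open>4 * n + 4\<close> exceeds
  \<open>9 + n\<close> once \<open>n\<close> is at least 2.\<close>

lemma sep_four_windows:
  assumes "\<forall>(k, d)\<in>{(0, 10), (10, 10), (20, 9), (29, 9)}. sep 9 d (S k) (T k)"
    and "\<And>k. (n, spin k l) \<in> set_bag (S k)" "\<And>k. \<exists>(v, w)\<in>set_bag (T k). add v w = spin k m"
    and "length l = 38" "length m = 38" "2 \<le> n"
  shows "9 + n < hdist l m"
proof (rule ccontr)
  assume near: "\<not> ?thesis"
  then have "\<exists>(k, d)\<in>{(0, 10), (10, 10), (20, 9), (29, 9)}. hdist (take d (spin k l)) (take d (spin k m)) \<le> n"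
    using hdist_four[OF assms(4,5)] assms(6) by auto
  then obtain k d where kd: "(k, d) \<in> {(0, 10), (10, 10), (20, 9), (29, 9)}" "hdist (take d (spin k l)) (take d (spin k m)) \<le> n"
    by auto
  obtain v w where vw: "(v, w) \<in> set_bag (T k)" "add v w = spin k m" using assms(3) by blast
  have "9 + n < hdist (spin k l) (spin k m)"
    using assms(1) kd assms(4,5) by (intro sep_sound[OF _ assms(2) vw]) auto
  then show False using near assms(4,5) by (simp add: hdist_spin)
qed

text \<open>Separation measures differences while the code forms sums, which is why \<open>t\<close>
  is negated; the enumeration of signed rows covers both signs.\<close>

lemma blocks_diff:
  "hdist (trits (q \<star> s) @ trits (u \<star> s)) (trits (p \<star> (- t)) @ trits (r \<star> (- t))) =
    wt (p \<star> t + q \<star> s) + wt (r \<star> t + u \<star> s)"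
  by (simp add: hdist_blocks conv_uminus_right add.commute)

lemma heavy_normal:
  assumes "far_heavy p q r u" "normal s" "wt s = 3 \<or> wt s = 4" "wt t = 3"
  shows "12 < wt s + wt (p \<star> t + q \<star> s) + wt (r \<star> t + u \<star> s)"
proof -
  have "6 + (6 - wt s) < hdist (trits (q \<star> s) @ trits (u \<star> s)) (trits (p \<star> (- t)) @ trits (r \<star> (- t)))"
  proof (rule sep_three_windows)
    show "\<forall>(k, d)\<in>{(0, 13), (13, 13), (26, 12)}. sep 6 d
        (build 7 (sreps 2 (rows k (trits q) (trits u)) reps4 @ sreps 3 (rows k (trits q) (trits u)) reps3))
        (tsums 3 zeros (rows k (trits p) (trits r)))"
      using assms(1) by (simp add: far_heavy_def apart3_def)
    show "(6 - wt s, spin k (trits (q \<star> s) @ trits (u \<star> s))) \<in> set_bag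
        (build 7 (sreps 2 (rows k (trits q) (trits u)) reps4 @ sreps 3 (rows k (trits q) (trits u)) reps3))" for k
      using sreps_normal[OF assms(2), of "6 - wt s" k q u] assms(3) by (auto simp: set_bag_build reps_def)
    show "\<exists>(v, w)\<in>set_bag (tsums 3 zeros (rows k (trits p) (trits r))).
        add v w = spin k (trits (p \<star> (- t)) @ trits (r \<star> (- t)))" for k
      using tsums_rows[of "- t" k p r] assms(4) by simp
  qed (use assms(3) in auto)
  then show ?thesis using assms(3) unfolding blocks_diff by auto
qed

text \<open>The vector \<open>f\<close> allows for a fifth nonzero entry in the block of \<open>s\<close>.\<close>

lemma light_normal:
  assumes "far_light p q r u" "normal s" "2 \<le> wt s" "wt s \<le> 4" "f = 0 \<and> wt t \<le> 2 \<or> t = 0 \<and> wt f = 1"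
  shows "15 < wt s + wt (p \<star> t + q \<star> (s + f)) + wt (r \<star> t + u \<star> (s + f))"
proof -
  have "9 + (6 - wt s) < hdist (trits (q \<star> s) @ trits (u \<star> s))
      (trits (p \<star> (- t) + q \<star> (- f)) @ trits (r \<star> (- t) + u \<star> (- f)))"
  proof (rule sep_four_windows)
    show "\<forall>(k, d)\<in>{(0, 10), (10, 10), (20, 9), (29, 9)}. sep 9 d
        (build 7 (sreps 2 (rows k (trits q) (trits u)) reps4 @ sreps 3 (rows k (trits q) (trits u)) reps3
          @ sreps 4 (rows k (trits q) (trits u)) reps2))
        (join (U (zeros, zeros)) (join (tsums 1 zeros (rows k (trits q) (trits u)))
          (join (tsums 1 zeros (rows k (trits p) (trits r))) (tsums 2 zeros (rows k (trits p) (trits r))))))"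
      using assms(1) by (simp add: far_light_def apart2_def)
    have w: "wt s = 2 \<or> wt s = 3 \<or> wt s = 4" using assms by linarith
    show "(6 - wt s, spin k (trits (q \<star> s) @ trits (u \<star> s))) \<in> set_bag
        (build 7 (sreps 2 (rows k (trits q) (trits u)) reps4 @ sreps 3 (rows k (trits q) (trits u)) reps3
          @ sreps 4 (rows k (trits q) (trits u)) reps2))" for k
      using sreps_normal[OF assms(2), of "6 - wt s" k q u] w by (auto simp: set_bag_build reps_def)
    show "\<exists>(v, w)\<in>set_bag (join (U (zeros, zeros)) (join (tsums 1 zeros (rows k (trits q) (trits u)))
          (join (tsums 1 zeros (rows k (trits p) (trits r))) (tsums 2 zeros (rows k (trits p) (trits r)))))).
        add v w = spin k (trits (p \<star> (- t) + q \<star> (- f)) @ trits (r \<star> (- t) + u \<star> (- f)))" for k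
    proof -
      consider "t = 0" "f = 0" | "f = 0" "wt t = 1" | "f = 0" "wt t = 2" | "t = 0" "wt f = 1"
        using assms(5) by (metis One_nat_def Suc_1 le_SucE le_zero_eq wt_eq_0)
      then show ?thesis
      proof cases
        case 1
        have "trits 0 @ trits 0 = zeros" by (rule nth_equalityI) (auto simp: nth_append nth_trits nth_zeros)
        moreover have "add zeros zeros = zeros" by (rule nth_equalityI) (auto simp: nth_add nth_zeros)
        moreover have "spin k zeros = zeros" by (simp add: spin_def zeros_def min_def flip: replicate_add)
        ultimately show ?thesis using 1 by simp
      next
        case 2
        then show ?thesis using tsums_rows[of "- t" k p r] by auto
      next
        case 3
        then show ?thesis using tsums_rows[of "- t" k p r] by auto
      next
        case 4
        then show ?thesis using tsums_rows[of "- f" k q u] by auto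
      qed
    qed
  qed (use assms in auto)
  moreover have "q \<star> s - (p \<star> (- t) + q \<star> (- f)) = p \<star> t + q \<star> (s + f)"
    "u \<star> s - (r \<star> (- t) + u \<star> (- f)) = r \<star> t + u \<star> (s + f)"
    by (simp_all add: conv_algebra)
  ultimately show ?thesis using assms(4) unfolding hdist_blocks by simp
qed

lemma single_normal:
  assumes "far_light p q r u" "normal s" "wt s = 1" "wt t \<le> 1"
  shows "14 < wt (p \<star> t + q \<star> s) + wt (r \<star> t + u \<star> s)"
proof -
  have S: "(0, spin 0 (trits (q \<star> s) @ trits (u \<star> s))) \<in> set_bag (build 0 (sreps 0 (rows 0 (trits q) (trits u)) [[0]]))"
    using sreps_normal[OF assms(2), of 0 0 q u] assms(3) unfolding set_bag_build by (simp add: reps_def)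
  have T: "\<exists>(v, w)\<in>set_bag (join (U (zeros, zeros)) (tsums 1 zeros (rows 0 (trits p) (trits r)))).
        add v w = spin 0 (trits (p \<star> (- t)) @ trits (r \<star> (- t)))"
  proof -
    consider "t = 0" | "wt t = 1" using assms(4) by (metis One_nat_def le_SucE le_zero_eq wt_eq_0)
    then show ?thesis
    proof cases
      case 1
      have "trits 0 @ trits 0 = zeros" by (rule nth_equalityI) (auto simp: nth_append nth_trits nth_zeros)
      moreover have "add zeros zeros = zeros" by (rule nth_equalityI) (auto simp: nth_add nth_zeros)
      ultimately show ?thesis using 1 by (simp add: spin_def)
    next
      case 2
      then show ?thesis using tsums_rows[of "- t" 0 p r] by auto
    qed
  qed
  then obtain v w where vw: "(v, w) \<in> set_bag (join (U (zeros, zeros)) (tsums 1 zeros (rows 0 (trits p) (trits r))))"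
    "add v w = spin 0 (trits (p \<star> (- t)) @ trits (r \<star> (- t)))" by auto
  have "sep 14 0 (build 0 (sreps 0 (rows 0 (trits q) (trits u)) [[0]]))
      (join (U (zeros, zeros)) (tsums 1 zeros (rows 0 (trits p) (trits r))))"
    using assms(1) by (simp only: far_light_def apart1_def)
  from sep_sound[OF this S vw] show ?thesis by (simp add: hdist_spin blocks_diff)
qed

section \<open>Block-circulant codes\<close>

text \<open>\<open>t\<close> and \<open>s\<close> are two blocks of a codeword, and the remaining
  two are computed from them. The coefficients depend on which block is paired with the first
  one.\<close>

definition heavier :: "F3 ^ 19 \<Rightarrow> F3 ^ 19 \<Rightarrow> F3 ^ 19 \<Rightarrow> F3 ^ 19 \<Rightarrow> F3 ^ 19 \<Rightarrow> F3 ^ 19 \<Rightarrow> bool" where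
  "heavier p q r u t s \<longleftrightarrow> 15 < wt t + wt s + wt (p \<star> t + q \<star> s) + wt (r \<star> t + u \<star> s)"

lemma conv_scale: "p \<star> (e *s x) = e *s (p \<star> x)"
  by (simp add: vec_eq_iff conv_nth sum_distrib_left mult.assoc)

lemma wt_scale: "e \<noteq> 0 \<Longrightarrow> wt (e *s x) = wt x"
  by (simp add: hamming_weight_def)

lemma heavier_affine:
  assumes "m * m' = (1::19)" "e \<noteq> 0"
  shows "heavier (affine m 0 p) (affine m 0 q) (affine m 0 r) (affine m 0 u) (e *s affine m c t) (e *s affine m c s)
    \<longleftrightarrow> heavier p q r u t s"
proof -
  have "affine m 0 p \<star> (e *s affine m c t) + affine m 0 q \<star> (e *s affine m c s) = e *s affine m c (p \<star> t + q \<star> s)" for p q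
    by (simp add: conv_scale affine_conv[OF assms(1)] affine_linear vector_add_ldistrib)
  then show ?thesis by (simp add: heavier_def wt_scale assms wt_affine[OF assms(1)])
qed

definition invariant7 :: "F3 ^ 19 \<Rightarrow> bool" where
  "invariant7 p \<longleftrightarrow> affine 7 0 p = p"

lemma invariant7: "invariant7 p \<Longrightarrow> m \<in> {1, 7, 11} \<Longrightarrow> affine m 0 p = p"
proof -
  assume p: "invariant7 p" and m: "m \<in> {1, 7, 11}"
  have "(7 * 7 :: 19) = 11" by simp
  then have "affine 7 0 (affine 7 0 p) = affine 11 0 p" by (simp only: affine_affine mult_zero_right add_0_right)
  moreover have "affine 1 0 p = p" by (simp add: affine_def)
  ultimately show ?thesis using p m by (auto simp: invariant7_def)
qed

lemma normal_form:
  assumes "1 \<le> wt s" "wt s \<le> 4"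
  shows "\<exists>m m' c e. m \<in> {1, 7, 11} \<and> m * m' = 1 \<and> (e = 1 \<or> e = -1) \<and> normal (e *s affine m c s)"
  by (rule normalize[OF assms]) blast

definition heavy_ok :: "F3 ^ 19 \<Rightarrow> F3 ^ 19 \<Rightarrow> F3 ^ 19 \<Rightarrow> F3 ^ 19 \<Rightarrow> bool" where
  "heavy_ok p q r u \<longleftrightarrow> (\<forall>t s. wt t = 3 \<longrightarrow> wt s = 3 \<or> wt s = 4 \<longrightarrow> heavier p q r u t s)"

definition light_ok :: "F3 ^ 19 \<Rightarrow> F3 ^ 19 \<Rightarrow> F3 ^ 19 \<Rightarrow> F3 ^ 19 \<Rightarrow> bool" where
  "light_ok p q r u \<longleftrightarrow> (\<forall>t s. wt t \<le> 2 \<and> wt t \<le> wt s \<and> 1 \<le> wt s \<and> wt s \<le> 4 \<or> t = 0 \<and> wt s = 5 \<longrightarrow> heavier p q r u t s)"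

lemma heavy_okI:
  assumes "far_heavy p q r u" and inv: "invariant7 p" "invariant7 q" "invariant7 r" "invariant7 u"
  shows "heavy_ok p q r u"
  unfolding heavy_ok_def
proof (intro allI impI)
  fix t s assume t: "wt t = 3" and s: "wt s = 3 \<or> wt s = 4"
  obtain m m' c e where m: "m \<in> {1, 7, 11}" "m * m' = 1" "e = 1 \<or> e = -1" "normal (e *s affine m c s)"
    using normal_form[of s] s by fastforce
  then have e: "e \<noteq> 0" by auto
  have "heavier p q r u (e *s affine m c t) (e *s affine m c s)"
    using heavy_normal[OF assms(1) m(4), of "e *s affine m c t"] s t
    by (auto simp: heavier_def wt_scale[OF e] wt_affine[OF m(2)])
  then show "heavier p q r u t s"
    using heavier_affine[OF m(2) e, of p q r u c t s] by (simp add: invariant7[OF _ m(1)] inv)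
qed

lemma light_okI:
  assumes "far_light p q r u" and inv: "invariant7 p" "invariant7 q" "invariant7 r" "invariant7 u"
  shows "light_ok p q r u"
  unfolding light_ok_def
proof (intro allI impI)
  fix t s :: "F3 ^ 19"
  assume "wt t \<le> 2 \<and> wt t \<le> wt s \<and> 1 \<le> wt s \<and> wt s \<le> 4 \<or> t = 0 \<and> wt s = 5"
  then consider (one) "wt s = 1" "wt t \<le> 1" | (few) "2 \<le> wt s" "wt s \<le> 4" "wt t \<le> 2" | (five) "t = 0" "wt s = 5"
    by linarith
  then show "heavier p q r u t s"
  proof cases
    case one
    obtain m m' c e where m: "m \<in> {1, 7, 11}" "m * m' = 1" "e = 1 \<or> e = -1" "normal (e *s affine m c s)"
      using normal_form[of s] one by fastforce
    then have e: "e \<noteq> 0" by auto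
    have "heavier p q r u (e *s affine m c t) (e *s affine m c s)"
      using single_normal[OF assms(1) m(4), of "e *s affine m c t"] one
      by (auto simp: heavier_def wt_scale[OF e] wt_affine[OF m(2)])
    then show ?thesis
      using heavier_affine[OF m(2) e, of p q r u c t s] by (simp add: invariant7[OF _ m(1)] inv)
  next
    case few
    obtain m m' c e where m: "m \<in> {1, 7, 11}" "m * m' = 1" "e = 1 \<or> e = -1" "normal (e *s affine m c s)"
      using normal_form[of s] few by fastforce
    then have e: "e \<noteq> 0" by auto
    have "heavier p q r u (e *s affine m c t) (e *s affine m c s)"
      using light_normal[OF assms(1) m(4), of 0 "e *s affine m c t"] few
      by (auto simp: heavier_def wt_scale[OF e] wt_affine[OF m(2)])
    then show ?thesis
      using heavier_affine[OF m(2) e, of p q r u c t s] by (simp add: invariant7[OF _ m(1)] inv)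
  next
    case five
    then obtain x where x: "s $ x \<noteq> 0" by (metis wt_eq_0 vec_eq_iff zero_index zero_neq_numeral)
    \<comment> \<open>One entry is split off, so the remaining four can be normalized and no
      representatives of size 5 have to be listed.\<close>
    define f where "f = axis x (s $ x)"
    have f: "wt f = 1" using x by (simp add: f_def hamming_weight_def axis_def)
    have "{i. (s - f) $ i \<noteq> 0} = {i. s $ i \<noteq> 0} - {x}" by (auto simp: f_def axis_def)
    then have s4: "wt (s - f) = 4" using five(2) x by (simp add: hamming_weight_def)
    obtain m m' c e where m: "m \<in> {1, 7, 11}" "m * m' = 1" "e = 1 \<or> e = -1" "normal (e *s affine m c (s - f))"
      using normal_form[of "s - f"] s4 by fastforce
    then have e: "e \<noteq> 0" by auto
    have wts: "wt (e *s affine m c x) = wt x" for x by (simp add: wt_scale[OF e] wt_affine[OF m(2)])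
    have sum: "e *s affine m c (s - f) + e *s affine m c f = e *s affine m c s"
      by (simp add: vec_eq_iff affine_nth algebra_simps)
    have "wt (e *s affine m c (s - f)) = 4" "wt (e *s affine m c f) = 1"
      using wts[of "s - f"] wts[of f] s4 f by (simp_all only:)
    then have "15 < 4 + wt (p \<star> 0 + q \<star> (e *s affine m c s)) + wt (r \<star> 0 + u \<star> (e *s affine m c s))"
      using light_normal[OF assms(1) m(4), of "e *s affine m c f" 0] unfolding sum by simp
    then have "heavier p q r u (e *s affine m c t) (e *s affine m c s)"
      using five wts[of s] by (simp add: heavier_def affine_linear)
    then show ?thesis
      using heavier_affine[OF m(2) e, of p q r u c t s] by (simp add: invariant7[OF _ m(1)] inv)
  qed
qed

lemma heavier_swap: "heavier p q r u t s \<longleftrightarrow> heavier r u p q t s"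
  by (auto simp: heavier_def)

lemma heavier_neg_row: "heavier (- p) (- q) r u t s \<longleftrightarrow> heavier p q r u t s"
proof -
  have "(- p) \<star> t + (- q) \<star> s = - (p \<star> t + q \<star> s)" by (simp add: conv_algebra)
  then show ?thesis by (simp only: heavier_def wt_uminus)
qed

lemma heavier_neg_column: "heavier p (- q) r (- u) t s \<longleftrightarrow> heavier p q r u t (- s)"
  by (simp add: heavier_def conv_algebra)

text \<open>Weights ignore the order and signs of the two computed blocks, and \<open>s\<close>
  ranges over a set closed under negation. For the first code these moves relate the three ways of
  pairing blocks.\<close>

lemma heavy_ok_symmetries:
  "heavy_ok p q r u \<Longrightarrow> heavy_ok r u p q"
  "heavy_ok p q r u \<Longrightarrow> heavy_ok (- p) (- q) r u"
  "heavy_ok p q r u \<Longrightarrow> heavy_ok p (- q) r (- u)"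
  by (simp_all add: heavy_ok_def heavier_swap[of r] heavier_neg_row heavier_neg_column)

lemma light_ok_symmetries:
  "light_ok p q r u \<Longrightarrow> light_ok r u p q"
  "light_ok p q r u \<Longrightarrow> light_ok (- p) (- q) r u"
  "light_ok p q r u \<Longrightarrow> light_ok p (- q) r (- u)"
  by (simp_all add: light_ok_def heavier_swap[of r] heavier_neg_row heavier_neg_column)

text \<open>The multiplier may lie outside the subgroup generated by 7. It then changes the
  coefficients, but the assertion survives because \<open>t\<close> and \<open>s\<close> range over
  all vectors of given weights.\<close>

lemma ok_affine:
  assumes "m * m' = (1::19)"
  shows "heavy_ok p q r u \<Longrightarrow> heavy_ok (affine m 0 p) (affine m 0 q) (affine m 0 r) (affine m 0 u)"
    and "light_ok p q r u \<Longrightarrow> light_ok (affine m 0 p) (affine m 0 q) (affine m 0 r) (affine m 0 u)"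
proof -
  have m: "m' * m = 1" using assms by (simp add: mult.commute)
  have "affine m 0 (affine m' 0 x) = affine 1 0 x" for x by (simp only: affine_affine m) simp
  then have inv: "affine m 0 (affine m' 0 x) = x" "wt (affine m' 0 x) = wt x" for x
    using wt_affine[OF m, of 0 x] by (simp_all add: affine_def)
  have "heavier (affine m 0 p) (affine m 0 q) (affine m 0 r) (affine m 0 u) t s
      \<longleftrightarrow> heavier p q r u (affine m' 0 t) (affine m' 0 s)" for t s
    using heavier_affine[OF assms, of 1 p q r u 0 "affine m' 0 t" "affine m' 0 s"] by (simp add: inv)
  moreover have "affine m' 0 t = 0 \<longleftrightarrow> t = 0" for t using inv(2)[of t] by (metis wt_eq_0)
  ultimately show "heavy_ok p q r u \<Longrightarrow> heavy_ok (affine m 0 p) (affine m 0 q) (affine m 0 r) (affine m 0 u)"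
    "light_ok p q r u \<Longrightarrow> light_ok (affine m 0 p) (affine m 0 q) (affine m 0 r) (affine m 0 u)"
    by (simp_all add: heavy_ok_def light_ok_def inv affine_linear)
qed

abbreviation star :: "F3 ^ 19 \<Rightarrow> F3 ^ 19" where
  "star \<equiv> affine (-1) 0"

type_synonym blocks = "(F3 ^ 19) \<times> (F3 ^ 19) \<times> (F3 ^ 19) \<times> (F3 ^ 19)"

definition code :: "F3 ^ 19 \<Rightarrow> F3 ^ 19 \<Rightarrow> blocks set" where
  "code a b = {(w, x, y, z). y = a \<star> w - b \<star> x \<and> z = b \<star> w + star a \<star> x}"

lemma star_star [simp]: "star (star x) = x"
  by (simp add: affine_def)

lemma star_conv: "star (p \<star> x) = star p \<star> star x"
  by (rule affine_conv[where m' = "-1"]) simp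

lemma wt_star [simp]: "wt (star x) = wt x"
  by (rule wt_affine[where m' = "-1"]) simp

text \<open>The inverse \<open>bi\<close> lets the first and third block determine a codeword, and
  \<open>ci\<close> does the same for the first and fourth.\<close>

locale circulant_code =
  fixes a b bi ci :: "F3 ^ 19"
  assumes star_b: "star b = b"
    and norm: "a \<star> star a + b \<star> b = - unit"
    and inverse_b: "bi \<star> b = unit"
    and inverse_a: "ci \<star> star a = unit"
begin

lemma norm_act: "a \<star> (star a \<star> x) + b \<star> (b \<star> x) = - x"
  using arg_cong[OF norm, of "\<lambda>p. p \<star> x"] by (simp add: conv_add_left conv_assoc conv_uminus_left)

lemma inverse_b_act: "bi \<star> (b \<star> x) = x"
  by (simp add: inverse_b flip: conv_assoc)

lemma inverse_a_act: "ci \<star> (star a \<star> x) = x"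
  by (simp add: inverse_a flip: conv_assoc)

lemma swap_pairs:
  assumes "(w, x, y, z) \<in> code a b"
  shows "(- star x, star w, - star z, star y) \<in> code a b"
  using assms by (simp add: code_def affine_linear star_conv star_b conv_algebra)

text \<open>By \<open>norm\<close>, the first half is recovered from the second:
  \<open>star a \<star> y + b \<star> z = - w\<close> and
  \<open>a \<star> z - b \<star> y = - x\<close>. Transposing brings these relations into the shape
  of the code.\<close>

lemma swap_halves:
  assumes "(w, x, y, z) \<in> code a b"
  shows "(star y, - star z, - star w, star x) \<in> code a b"
proof -
  have y: "y = a \<star> w - b \<star> x" and z: "z = b \<star> w + star a \<star> x" using assms by (simp_all add: code_def)
  have "star a \<star> y + b \<star> z = a \<star> (star a \<star> w) + b \<star> (b \<star> w)"
    unfolding y z by (simp add: conv_algebra conv_left_commute)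
  then have w: "star a \<star> y + b \<star> z = - w" by (simp add: norm_act)
  have "a \<star> z - b \<star> y = a \<star> (star a \<star> x) + b \<star> (b \<star> x)"
    unfolding y z by (simp add: conv_algebra conv_left_commute)
  then have x: "a \<star> z - b \<star> y = - x" by (simp add: norm_act)
  from arg_cong[OF w, of star] arg_cong[OF x, of star] show ?thesis
    by (simp add: code_def affine_linear star_conv star_b conv_algebra algebra_simps)
qed

text \<open>Inverting \<open>b\<close> gives \<open>x\<close>; on substitution into
  \<open>z\<close>, the norm relation collapses the coefficient of \<open>w\<close> to
  \<open>- bi\<close>.\<close>

lemma solve_second:
  assumes "(w, x, y, z) \<in> code a b"
  shows "x = (bi \<star> a) \<star> w + (- bi) \<star> y" "z = (- bi) \<star> w + (- (bi \<star> star a)) \<star> y"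
proof -
  have y: "y = a \<star> w - b \<star> x" and z: "z = b \<star> w + star a \<star> x" using assms by (simp_all add: code_def)
  have "bi \<star> y = bi \<star> (a \<star> w) - x" unfolding y by (simp add: conv_algebra inverse_b_act)
  then show x: "x = (bi \<star> a) \<star> w + (- bi) \<star> y" by (simp add: conv_algebra conv_assoc)
  have "star a \<star> (bi \<star> (a \<star> w)) = bi \<star> (a \<star> (star a \<star> w))" by (simp add: conv_ac)
  also have "a \<star> (star a \<star> w) = - w - b \<star> (b \<star> w)" unfolding eq_diff_eq by (rule norm_act)
  also have "bi \<star> \<dots> = - (bi \<star> w) - b \<star> w" by (simp add: conv_algebra inverse_b_act)
  finally show "z = (- bi) \<star> w + (- (bi \<star> star a)) \<star> y"
    unfolding z x by (simp add: conv_algebra conv_assoc conv_left_commute[of "star a" bi])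
qed

lemma solve_third:
  assumes "(w, x, y, z) \<in> code a b"
  shows "x = (- (ci \<star> b)) \<star> w + ci \<star> z" "y = (- ci) \<star> w + (- (ci \<star> b)) \<star> z"
proof -
  have y: "y = a \<star> w - b \<star> x" and z: "z = b \<star> w + star a \<star> x" using assms by (simp_all add: code_def)
  have "ci \<star> z = ci \<star> (b \<star> w) + x" unfolding z by (simp add: conv_algebra inverse_a_act)
  then show x: "x = (- (ci \<star> b)) \<star> w + ci \<star> z" by (simp add: conv_algebra conv_assoc)
  have "b \<star> (ci \<star> (b \<star> w)) = ci \<star> (b \<star> (b \<star> w))" by (simp add: conv_ac)
  also have "b \<star> (b \<star> w) = - w - star a \<star> (a \<star> w)"
    unfolding eq_diff_eq conv_left_commute[of "star a" a w] by (subst add.commute) (rule norm_act)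
  also have "ci \<star> \<dots> = - (ci \<star> w) - a \<star> w" by (simp add: conv_algebra inverse_a_act)
  finally show "y = (- ci) \<star> w + (- (ci \<star> b)) \<star> z"
    unfolding y x by (simp add: conv_algebra conv_assoc conv_left_commute[of b ci])
qed

text \<open>The four arrangements come from the identity, \<open>swap_pairs\<close>,
  \<open>swap_halves\<close> and their composition; signs and transposition leave the weights
  alone.\<close>

lemma Klein:
  assumes "(w, x, y, z) \<in> code a b"
    and "\<And>w x y z. (w, x, y, z) \<in> code a b \<Longrightarrow> Q (wt w) (wt x) (wt y) (wt z)"
  shows "Q (wt w) (wt x) (wt y) (wt z)" "Q (wt x) (wt w) (wt z) (wt y)"
    "Q (wt y) (wt z) (wt w) (wt x)" "Q (wt z) (wt y) (wt x) (wt w)"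
  using assms(2)[OF assms(1)] assms(2)[OF swap_pairs[OF assms(1)]] assms(2)[OF swap_halves[OF assms(1)]]
    assms(2)[OF swap_pairs[OF swap_halves[OF assms(1)]]] by simp_all

definition light_pair :: "nat \<Rightarrow> nat \<Rightarrow> bool" where
  "light_pair t s \<longleftrightarrow> t \<le> 2 \<and> t \<le> s \<and> 1 \<le> s \<and> s \<le> 4 \<or> t = 0 \<and> s = 5"

definition heavy_pair :: "nat \<Rightarrow> nat \<Rightarrow> bool" where
  "heavy_pair t s \<longleftrightarrow> t = 3 \<and> (s = 3 \<or> s = 4)"

lemma weights:
  assumes "heavy_ok a (- b) b (star a)" "light_ok a (- b) b (star a)"
    and "heavy_ok (bi \<star> a) (- bi) (- bi) (- (bi \<star> star a))" "light_ok (bi \<star> a) (- bi) (- bi) (- (bi \<star> star a))"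
    and "light_ok (- (ci \<star> b)) ci (- ci) (- (ci \<star> b))"
    and c: "(w, x, y, z) \<in> code a b" and nz: "(w, x, y, z) \<noteq> (0, 0, 0, 0)"
  shows "15 < wt w + wt x + wt y + wt z"
proof (rule ccontr)
  assume le: "\<not> ?thesis"
  \<comment> \<open>What the checks say about a nonzero word of weight at most 15, read from its
    first block; as a property of four numbers it can be moved along the Klein group. The last three
    conditions hold because two zero blocks, one of them the first, force the whole word to
    vanish.\<close>
  define Q where "Q A B C D \<longleftrightarrow> (A + B + C + D \<le> 15 \<and> 0 < A + B + C + D \<longrightarrow>
    \<not> light_pair A B \<and> \<not> light_pair A C \<and> \<not> light_pair A D \<and> \<not> heavy_pair A B \<and> \<not> heavy_pair A C
    \<and> (A \<noteq> 0 \<or> B \<noteq> 0) \<and> (A \<noteq> 0 \<or> C \<noteq> 0) \<and> (A \<noteq> 0 \<or> D \<noteq> 0))" for A B C D :: nat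
  have Q: "Q (wt w) (wt x) (wt y) (wt z)" if c: "(w, x, y, z) \<in> code a b" for w x y z
  proof -
    have y: "y = a \<star> w + (- b) \<star> x" and z: "z = b \<star> w + star a \<star> x"
      using c by (simp_all add: code_def conv_algebra)
    note s2 = solve_second[OF c] and s3 = solve_third[OF c]
    have 1: "heavier a (- b) b (star a) w x \<longleftrightarrow> 15 < wt w + wt x + wt y + wt z"
      unfolding heavier_def y z by (rule refl)
    have "heavier (bi \<star> a) (- bi) (- bi) (- (bi \<star> star a)) w y \<longleftrightarrow> 15 < wt w + wt y + wt x + wt z"
      unfolding heavier_def s2[symmetric] by (rule refl)
    then have 2: "heavier (bi \<star> a) (- bi) (- bi) (- (bi \<star> star a)) w y \<longleftrightarrow> 15 < wt w + wt x + wt y + wt z"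
      by (simp add: ac_simps)
    have "heavier (- (ci \<star> b)) ci (- ci) (- (ci \<star> b)) w z \<longleftrightarrow> 15 < wt w + wt z + wt x + wt y"
      unfolding heavier_def s3[symmetric] by (rule refl)
    then have 3: "heavier (- (ci \<star> b)) ci (- ci) (- (ci \<star> b)) w z \<longleftrightarrow> 15 < wt w + wt x + wt y + wt z"
      by (simp add: ac_simps)
    define S where "S = wt w + wt x + wt y + wt z"
    have "heavy_pair (wt w) (wt x) \<longrightarrow> 15 < S"
      using assms(1) unfolding S_def 1[symmetric] heavy_ok_def heavy_pair_def by blast
    moreover have "light_pair (wt w) (wt x) \<longrightarrow> 15 < S"
      using assms(2) unfolding S_def 1[symmetric] light_ok_def light_pair_def wt_eq_0 by blast
    moreover have "heavy_pair (wt w) (wt y) \<longrightarrow> 15 < S"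
      using assms(3) unfolding S_def 2[symmetric] heavy_ok_def heavy_pair_def by blast
    moreover have "light_pair (wt w) (wt y) \<longrightarrow> 15 < S"
      using assms(4) unfolding S_def 2[symmetric] light_ok_def light_pair_def wt_eq_0 by blast
    moreover have "light_pair (wt w) (wt z) \<longrightarrow> 15 < S"
      using assms(5) unfolding S_def 3[symmetric] light_ok_def light_pair_def wt_eq_0 by blast
    moreover have "w = 0 \<and> x = 0 \<longrightarrow> S = 0" unfolding S_def using y z by simp
    moreover have "w = 0 \<and> y = 0 \<longrightarrow> S = 0" unfolding S_def using s2 by simp
    moreover have "w = 0 \<and> z = 0 \<longrightarrow> S = 0" unfolding S_def using s3 by simp
    ultimately show ?thesis unfolding Q_def S_def[symmetric] wt_eq_0 by (cases "15 < S"; cases "S = 0") simp_all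
  qed
  \<comment> \<open>If the lightest weight is 0, the other three are at least 6. If it is 1 or 2,
    they are at least 5 and the total is at least 16. If it is 3, then \<open>B\<close> and
    \<open>C\<close> are at least 5 and the total is at least 3 + 5 + 5 + 3 = 16.\<close>
  have min: False if "Q A B C D" "A \<le> B" "A \<le> C" "A \<le> D" "A + B + C + D \<le> 15" "0 < A + B + C + D" for A B C D
  proof (cases "A \<le> 2")
    case True
    have far: "5 \<le> s \<and> (A = 0 \<longrightarrow> s \<noteq> 5)" if "\<not> light_pair A s" "A \<noteq> 0 \<or> s \<noteq> 0" "A \<le> s" for s
      using that True unfolding light_pair_def by linarith
    have "5 \<le> B \<and> (A = 0 \<longrightarrow> B \<noteq> 5)" "5 \<le> C \<and> (A = 0 \<longrightarrow> C \<noteq> 5)" "5 \<le> D \<and> (A = 0 \<longrightarrow> D \<noteq> 5)"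
      using far that unfolding Q_def by blast+
    with that(5) show ?thesis by (cases "A = 0") linarith+
  next
    case False
    then have "A = 3" using that by linarith
    have "\<not> heavy_pair A B" "\<not> heavy_pair A C" using that unfolding Q_def by blast+
    then have "5 \<le> B" "5 \<le> C" using that(2,3) \<open>A = 3\<close> unfolding heavy_pair_def by linarith+
    with that(4,5) \<open>A = 3\<close> show ?thesis by linarith
  qed
  have "wt w \<noteq> 0 \<or> wt x \<noteq> 0 \<or> wt y \<noteq> 0 \<or> wt z \<noteq> 0" using nz by simp
  then have pos: "0 < wt w + wt x + wt y + wt z" by linarith
  note K = Klein[where Q = Q, OF c Q]
  consider "wt w \<le> wt x" "wt w \<le> wt y" "wt w \<le> wt z" | "wt x \<le> wt w" "wt x \<le> wt y" "wt x \<le> wt z"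
    | "wt y \<le> wt w" "wt y \<le> wt x" "wt y \<le> wt z" | "wt z \<le> wt w" "wt z \<le> wt x" "wt z \<le> wt y"
    by linarith
  then show False
    using le pos min[OF K(1)] min[OF K(2)] min[OF K(3)] min[OF K(4)] by cases (simp_all add: ac_simps)
qed

end

section \<open>Parameters and self-duality\<close>

lemma of_nat_F3: "(of_nat n :: F3) = of_nat (n mod 3)"
proof -
  have "of_nat 3 = (0 :: F3)" by (simp add: eval_nat_numeral F3_constants F3_plus)
  then have "(of_nat (n mod 3 + 3 * (n div 3)) :: F3) = of_nat (n mod 3)"
    by (simp only: of_nat_add of_nat_mult mult_zero_left add_0_right)
  then show ?thesis by simp
qed

lemma of_nat_F3_eq: "(of_nat m :: F3) = of_nat n \<longleftrightarrow> m mod 3 = n mod 3"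
proof -
  have "inj_on (of_nat :: nat \<Rightarrow> F3) {0, 1, 2}"
    by (auto simp: inj_on_def F3_constants F3_plus)
  moreover have "k mod 3 \<in> {0, 1, 2}" for k :: nat by auto
  ultimately show ?thesis by (subst (1 2) of_nat_F3) (metis inj_on_eq_iff)
qed

text \<open>Any bijection serves, because weights and inner products are sums over all
  coordinates.\<close>

definition place :: "76 \<Rightarrow> bool \<times> bool \<times> 19" where
  "place = (SOME h. bij h)"

lemma bij_place: "bij place"
proof -
  have "CARD(76) = CARD(bool \<times> bool \<times> 19)" by simp
  then have "\<exists>h :: 76 \<Rightarrow> bool \<times> bool \<times> 19. bij h" by (intro finite_same_card_bij) simp_all
  then show ?thesis unfolding place_def by (rule someI_ex)
qed

fun entry :: "blocks \<Rightarrow> bool \<times> bool \<times> 19 \<Rightarrow> F3" where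
  "entry (w, x, y, z) (i, j, r) = (if i then if j then z else y else if j then x else w) $ r"

definition assemble :: "blocks \<Rightarrow> F3 ^ 76" where
  "assemble v = (\<chi> i. entry v (place i))"

text \<open>Polymorphic in the values of \<open>f\<close>, so that it yields both the weight, summed
  in \<open>nat\<close>, and the inner product, summed in \<open>F3\<close>.\<close>

lemma sum_assemble:
  fixes f :: "F3 \<Rightarrow> F3 \<Rightarrow> 'a::comm_monoid_add"
  shows "(\<Sum>i\<in>UNIV. f (assemble (w, x, y, z) $ i) (assemble (w', x', y', z') $ i)) =
    (\<Sum>r\<in>UNIV. f (w $ r) (w' $ r)) + (\<Sum>r\<in>UNIV. f (x $ r) (x' $ r))
    + (\<Sum>r\<in>UNIV. f (y $ r) (y' $ r)) + (\<Sum>r\<in>UNIV. f (z $ r) (z' $ r))"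
proof -
  have "(\<Sum>i\<in>UNIV. f (assemble (w, x, y, z) $ i) (assemble (w', x', y', z') $ i)) =
      (\<Sum>p\<in>UNIV. f (entry (w, x, y, z) p) (entry (w', x', y', z') p))"
    unfolding assemble_def vec_lambda_beta
    using sum.reindex_bij_betw[OF bij_place, of "\<lambda>p. f (entry (w, x, y, z) p) (entry (w', x', y', z') p)"] .
  also have "\<dots> = (\<Sum>i\<in>UNIV. \<Sum>j\<in>UNIV. \<Sum>r\<in>UNIV. f (entry (w, x, y, z) (i, j, r)) (entry (w', x', y', z') (i, j, r)))"
    by (simp add: sum.cartesian_product case_prod_unfold del: entry.simps)
  finally show ?thesis by (simp add: UNIV_bool ac_simps)
qed

lemma card_as_sum: "card {i. x $ i \<noteq> 0} = (\<Sum>i\<in>UNIV. if x $ i \<noteq> 0 then 1 else 0)"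
  for x :: "F3 ^ 'n::finite"
  by (simp add: sum.If_cases)

lemma weight_assemble: "hamming_weight (assemble (w, x, y, z)) = wt w + wt x + wt y + wt z"
  using sum_assemble[of "\<lambda>a _. if a \<noteq> 0 then 1 else 0 :: nat" w x y z w x y z]
  unfolding hamming_weight_def card_as_sum .

definition dot :: "F3 ^ 'n \<Rightarrow> F3 ^ 'n \<Rightarrow> F3" where
  "dot x y = (\<Sum>i\<in>UNIV. x $ i * y $ i)"

lemma dot_assemble: "dot (assemble (w, x, y, z)) (assemble (w', x', y', z')) = dot w w' + dot x x' + dot y y' + dot z z'"
  unfolding dot_def by (rule sum_assemble)

lemma dot_algebra:
  "dot (x + y) z = dot x z + dot y z" "dot x (y + z) = dot x y + dot x z"
  "dot (x - y) z = dot x z - dot y z" "dot x (y - z) = dot x y - dot x z"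
  "dot (- x) z = - dot x z" "dot x (- z) = - dot x z"
  by (simp_all add: dot_def distrib_left distrib_right sum.distrib left_diff_distrib right_diff_distrib
      sum_subtractf sum_negf)

lemma dot_commute: "dot x y = dot y x"
  by (simp add: dot_def mult.commute)

lemma dot_0 [simp]: "dot 0 x = 0" "dot x 0 = 0"
  by (simp_all add: dot_def)

lemma dot_conv: "dot (p \<star> x) y = dot x (star p \<star> y)"
proof -
  have "dot (p \<star> x) y = (\<Sum>r\<in>UNIV. \<Sum>i\<in>UNIV. x $ i * p $ (r - i) * y $ r)"
    by (simp add: dot_def conv_nth sum_distrib_right)
  also have "\<dots> = (\<Sum>i\<in>UNIV. \<Sum>r\<in>UNIV. x $ i * p $ (r - i) * y $ r)" by (rule sum.swap)
  also have "\<dots> = dot x (star p \<star> y)"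
    by (simp add: dot_def conv_nth affine_nth sum_distrib_left algebra_simps)
  finally show ?thesis .
qed

lemma dot_eq_0_imp:
  assumes "\<And>x. dot x y = 0"
  shows "y = 0"
proof -
  have "dot (axis i 1) y = y $ i" for i
  proof -
    have "dot (axis i 1) y = (\<Sum>j\<in>{i}. axis i 1 $ j * y $ j)"
      unfolding dot_def by (rule sum.mono_neutral_right) (auto simp: axis_def)
    then show ?thesis by (simp add: axis_def)
  qed
  with assms show ?thesis by (simp add: vec_eq_iff)
qed

text \<open>Nonzero elements of \<open>F3\<close> have square 1. Hence every self-orthogonal word
  has weight divisible by 3, which later lifts the bound from above 15 to 18.\<close>

lemma dot_self: "dot x x = of_nat (hamming_weight x)"
proof -
  have "a * a = (if a \<noteq> 0 then 1 else 0)" for a :: F3 by (cases a rule: F3_cases) auto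
  then have "dot x x = (\<Sum>i\<in>UNIV. of_nat (if x $ i \<noteq> 0 then 1 else 0))"
    unfolding dot_def by (intro sum.cong) auto
  then show ?thesis unfolding hamming_weight_def card_as_sum by (simp only: of_nat_sum)
qed

lemma surj_assemble: "surj assemble"
proof -
  have "\<exists>u. v = assemble u" for v :: "F3 ^ 76"
  proof -
    define g where "g i j = (\<chi> r. v $ inv place (i, j, r))" for i j
    have "entry (g False False, g False True, g True False, g True True) p = v $ inv place p" for p
      by (cases p) (auto simp: g_def)
    then have "v = assemble (g False False, g False True, g True False, g True True)"
      using bij_place by (simp add: assemble_def vec_eq_iff bij_is_inj del: entry.simps)
    then show ?thesis by blast
  qed
  then show ?thesis by (simp add: surj_def)
qed

lemma inj_assemble: "inj assemble"
proof (rule injI)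
  fix u v assume "assemble u = assemble v"
  then have "entry u (place i) = entry v (place i)" for i by (simp add: assemble_def vec_eq_iff)
  then have *: "entry u p = entry v p" for p using bij_place by (metis bij_pointE)
  show "u = v"
    using *[of "(False, False, r)" for r] *[of "(False, True, r)" for r] *[of "(True, False, r)" for r] *[of "(True, True, r)" for r]
    by (cases u; cases v) (simp add: vec_eq_iff)
qed

lemma assemble_add: "assemble (w, x, y, z) + assemble (w', x', y', z') = assemble (w + w', x + x', y + y', z + z')"
  and assemble_scale: "c *s assemble (w, x, y, z) = assemble (c *s w, c *s x, c *s y, c *s z)"
  and assemble_0: "assemble (0, 0, 0, 0) = 0"
proof -
  have "entry (w, x, y, z) p + entry (w', x', y', z') p = entry (w + w', x + x', y + y', z + z') p"
    "c * entry (w, x, y, z) p = entry (c *s w, c *s x, c *s y, c *s z) p" "entry (0, 0, 0, 0) p = 0" for p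
    by (cases p; simp)+
  then show "assemble (w, x, y, z) + assemble (w', x', y', z') = assemble (w + w', x + x', y + y', z + z')"
    "c *s assemble (w, x, y, z) = assemble (c *s w, c *s x, c *s y, c *s z)" "assemble (0, 0, 0, 0) = 0"
    by (simp_all add: assemble_def vec_eq_iff)
qed

definition half :: "bool \<Rightarrow> F3 ^ (bool \<times> 19) \<Rightarrow> F3 ^ 19" where
  "half i m = (\<chi> r. m $ (i, r))"

lemma half_linear: "half i (m + n) = half i m + half i n" "half i (c *s m) = c *s half i m"
  by (simp_all add: half_def vec_eq_iff)

context circulant_code
begin

definition codewords :: "(F3 ^ 76) set" where
  "codewords = assemble ` code a b"

text \<open>A systematic encoder on an index type with 38 elements, so the dimension of the code
  follows from injectivity.\<close>

definition encode :: "F3 ^ (bool \<times> 19) \<Rightarrow> F3 ^ 76" where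
  "encode m = assemble (half False m, half True m,
    a \<star> half False m - b \<star> half True m, b \<star> half False m + star a \<star> half True m)"

lemma linear_encode: "Vector_Spaces.linear (*s) (*s) encode"
  by (intro Vector_Spaces.linear_iff[THEN iffD2] conjI allI vec.vector_space_axioms)
    (simp_all add: encode_def half_linear assemble_add assemble_scale conv_algebra conv_scale
      vec.scale_right_distrib vec.scale_right_diff_distrib algebra_simps)

lemma range_encode: "range encode = codewords"
proof -
  have "assemble (w, x, a \<star> w - b \<star> x, b \<star> w + star a \<star> x) \<in> range encode" for w x
    by (rule range_eqI[of _ _ "\<chi> p. if fst p then x $ snd p else w $ snd p"]) (simp add: encode_def half_def)
  then show ?thesis by (auto simp: codewords_def code_def encode_def)
qed

lemma inj_encode: "inj encode"
proof (rule injI)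
  fix m n assume "encode m = encode n"
  then have "half False m = half False n" "half True m = half True n"
    unfolding encode_def by (auto dest: injD[OF inj_assemble])
  then have "m $ (i, r) = n $ (i, r)" for i r by (cases i) (auto simp: half_def vec_eq_iff)
  then show "m = n" by (auto simp: vec_eq_iff)
qed

lemma subspace_codewords: "vec.subspace codewords"
  unfolding range_encode[symmetric] using vec.linear_subspace_image[OF linear_encode vec.subspace_UNIV] .

lemma dim_codewords: "vec.dim codewords = 38"
proof -
  have "vec.dim (range encode) = vec.dim (UNIV :: (F3 ^ (bool \<times> 19)) set)"
    using inj_encode by (intro vec.dim_image_eq[OF linear_encode]) (auto intro: inj_on_subset)
  then show ?thesis unfolding range_encode vec_dim_card by simp
qed

lemma self_orthogonal:
  assumes "(w, x, y, z) \<in> code a b" "(w', x', y', z') \<in> code a b"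
  shows "dot w w' + dot x x' + dot y y' + dot z z' = 0"
proof -
  have y: "y = a \<star> w - b \<star> x" "y' = a \<star> w' - b \<star> x'" and z: "z = b \<star> w + star a \<star> x" "z' = b \<star> w' + star a \<star> x'"
    using assms by (simp_all add: code_def)
  have n: "star a \<star> (a \<star> v) = - v - b \<star> (b \<star> v)" for v
    unfolding eq_diff_eq conv_left_commute[of "star a" a v] by (rule norm_act)
  have n': "a \<star> (star a \<star> v) = - v - b \<star> (b \<star> v)" for v
    unfolding eq_diff_eq by (rule norm_act)
  show ?thesis
    unfolding y z by (simp add: dot_algebra dot_conv star_b conv_algebra n n' conv_left_commute[of b a] conv_left_commute[of b "star a"])
qed

lemma self_dual_codewords: "self_dual codewords"
proof -
  have "v \<in> dual_code codewords" if "v \<in> codewords" for v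
    using that self_orthogonal
    by (force simp: codewords_def dual_code_def dot_def[symmetric] dot_assemble)
  moreover have "v \<in> codewords" if v: "v \<in> dual_code codewords" for v
  proof -
    obtain w x y z where wxyz: "v = assemble (w, x, y, z)" using surj_assemble by (metis prod_cases4 surjE)
    have orth: "dot w w' + dot x x' + dot y (a \<star> w' - b \<star> x') + dot z (b \<star> w' + star a \<star> x') = 0" for w' x'
    proof -
      have "assemble (w', x', a \<star> w' - b \<star> x', b \<star> w' + star a \<star> x') \<in> codewords"
        by (simp add: codewords_def code_def)
      then show ?thesis using v unfolding wxyz dual_code_def dot_def[symmetric] by (auto simp: dot_assemble)
    qed
    \<comment> \<open>Testing against codewords with \<open>x' = 0\<close>, and below with
      \<open>w' = 0\<close>, gives one equation for each block of the first half. By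
      \<open>norm\<close> the two are equivalent to the defining equations, so no dimension count
      enters.\<close>
    have "dot w' (w + star a \<star> y + b \<star> z) = 0" for w'
      using orth[of w' 0] by (simp add: dot_algebra dot_commute[of _ w'] dot_commute[of _ "_ \<star> w'"] dot_conv star_b)
    then have w: "w + star a \<star> y + b \<star> z = 0" by (rule dot_eq_0_imp)
    have "dot x' (x - b \<star> y + a \<star> z) = 0" for x'
      using orth[of 0 x'] by (simp add: dot_algebra dot_commute[of _ x'] dot_commute[of _ "_ \<star> x'"] dot_conv star_b)
    then have x: "x - b \<star> y + a \<star> z = 0" by (rule dot_eq_0_imp)
    have w': "w = - (star a \<star> y) - b \<star> z" and x': "x = b \<star> y - a \<star> z"
      using w x by (simp_all add: algebra_simps eq_neg_iff_add_eq_0)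
    have n: "a \<star> (star a \<star> v) = - v - b \<star> (b \<star> v)" for v
      unfolding eq_diff_eq by (rule norm_act)
    have n': "star a \<star> (a \<star> v) = - v - b \<star> (b \<star> v)" for v
      unfolding eq_diff_eq conv_left_commute[of "star a" a v] by (rule norm_act)
    have "(w, x, y, z) \<in> code a b"
      unfolding code_def w' x' by (simp add: conv_algebra n n' conv_left_commute[of b a] conv_left_commute[of b "star a"])
    then show ?thesis unfolding wxyz codewords_def by (rule imageI)
  qed
  ultimately show ?thesis unfolding self_dual_def by blast
qed

lemma three_dvd_weight:
  assumes "(w, x, y, z) \<in> code a b"
  shows "3 dvd wt w + wt x + wt y + wt z"
proof -
  have "(of_nat (wt w + wt x + wt y + wt z) :: F3) = of_nat 0"
    using self_orthogonal[OF assms assms] by (simp add: dot_self)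
  then show ?thesis unfolding of_nat_F3_eq by (simp add: dvd_eq_mod_eq_0)
qed

lemma code_with_parameters:
  assumes "\<And>w x y z. (w, x, y, z) \<in> code a b \<Longrightarrow> (w, x, y, z) \<noteq> (0, 0, 0, 0) \<Longrightarrow> 15 < wt w + wt x + wt y + wt z"
    and "(w, x, y, z) \<in> code a b" "wt w + wt x + wt y + wt z = 18"
  shows "code_with_parameters 76 38 18 codewords"
proof -
  have "18 \<le> hamming_weight v" if "v \<in> codewords - {0}" for v
  proof -
    obtain w x y z where v: "(w, x, y, z) \<in> code a b" "v = assemble (w, x, y, z)"
      using \<open>v \<in> codewords - {0}\<close> unfolding codewords_def by auto
    moreover from this have "(w, x, y, z) \<noteq> (0, 0, 0, 0)" using that assemble_0 by auto
    ultimately have "15 < hamming_weight v" "3 dvd hamming_weight v"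
      using assms(1) three_dvd_weight by (simp_all add: weight_assemble)
    then show ?thesis by presburger
  qed
  moreover have "18 \<in> hamming_weight ` (codewords - {0})"
  proof (rule image_eqI)
    show "18 = hamming_weight (assemble (w, x, y, z))" using assms(3) by (simp add: weight_assemble)
    then show "assemble (w, x, y, z) \<in> codewords - {0}" using assms(2) by (auto simp: codewords_def)
  qed
  ultimately have "minimum_distance codewords = 18"
    unfolding minimum_distance_def by (intro Min_eqI) auto
  then show ?thesis unfolding code_with_parameters_def using subspace_codewords dim_codewords by simp
qed

end

lemma weight_distribution_equivalent:
  fixes C D :: "(F3 ^ 'n::finite) set"
  assumes "equivalent_codes C D"
  shows "card {v \<in> C. hamming_weight v = k} = card {v \<in> D. hamming_weight v = k}"
proof -
  obtain p c where p: "bij p" and c: "\<forall>i. c i \<noteq> 0" and D: "D = monomial_map p c ` C"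
    using assms unfolding equivalent_codes_def by blast
  have inj: "inj (monomial_map p c)"
  proof (rule injI)
    fix x y assume "monomial_map p c x = monomial_map p c y"
    then have "x $ p i = y $ p i" for i using c by (simp add: monomial_map_def vec_eq_iff)
    then show "x = y" using p by (metis vec_eq_iff bij_pointE)
  qed
  have weight: "hamming_weight (monomial_map p c x) = hamming_weight x" for x
  proof -
    have "bij_betw p {i. x $ p i \<noteq> 0} {i. x $ i \<noteq> 0}"
      using p by (auto simp: bij_betw_def inj_on_def bij_def)
    then show ?thesis using c by (simp add: hamming_weight_def monomial_map_def bij_betw_same_card)
  qed
  have "{v \<in> D. hamming_weight v = k} = monomial_map p c ` {v \<in> C. hamming_weight v = k}"
    unfolding D using weight by auto
  then show ?thesis using inj by (simp add: card_image inj_on_subset)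
qed

section \<open>Counting words of weight 75 modulo 3\<close>

text \<open>A map whose third iterate is the identity has orbits of size 1 or 3; each induction step
  removes one orbit of size 3.\<close>

lemma card_fixed_points_mod_3:
  assumes "finite X" "\<And>x. x \<in> X \<Longrightarrow> f x \<in> X" "\<And>x. x \<in> X \<Longrightarrow> f (f (f x)) = x"
  shows "card X mod 3 = card {x \<in> X. f x = x} mod 3"
  using assms
proof (induction "card X" arbitrary: X rule: less_induct)
  case less
  show ?case
  proof (cases "\<exists>x\<in>X. f x \<noteq> x")
    case False
    then have "{x \<in> X. f x = x} = X" by auto
    then show ?thesis by simp
  next
    case True
    then obtain x where x: "x \<in> X" "f x \<noteq> x" by auto
    define Orb where "Orb = {x, f x, f (f x)}"
    have fff: "f (f (f x)) = x" using less.prems(3) x by simp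
    have "f (f x) \<noteq> f x" using fff x less.prems by metis
    moreover have "f (f x) \<noteq> x" using fff x(2) by metis
    ultimately have cO: "card Orb = 3" using x(2) by (simp add: Orb_def)
    have OX: "Orb \<subseteq> X" using x less.prems(2) by (auto simp: Orb_def)
    then have card: "card X = card (X - Orb) + 3"
      using cO less.prems(1) card_mono[OF less.prems(1) OX] by (simp add: card_Diff_subset finite_subset)
    have closed: "f y \<in> X - Orb" if "y \<in> X - Orb" for y
    proof -
      have "f y \<notin> Orb"
      proof
        assume "f y \<in> Orb"
        then have "f (f (f y)) \<in> Orb" using fff by (auto simp: Orb_def)
        then show False using less.prems(3) that by simp
      qed
      then show ?thesis using less.prems(2) that by simp
    qed
    have "card (X - Orb) mod 3 = card {y \<in> X - Orb. f y = y} mod 3"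
      using closed less.prems card by (intro less.hyps) auto
    moreover have "{y \<in> X - Orb. f y = y} = {y \<in> X. f y = y}"
      using x(2) \<open>f (f x) \<noteq> f x\<close> \<open>f (f x) \<noteq> x\<close> fff by (auto simp: Orb_def)
    ultimately show ?thesis using card by simp
  qed
qed

text \<open>The values lie in \<open>F3\<close>, so summing indicators counts modulo 3 and the
  numbers stay small during evaluation.\<close>

primrec bag_sum :: "('a \<Rightarrow> F3) \<Rightarrow> 'a bag \<Rightarrow> F3" where
  "bag_sum g E = 0" | "bag_sum g (U i) = g i" | "bag_sum g (J x y) = bag_sum g x + bag_sum g y"

definition signs :: "nat \<Rightarrow> F3 list set" where
  "signs n = {cs. set cs \<subseteq> {1, -1} \<and> length cs = n}"

lemma finite_signs [simp]: "finite (signs n)"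
  unfolding signs_def by (rule finite_lists_length_eq) simp

lemma sum_signs_Suc: "(\<Sum>cs\<in>signs (Suc n). g cs) = (\<Sum>cs\<in>signs n. g (1 # cs)) + (\<Sum>cs\<in>signs n. g (-1 # cs))"
  for g :: "F3 list \<Rightarrow> F3"
proof -
  have "signs (Suc n) = (#) 1 ` signs n \<union> (#) (-1) ` signs n"
    by (auto simp: signs_def image_iff length_Suc_conv)
  moreover have "(1 :: F3) \<noteq> -1" by (simp add: one_finite_3_def uminus_finite_3_def)
  then have "(#) (1 :: F3) ` signs n \<inter> (#) (-1) ` signs n = {}" by auto
  ultimately show ?thesis by (simp add: sum.union_disjoint sum.reindex)
qed

lemma bag_sum_ssums:
  assumes "length v = 38" "\<forall>r\<in>set rs. length r = 38"
  shows "bag_sum g (ssums n v (pairneg rs)) =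
    (\<Sum>cs\<in>signs (length rs). g (n, map (\<lambda>j. v ! j + (\<Sum>k<length rs. cs ! k * rs ! k ! j)) [0..<38]))"
  using assms
proof (induction rs arbitrary: v)
  case Nil
  have "signs 0 = {[]}" by (auto simp: signs_def)
  moreover have "map (\<lambda>j. v ! j) [0..<38] = v" using Nil by (metis map_nth)
  ultimately show ?case by simp
next
  case (Cons r rs)
  have step: "map (\<lambda>j. add v r ! j + (\<Sum>k<length rs. cs ! k * rs ! k ! j)) [0..<38] =
      map (\<lambda>j. v ! j + (\<Sum>k<length (r # rs). (1 # cs) ! k * (r # rs) ! k ! j)) [0..<38]"
    "map (\<lambda>j. add v (neg r) ! j + (\<Sum>k<length rs. cs ! k * rs ! k ! j)) [0..<38] =
      map (\<lambda>j. v ! j + (\<Sum>k<length (r # rs). (-1 # cs) ! k * (r # rs) ! k ! j)) [0..<38]" for cs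
    using Cons.prems by (auto simp: nth_add nth_neg sum.lessThan_Suc_shift simp del: sum.lessThan_Suc)
  have "bag_sum g (ssums n v (pairneg (r # rs))) =
      (\<Sum>cs\<in>signs (length rs). g (n, map (\<lambda>j. add v r ! j + (\<Sum>k<length rs. cs ! k * rs ! k ! j)) [0..<38]))
      + (\<Sum>cs\<in>signs (length rs). g (n, map (\<lambda>j. add v (neg r) ! j + (\<Sum>k<length rs. cs ! k * rs ! k ! j)) [0..<38]))"
    using Cons by simp
  then show ?case unfolding step by (simp only: list.size(4) add_0_right One_nat_def add_Suc_right sum_signs_Suc)
qed

text \<open>Here \<open>k\<close> is the number of zeros already present in the first two blocks.
  The value is 1 exactly if the whole word has one zero, that is weight 75, and evaluation can stop
  at a second zero.\<close>

definition exact :: "nat \<Rightarrow> F3 list \<Rightarrow> F3 list \<Rightarrow> F3" where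
  "exact k l m = (if k + length (filter (\<lambda>x. x = Z) (add l m)) = 1 then P else Z)"

definition count_pairs :: "(nat \<times> F3 list) bag \<Rightarrow> (nat \<times> F3 list) bag \<Rightarrow> F3" where
  "count_pairs S T = bag_sum (\<lambda>(n, l). bag_sum (\<lambda>(m, l'). exact (n + m) l l') T) S"

lemma exact_eval:
  "exact (Suc (Suc k)) l m = Z" "exact 0 [] m = Z" "exact (Suc 0) [] m = P"
  "exact 0 (Z # l) (Z # m) = exact (Suc 0) l m" "exact 0 (Z # l) (P # m) = exact 0 l m" "exact 0 (Z # l) (M # m) = exact 0 l m"
  "exact 0 (P # l) (Z # m) = exact 0 l m" "exact 0 (P # l) (P # m) = exact 0 l m" "exact 0 (P # l) (M # m) = exact (Suc 0) l m"
  "exact 0 (M # l) (Z # m) = exact 0 l m" "exact 0 (M # l) (P # m) = exact (Suc 0) l m" "exact 0 (M # l) (M # m) = exact 0 l m"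
  "exact (Suc 0) (Z # l) (Z # m) = Z" "exact (Suc 0) (Z # l) (P # m) = exact (Suc 0) l m" "exact (Suc 0) (Z # l) (M # m) = exact (Suc 0) l m"
  "exact (Suc 0) (P # l) (Z # m) = exact (Suc 0) l m" "exact (Suc 0) (P # l) (P # m) = exact (Suc 0) l m" "exact (Suc 0) (P # l) (M # m) = Z"
  "exact (Suc 0) (M # l) (Z # m) = exact (Suc 0) l m" "exact (Suc 0) (M # l) (P # m) = Z" "exact (Suc 0) (M # l) (M # m) = exact (Suc 0) l m"
  by (simp_all add: exact_def add_eval)

lemma count_pairs_eval:
  "count_pairs (J a b) T = count_pairs a T + count_pairs b T"
  "count_pairs (U i) (J t u) = count_pairs (U i) t + count_pairs (U i) u"
  "count_pairs (U (n, l)) (U (m, l')) = exact (n + m) l l'"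
  by (simp_all add: count_pairs_def case_prod_unfold)

text \<open>A vector invariant under 7 has one coefficient on each orbit. The triples are the six
  orbits of length 3, each listed as \<open>i\<close>, \<open>7 i\<close>, \<open>49 i\<close>
  modulo 19.\<close>

definition orbit_sums :: "F3 list list \<Rightarrow> F3 list list" where
  "orbit_sums rs = map (\<lambda>(i, j, k). add (rs ! i) (add (rs ! j) (rs ! k)))
    [(1, 7, 11), (2, 14, 3), (4, 9, 6), (5, 16, 17), (8, 18, 12), (10, 13, 15)]"

text \<open>The number in an entry is no longer a budget but a count of zeros: 1 if the coefficient
  at residue 0 vanishes, otherwise 0.\<close>

definition full_words :: "F3 list list \<Rightarrow> (nat \<times> F3 list) bag" where
  "full_words rs = (let os = pairneg (orbit_sums rs) in
    J (ssums 1 zeros os) (J (ssums 0 (rs ! 0) os) (ssums 0 (neg (rs ! 0)) os)))"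

text \<open>The orbits of \<open>i \<mapsto> 7 i\<close> on residues modulo 19, numbered in the order of their least elements.\<close>

definition orbit_of :: "nat list" where
  "orbit_of = [0, 1, 2, 2, 3, 4, 3, 1, 5, 3, 6, 1, 5, 6, 2, 6, 4, 4, 5]"

definition fixed :: "F3 \<Rightarrow> F3 list \<Rightarrow> F3 ^ 19" where
  "fixed c cs = (\<chi> r. (c # cs) ! (orbit_of ! residue (- r)))"

lemma fixed_nth: "i < 19 \<Longrightarrow> fixed c cs $ (- of_nat i) = (c # cs) ! (orbit_of ! i)"
  by (simp add: fixed_def residue_of_nat)

lemma vec_eq_minus_iff: "x = y \<longleftrightarrow> (\<forall>i<19. x $ (- of_nat i :: 19) = y $ (- of_nat i))"
  for x y :: "F3 ^ 19"
proof
  assume *: "\<forall>i<19. x $ (- of_nat i :: 19) = y $ (- of_nat i)"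
  show "x = y"
  proof (simp add: vec_eq_iff, rule allI)
    fix r show "x $ r = y $ r" using *[rule_format, of "residue (- r)"] by simp
  qed
qed simp

lemma lt_19: "i < 19 \<longleftrightarrow> i \<in> {0, 1, 2, 3, 4, 5, 6, 7, 8, 9, 10, 11, 12, 13, 14, 15, 16, 17, 18 :: nat}"
proof -
  have "i < 19 \<longleftrightarrow> i \<in> set [0..<19]" by simp
  also have "[0..<19] = [0, 1, 2, 3, 4, 5, 6, 7, 8, 9, 10, 11, 12, 13, 14, 15, 16, 17, 18]" by (simp add: upt_rec)
  finally show ?thesis by (simp only: list.set)
qed

lemma times7_orbit: "i < 19 \<Longrightarrow> orbit_of ! (7 * i mod 19) = orbit_of ! i"
  unfolding lt_19 orbit_of_def by (elim insertE emptyE) simp_all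

lemma invariant7_fixed: "invariant7 (fixed c cs)"
  unfolding invariant7_def vec_eq_minus_iff
proof (intro allI impI)
  fix i :: nat assume i: "i < 19"
  have "affine 7 0 (fixed c cs) $ (- of_nat i) = fixed c cs $ (- of_nat (7 * i mod 19))"
    by (simp add: affine_nth)
  also have "\<dots> = (c # cs) ! (orbit_of ! (7 * i mod 19))" by (rule fixed_nth) simp
  also have "\<dots> = fixed c cs $ (- of_nat i)" using i by (simp add: times7_orbit fixed_nth)
  finally show "affine 7 0 (fixed c cs) $ (- of_nat i) = fixed c cs $ (- of_nat i)" .
qed

lemma invariant7_imp_fixed:
  assumes "invariant7 x"
  obtains c cs where "length cs = 6" "x = fixed c cs"
proof -
  define g where "g i = x $ (- of_nat i)" for i :: nat
  have g7: "g (7 * i mod 19) = g i" for i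
  proof -
    have "g (7 * i mod 19) = affine 7 0 x $ (- of_nat i)" by (simp add: g_def affine_nth)
    then show ?thesis using assms by (simp add: invariant7_def g_def)
  qed
  have eqs: "g 7 = g 1" "g 11 = g 7" "g 14 = g 2" "g 3 = g 14" "g 9 = g 4" "g 6 = g 9" "g 16 = g 5" "g 17 = g 16"
    "g 18 = g 8" "g 12 = g 18" "g 13 = g 10" "g 15 = g 13"
    using g7[of 1] g7[of 7] g7[of 2] g7[of 14] g7[of 4] g7[of 9] g7[of 5] g7[of 16] g7[of 8] g7[of 18] g7[of 10] g7[of 13]
    by simp_all
  have "x = fixed (g 0) [g 1, g 2, g 4, g 5, g 8, g 10]"
    unfolding vec_eq_minus_iff
  proof (intro allI impI)
    fix i :: nat assume i: "i < 19"
    then have "(g 0 # [g 1, g 2, g 4, g 5, g 8, g 10]) ! (orbit_of ! i) = g i"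
      unfolding lt_19 orbit_of_def using eqs by (elim insertE emptyE) simp_all
    with i show "x $ (- of_nat i) = fixed (g 0) [g 1, g 2, g 4, g 5, g 8, g 10] $ (- of_nat i)"
      by (simp add: fixed_nth g_def)
  qed
  then show ?thesis by (intro that[of "[g 1, g 2, g 4, g 5, g 8, g 10]" "g 0"]) simp_all
qed

lemma inj_fixed: "inj_on (\<lambda>(c, cs). fixed c cs) (UNIV \<times> {cs. length cs = 6})"
proof (rule inj_onI, clarsimp)
  fix c d cs ds assume l: "length cs = 6" "length ds = 6" and eq: "fixed c cs = fixed d ds"
  have *: "(c # cs) ! (orbit_of ! i) = (d # ds) ! (orbit_of ! i)" if "i < 19" for i
    using fixed_nth[OF that, of c cs] fixed_nth[OF that, of d ds] eq by simp
  have "(c # cs) ! k = (d # ds) ! k" if "k < 7" for k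
  proof -
    have "k \<in> set orbit_of" using that unfolding orbit_of_def by auto
    moreover have "length orbit_of = 19" by (simp add: orbit_of_def)
    ultimately show ?thesis using * by (metis in_set_conv_nth)
  qed
  then have "c # cs = d # ds" using l by (intro nth_equalityI) auto
  then show "c = d \<and> cs = ds" by simp
qed

lemma list6: "length cs = 6 \<longleftrightarrow> (\<exists>a b c d e f. cs = [a, b, c, d, e, f])"
  by (auto simp: numeral_eq_Suc length_Suc_conv)

lemma sum_19: "(\<Sum>i<19. g i) = g 0 + g 1 + g 2 + g 3 + g 4 + g 5 + g 6 + g 7 + g 8 + g 9 + g 10
    + g 11 + g 12 + g 13 + g 14 + g 15 + g 16 + g 17 + g (18 :: nat)"
  for g :: "nat \<Rightarrow> 'a::comm_monoid_add"
  by (simp add: numeral_eq_Suc)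

lemma comb_fixed:
  assumes "length cs = 6" "length rs = 19" "\<forall>r\<in>set rs. length r = 38" "length v = 38" "\<And>j. j < 38 \<Longrightarrow> v ! j = c * rs ! 0 ! j"
  shows "map (\<lambda>j. v ! j + (\<Sum>k<length (orbit_sums rs). cs ! k * orbit_sums rs ! k ! j)) [0..<38] =
    comb (\<lambda>i. fixed c cs $ (- of_nat i)) rs"
proof -
  obtain d1 d2 d3 d4 d5 d6 where cs: "cs = [d1, d2, d3, d4, d5, d6]" using assms(1) unfolding list6 by auto
  have len: "i < 19 \<Longrightarrow> length (rs ! i) = 38" for i using assms(2,3) by simp
  have "v ! j + (\<Sum>k<length (orbit_sums rs). cs ! k * orbit_sums rs ! k ! j) =
      (\<Sum>i<19. (c # cs) ! (orbit_of ! i) * rs ! i ! j)" if j: "j < 38" for j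
    unfolding sum_19 cs using j
    by (simp add: assms(5) orbit_sums_def orbit_of_def numeral_eq_Suc nth_add len algebra_simps)
  then show ?thesis using assms(2) by (simp add: comb_def fixed_nth)
qed

lemma hamming_weight_zeros: "wt x + wt y + length (filter (\<lambda>c. c = Z) (trits x @ trits y)) = 38"
proof -
  have "wt x + length (filter (\<lambda>c. c = Z) (trits x)) = 19" for x
  proof -
    have "wt x = length (filter (\<lambda>c. c \<noteq> Z) (trits x))"
      using card_residues[of "\<lambda>r. x $ r \<noteq> 0"]
      by (simp add: hamming_weight_def length_filter_conv_card nth_trits F3_constants cong: conj_cong)
    then show ?thesis using sum_length_filter_compl[of "\<lambda>c. c = Z" "trits x"] by simp
  qed
  from this[of x] this[of y] show ?thesis by simp
qed

lemma wt_fixed: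
  "wt (fixed c [d1, d2, d3, d4, d5, d6]) = of_bool (c \<noteq> 0) + 3 * (of_bool (d1 \<noteq> 0) + of_bool (d2 \<noteq> 0)
    + of_bool (d3 \<noteq> 0) + of_bool (d4 \<noteq> 0) + of_bool (d5 \<noteq> 0) + of_bool (d6 \<noteq> 0))"
proof -
  let ?cs = "[d1, d2, d3, d4, d5, d6]"
  have "wt (fixed c ?cs) = card {i. i < 19 \<and> fixed c ?cs $ (- of_nat i) \<noteq> 0}"
    unfolding hamming_weight_def by (rule card_minus_residues[symmetric])
  also have "\<dots> = card {i \<in> {..<19}. (c # ?cs) ! (orbit_of ! i) \<noteq> 0}"
    by (intro arg_cong[where f = card]) (auto simp: fixed_nth)
  also have "\<dots> = (\<Sum>i<19. of_bool ((c # ?cs) ! (orbit_of ! i) \<noteq> 0))" by (simp add: Int_def)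
  also have "\<dots> = of_bool ((c # ?cs) ! 0 \<noteq> 0) + 3 * (of_bool ((c # ?cs) ! 1 \<noteq> 0) + of_bool ((c # ?cs) ! 2 \<noteq> 0)
      + of_bool ((c # ?cs) ! 3 \<noteq> 0) + of_bool ((c # ?cs) ! 4 \<noteq> 0) + of_bool ((c # ?cs) ! 5 \<noteq> 0)
      + of_bool ((c # ?cs) ! 6 \<noteq> 0))"
  proof -
    have "(\<Sum>i<19. e (orbit_of ! i)) = e 0 + 3 * (e 1 + e 2 + e 3 + e 4 + e 5 + e 6)" for e :: "nat \<Rightarrow> nat"
      unfolding sum_19 orbit_of_def by simp
    from this[of "\<lambda>k. of_bool ((c # ?cs) ! k \<noteq> 0)"] show ?thesis .
  qed
  finally show ?thesis by simp
qed

text \<open>Invariant vectors with no zero outside residue 0. There are 3 choices at 0 and 2 on each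
  of the six long orbits, which makes 192.\<close>

definition dense :: "(F3 ^ 19) set" where
  "dense = (\<lambda>(c, cs). fixed c cs) ` (UNIV \<times> signs 6)"

lemma signs6: "cs \<in> signs 6 \<longleftrightarrow> (\<exists>a b c d e f. cs = [a, b, c, d, e, f] \<and> a \<noteq> 0 \<and> b \<noteq> 0 \<and> c \<noteq> 0 \<and> d \<noteq> 0 \<and> e \<noteq> 0 \<and> f \<noteq> 0)"
proof -
  define S :: "F3 set" where "S = {1, -1}"
  have "x \<in> S \<longleftrightarrow> x \<noteq> 0" for x by (cases x rule: F3_cases) (auto simp: S_def)
  then have sub: "set [a, b, c, d, e, f] \<subseteq> S \<longleftrightarrow> a \<noteq> 0 \<and> b \<noteq> 0 \<and> c \<noteq> 0 \<and> d \<noteq> 0 \<and> e \<noteq> 0 \<and> f \<noteq> 0" for a b c d e f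
    by simp
  show ?thesis unfolding signs_def S_def[symmetric] mem_Collect_eq list6
  proof
    assume "set cs \<subseteq> S \<and> (\<exists>a b c d e f. cs = [a, b, c, d, e, f])"
    then obtain a b c d e f where cs: "cs = [a, b, c, d, e, f]" "set cs \<subseteq> S" by blast
    from cs(2) show "\<exists>a b c d e f. cs = [a, b, c, d, e, f] \<and> a \<noteq> 0 \<and> b \<noteq> 0 \<and> c \<noteq> 0 \<and> d \<noteq> 0 \<and> e \<noteq> 0 \<and> f \<noteq> 0"
      unfolding cs(1) sub by blast
  next
    assume "\<exists>a b c d e f. cs = [a, b, c, d, e, f] \<and> a \<noteq> 0 \<and> b \<noteq> 0 \<and> c \<noteq> 0 \<and> d \<noteq> 0 \<and> e \<noteq> 0 \<and> f \<noteq> 0"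
    then obtain a b c d e f where cs: "cs = [a, b, c, d, e, f]"
      "a \<noteq> 0 \<and> b \<noteq> 0 \<and> c \<noteq> 0 \<and> d \<noteq> 0 \<and> e \<noteq> 0 \<and> f \<noteq> 0" by blast
    from cs(2) show "set cs \<subseteq> S \<and> (\<exists>a b c d e f. cs = [a, b, c, d, e, f])"
      unfolding sub[symmetric] cs(1) by blast
  qed
qed

lemma wt_dense: "cs \<in> signs 6 \<Longrightarrow> wt (fixed c cs) = (if c = 0 then 18 else 19)"
  unfolding signs6 by (auto simp: wt_fixed)

text \<open>A zero coefficient on a long orbit costs three places at once, so weights 17 to 19 force
  a dense vector.\<close>

lemma wt_not_dense:
  assumes "invariant7 x" "x \<notin> dense"
  shows "wt x \<le> 16"
proof -
  obtain c cs where x: "length cs = 6" "x = fixed c cs" using invariant7_imp_fixed[OF assms(1)] by metis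
  then have "cs \<notin> signs 6" using assms(2) by (auto simp: dense_def)
  moreover obtain d1 d2 d3 d4 d5 d6 where cs: "cs = [d1, d2, d3, d4, d5, d6]" using x(1) unfolding list6 by auto
  ultimately have "d1 = 0 \<or> d2 = 0 \<or> d3 = 0 \<or> d4 = 0 \<or> d5 = 0 \<or> d6 = 0" unfolding signs6 by auto
  then show ?thesis unfolding x(2) cs wt_fixed by (auto simp: of_bool_def)
qed

lemma wt_le_19: "wt x \<le> 19"
proof -
  have "card {i. x $ i \<noteq> 0} \<le> CARD(19)" by (rule card_mono) auto
  then show ?thesis by (simp add: hamming_weight_def)
qed

lemma bag_sum_full_words:
  assumes "length rs = 19" "\<forall>r\<in>set rs. length r = 38"
  shows "bag_sum g (full_words rs) = (\<Sum>w\<in>dense. g (19 - wt w, comb (\<lambda>i. w $ (- of_nat i)) rs))"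
proof -
  have len: "i < 19 \<Longrightarrow> length (rs ! i) = 38" for i using assms by simp
  have os: "length (orbit_sums rs) = 6" "\<forall>r\<in>set (orbit_sums rs). length r = 38"
    by (simp_all add: orbit_sums_def len)
  have part: "bag_sum g (ssums n v (pairneg (orbit_sums rs))) =
      (\<Sum>cs\<in>signs 6. g (19 - wt (fixed c cs), comb (\<lambda>i. fixed c cs $ (- of_nat i)) rs))"
    if "length v = 38" "\<And>j. j < 38 \<Longrightarrow> v ! j = c * rs ! 0 ! j" "n = (if c = 0 then 1 else 0)" for n v c
  proof -
    have "bag_sum g (ssums n v (pairneg (orbit_sums rs))) =
      (\<Sum>cs\<in>signs 6. g (n, map (\<lambda>j. v ! j + (\<Sum>k<length (orbit_sums rs). cs ! k * orbit_sums rs ! k ! j)) [0..<38]))"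
      using bag_sum_ssums[OF that(1) os(2)] os(1) by simp
    also have "\<dots> = (\<Sum>cs\<in>signs 6. g (19 - wt (fixed c cs), comb (\<lambda>i. fixed c cs $ (- of_nat i)) rs))"
    proof (rule sum.cong[OF refl])
      fix cs assume cs: "cs \<in> signs 6"
      then have "length cs = 6" by (simp add: signs_def)
      from comb_fixed[OF this assms that(1,2)] wt_dense[OF cs, of c] that(3)
      show "g (n, map (\<lambda>j. v ! j + (\<Sum>k<length (orbit_sums rs). cs ! k * orbit_sums rs ! k ! j)) [0..<38]) =
        g (19 - wt (fixed c cs), comb (\<lambda>i. fixed c cs $ (- of_nat i)) rs)" by auto
    qed
    finally show ?thesis .
  qed
  have inj: "inj_on (\<lambda>(c, cs). fixed c cs) (UNIV \<times> signs 6)"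
    by (rule inj_on_subset[OF inj_fixed]) (auto simp: signs_def)
  have "(\<Sum>w\<in>dense. g (19 - wt w, comb (\<lambda>i. w $ (- of_nat i)) rs)) =
      (\<Sum>c\<in>UNIV. \<Sum>cs\<in>signs 6. g (19 - wt (fixed c cs), comb (\<lambda>i. fixed c cs $ (- of_nat i)) rs))"
    unfolding dense_def sum.reindex[OF inj] by (simp add: sum.cartesian_product case_prod_unfold)
  also have "(UNIV :: F3 set) = {0, 1, -1}" using F3_cases by auto
  also have "(\<Sum>c\<in>{0, 1, -1}. \<Sum>cs\<in>signs 6. g (19 - wt (fixed c cs), comb (\<lambda>i. fixed c cs $ (- of_nat i)) rs)) =
      bag_sum g (ssums 1 zeros (pairneg (orbit_sums rs))) + (bag_sum g (ssums 0 (rs ! 0) (pairneg (orbit_sums rs)))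
        + bag_sum g (ssums 0 (neg (rs ! 0)) (pairneg (orbit_sums rs))))"
  proof -
    have "(0::F3) \<noteq> 1" "(0::F3) \<noteq> -1" "(1::F3) \<noteq> -1" by (simp_all add: zero_finite_3_def one_finite_3_def uminus_finite_3_def)
    then show ?thesis
      using part[of zeros 0 1] part[of "rs ! 0" 1 0] part[of "neg (rs ! 0)" "-1" 0]
      by (simp add: nth_zeros nth_neg len)
  qed
  finally show ?thesis by (simp add: full_words_def Let_def)
qed

context circulant_code
begin

lemma heavy_words_mod_3:
  assumes "invariant7 a" "invariant7 b"
    and count: "count_pairs (full_words (circ 19 (trits a) (trits b))) (full_words (circ 19 (trits (- b)) (trits (star a)))) = of_nat n"
  shows "card {v \<in> codewords. hamming_weight v = 75} mod 3 = n mod 3"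
proof -
  define X where "X = {v \<in> code a b. hamming_weight (assemble v) = 75}"
  define f :: "blocks \<Rightarrow> blocks" where "f = (\<lambda>(w, x, y, z). (affine 7 0 w, affine 7 0 x, affine 7 0 y, affine 7 0 z))"
  have inv: "affine 7 0 a = a" "affine 7 0 b = b" using assms(1,2) by (simp_all add: invariant7_def)
  have "affine 7 0 (star a) = star (affine 7 0 a)" by (simp add: affine_affine)
  then have inv_star: "affine 7 0 (star a) = star a" by (simp only: inv)
  have c7: "affine 7 0 (p \<star> x) = affine 7 0 p \<star> affine 7 0 x" for p x
    by (rule affine_conv[where m' = 11]) simp
  have w7: "wt (affine 7 0 x) = wt x" for x by (rule wt_affine[where m' = 11]) simp
  have blocks7: "wt (a \<star> affine 7 0 w - b \<star> affine 7 0 x) = wt (a \<star> w - b \<star> x)"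
    "wt (b \<star> affine 7 0 w + star a \<star> affine 7 0 x) = wt (b \<star> w + star a \<star> x)" for w x
    using w7[of "a \<star> w - b \<star> x"] w7[of "b \<star> w + star a \<star> x"] by (simp_all only: affine_linear c7 inv inv_star)
  have "{v \<in> codewords. hamming_weight v = 75} = assemble ` X" by (auto simp: codewords_def X_def)
  then have "card {v \<in> codewords. hamming_weight v = 75} = card X"
    using inj_assemble by (simp add: card_image inj_on_subset)
  also have "card X mod 3 = card {v \<in> X. f v = v} mod 3"
  proof (rule card_fixed_points_mod_3)
    show "finite X" by simp
    show "f v \<in> X" if "v \<in> X" for v
      using that by (cases v) (auto simp: X_def f_def code_def weight_assemble w7 blocks7 affine_linear c7 inv inv_star)
    have "affine 7 0 (affine 7 0 (affine 7 0 x)) = x" for x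
    proof -
      have "(7 * 7 * 7 :: 19) = 1" by simp
      then have "affine 7 0 (affine 7 0 (affine 7 0 x)) = affine 1 0 x"
        by (simp only: affine_affine mult_zero_right add_0_right mult.assoc)
      then show ?thesis by (simp add: affine_def)
    qed
    then show "f (f (f v)) = v" for v by (cases v) (simp add: f_def)
  qed
  also have "{v \<in> X. f v = v} = (\<lambda>(w, x). (w, x, a \<star> w - b \<star> x, b \<star> w + star a \<star> x)) `
      {(w, x) \<in> dense \<times> dense. wt w + wt x + wt (a \<star> w - b \<star> x) + wt (b \<star> w + star a \<star> x) = 75}"
    (is "_ = ?g ` ?N")
  proof (intro equalityI subsetI)
    fix v assume v: "v \<in> {v \<in> X. f v = v}"
    obtain w x where wx: "v = ?g (w, x)" using v by (cases v) (auto simp: X_def code_def)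
    have "invariant7 w" "invariant7 x" using v by (auto simp: wx f_def invariant7_def)
    moreover have t: "wt w + wt x + wt (a \<star> w - b \<star> x) + wt (b \<star> w + star a \<star> x) = 75"
      using v by (simp add: wx X_def weight_assemble)
    \<comment> \<open>The other three blocks have weight at most 57 together, so each block has
      weight at least 75 - 57 = 18.\<close>
    then have "16 < wt w" "16 < wt x"
      using wt_le_19[of w] wt_le_19[of x] wt_le_19[of "a \<star> w - b \<star> x"] wt_le_19[of "b \<star> w + star a \<star> x"] by linarith+
    ultimately have "w \<in> dense" "x \<in> dense" using wt_not_dense by (meson not_le)+
    then show "v \<in> ?g ` ?N" using t wx by auto
  next
    fix v assume "v \<in> ?g ` ?N"
    then obtain w x where wx: "v = ?g (w, x)" "w \<in> dense" "x \<in> dense"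
      "wt w + wt x + wt (a \<star> w - b \<star> x) + wt (b \<star> w + star a \<star> x) = 75" by auto
    then have "affine 7 0 w = w" "affine 7 0 x = x"
      using invariant7_fixed by (auto simp: dense_def invariant7_def)
    then show "v \<in> {v \<in> X. f v = v}" using wx
      by (simp add: X_def f_def code_def weight_assemble affine_linear c7 inv inv_star)
  qed
  also have "card (?g ` ?N) = card ?N" by (rule card_image) (auto simp: inj_on_def)
  finally have card: "card {v \<in> codewords. hamming_weight v = 75} mod 3 = card ?N mod 3" .
  have fin: "finite dense" by simp
  have "of_nat n = (\<Sum>w\<in>dense. \<Sum>x\<in>dense. exact (19 - wt w + (19 - wt x))
      (comb (\<lambda>i. w $ (- of_nat i)) (circ 19 (trits a) (trits b)))
      (comb (\<lambda>i. x $ (- of_nat i)) (circ 19 (trits (- b)) (trits (star a)))))"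
    unfolding count[symmetric] count_pairs_def by (simp add: bag_sum_full_words length_circ_row)
  also have "\<dots> = (\<Sum>w\<in>dense. \<Sum>x\<in>dense. of_bool (wt w + wt x + wt (a \<star> w - b \<star> x) + wt (b \<star> w + star a \<star> x) = 75))"
  proof (intro sum.cong refl)
    fix w x
    have "add (trits (a \<star> w) @ trits (b \<star> w)) (trits ((- b) \<star> x) @ trits (star a \<star> x)) =
        trits (a \<star> w - b \<star> x) @ trits (b \<star> w + star a \<star> x)"
      by (rule nth_equalityI) (auto simp: nth_add nth_append nth_trits conv_algebra)
    then show "exact (19 - wt w + (19 - wt x)) (comb (\<lambda>i. w $ (- of_nat i)) (circ 19 (trits a) (trits b)))
        (comb (\<lambda>i. x $ (- of_nat i)) (circ 19 (trits (- b)) (trits (star a)))) =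
      of_bool (wt w + wt x + wt (a \<star> w - b \<star> x) + wt (b \<star> w + star a \<star> x) = 75)"
      using hamming_weight_zeros[of "a \<star> w - b \<star> x" "b \<star> w + star a \<star> x"] wt_le_19[of w] wt_le_19[of x]
      unfolding comb_circ exact_def by (auto simp: F3_constants)
  qed
  also have "\<dots> = (\<Sum>p\<in>dense \<times> dense. of_bool (p \<in> ?N))"
    unfolding sum.cartesian_product by (rule sum.cong) auto
  also have "\<dots> = of_nat (card (dense \<times> dense \<inter> ?N))"
    by (subst sum_of_bool_eq) (use fin in auto)
  also have "dense \<times> dense \<inter> ?N = ?N" by auto
  finally show ?thesis unfolding card of_nat_F3_eq by simp
qed

end

section \<open>The two codes\<close>

text \<open>Multiplication modulo \<open>X^19 - 1\<close> by a Horner scheme. \<open>rotate1\<close>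
  shifts to the left, and the term with index \<open>i\<close> is shifted \<open>19 - i\<close>
  times, which amounts to a shift by \<open>i\<close> to the right.\<close>

fun horner :: "F3 list \<Rightarrow> F3 list \<Rightarrow> F3 list \<Rightarrow> F3 list" where
  "horner l [] acc = acc"
| "horner l (Z # cs) acc = horner l cs (rotate1 acc)"
| "horner l (P # cs) acc = horner l cs (rotate1 (add acc l))"
| "horner l (M # cs) acc = horner l cs (rotate1 (add acc (neg l)))"

lemma horner_Cons: "horner (trits p) (c # cs) (trits v) = horner (trits p) cs (trits (affine 1 1 (v + c *s p)))"
proof -
  have add: "add (trits v) (trits p) = trits (v + p)" "add (trits v) (neg (trits p)) = trits (v - p)"
    by (rule nth_equalityI; simp add: nth_add nth_neg nth_trits)+
  have scale: "v + Z *s p = v" "v + P *s p = v + p" "v + M *s p = v - p"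
    unfolding F3_constants(1,2,4)[symmetric] by (simp_all add: vec_eq_iff)
  show ?thesis by (cases c) (simp_all only: horner.simps rotate1_trits add scale)
qed

lemma horner_trits:
  "horner (trits p) cs (trits v) =
    trits (affine 1 (of_nat (length cs)) v + (\<Sum>i<length cs. cs ! i *s affine 1 (of_nat (length cs - i)) p))"
proof (induction cs arbitrary: v)
  case Nil
  then show ?case by (simp add: affine_def)
next
  case (Cons c cs)
  have scale: "affine m k (c *s x) = c *s affine m k x" for m k c x by (simp add: affine_def vec_eq_iff)
  show ?case
    unfolding horner_Cons Cons.IH
    by (simp add: affine_linear affine_affine scale sum.lessThan_Suc_shift ac_simps del: sum.lessThan_Suc)
qed

lemma conv_of_trits:
  assumes "length l = 19" "length m = 19"
  shows "of_trits l \<star> of_trits m = of_trits (horner l m (replicate 19 Z))"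
proof -
  define p x where "p = of_trits l" and "x = of_trits m"
  have l: "l = trits p" and m: "m = trits x" using assms by (simp_all add: p_def x_def trits_of_trits)
  have z: "replicate 19 Z = trits 0" by (rule nth_equalityI) (simp_all add: nth_trits F3_constants)
  have minus: "of_nat (19 - i) = (- of_nat i :: 19)" if "i < 19" for i
  proof -
    have "of_nat (19 - i) + of_nat i = (of_nat 19 :: 19)" using that by (simp flip: of_nat_add)
    also have "\<dots> = 0" by simp
    finally show ?thesis by (simp only: eq_neg_iff_add_eq_0)
  qed
  have "(\<Sum>i<19. x $ of_nat i *s affine 1 (of_nat (19 - i)) p) = p \<star> x"
  proof -
    have "(\<Sum>i<19. x $ of_nat i * p $ (r + of_nat (19 - i))) = (\<Sum>i\<in>UNIV. x $ i * p $ (r - i))" for r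
      using sum.reindex_bij_betw[OF bij_of_nat_19, of "\<lambda>i. x $ i * p $ (r - i)"]
      by (simp add: minus del: of_nat_diff)
    then show ?thesis by (simp add: vec_eq_iff conv_nth affine_nth sum_component)
  qed
  then show ?thesis unfolding z l m horner_trits by (simp add: affine_linear nth_trits of_trits_trits)
qed

lemma affine_of_trits:
  assumes "length l = 19"
  shows "affine (of_nat k) 0 (of_trits l) = of_trits (map (\<lambda>i. l ! (k * i mod 19)) [0..<19])"
proof -
  have l: "l = trits (of_trits l)" using assms by (simp add: trits_of_trits)
  have "map (\<lambda>i. l ! (k * i mod 19)) [0..<19] = trits (affine (of_nat k) 0 (of_trits l))"
    by (subst l, rule nth_equalityI) (simp_all add: nth_trits affine_nth)
  then show ?thesis by (simp add: of_trits_trits)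
qed

lemma uminus_of_trits: "length l = 19 \<Longrightarrow> - of_trits l = of_trits (neg l)"
  by (simp add: of_trits_def vec_eq_iff nth_neg)

lemma unit_of_trits: "unit = of_trits (P # replicate 18 Z)"
proof -
  have "trits unit = P # replicate 18 Z"
  proof (rule nth_equalityI)
    fix i assume "i < length (trits unit)"
    then have "i < 19" by simp
    then show "trits unit ! i = (P # replicate 18 Z) ! i"
      using of_nat_19_eq[of i 0]
      by (cases i) (auto simp: nth_trits unit_def axis_def F3_constants)
  qed simp
  then show ?thesis by (metis of_trits_trits)
qed

lemma add_of_trits: "length l = 19 \<Longrightarrow> length m = 19 \<Longrightarrow> of_trits l + of_trits m = of_trits (add l m)"
  by (simp add: of_trits_def vec_eq_iff nth_add)

lemma wt_of_trits: "length l = 19 \<Longrightarrow> wt (of_trits l) = length (filter (\<lambda>c. c \<noteq> Z) l)"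
  using card_residues[of "\<lambda>r. of_trits l $ r \<noteq> 0"]
  by (simp add: hamming_weight_def length_filter_conv_card of_trits_def residue_of_nat F3_constants cong: conj_cong)

lemma far_heavy_of_trits:
  assumes "apart3 0 13 p q r u" "apart3 13 13 p q r u" "apart3 26 12 p q r u"
    and "length p = 19" "length q = 19" "length r = 19" "length u = 19"
  shows "far_heavy (of_trits p) (of_trits q) (of_trits r) (of_trits u)"
  using assms by (simp add: far_heavy_def trits_of_trits)

lemma far_light_of_trits:
  assumes "apart1 p q r u" "apart2 0 10 p q r u" "apart2 10 10 p q r u" "apart2 20 9 p q r u" "apart2 29 9 p q r u"
    and "length p = 19" "length q = 19" "length r = 19" "length u = 19"
  shows "far_light (of_trits p) (of_trits q) (of_trits r) (of_trits u)"
  using assms by (simp add: far_light_def trits_of_trits)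

text \<open>
  Found by computer search. Here \<open>a2'\<close> is the transpose of \<open>a2\<close>, \<open>bi2\<close> and \<open>ci2\<close> are the inverses
  of \<open>b2\<close> and \<open>a2'\<close>, and \<open>ba2\<close>, \<open>ba2'\<close>, \<open>cb2\<close> are the products \<open>bi2 a2\<close>, \<open>bi2 a2'\<close>, \<open>ci2 b2\<close>. For the
  first code the maps \<open>r \<mapsto> 5 r\<close> and \<open>r \<mapsto> 4 r\<close> take the place of such products, so one third of the
  separation checks suffices.
\<close>

definition a1 :: "F3 list" where "a1 = [P, P, M, M, Z, M, Z, P, P, Z, Z, P, P, Z, M, Z, M, M, P]"
definition b1 :: "F3 list" where "b1 = [P, P, P, P, M, P, M, P, P, M, M, P, P, M, P, M, P, P, P]"
definition a2 :: "F3 list" where "a2 = [P, Z, Z, Z, P, M, P, Z, Z, P, M, Z, Z, M, Z, M, M, M, Z]"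
definition b2 :: "F3 list" where "b2 = [P, P, Z, Z, Z, Z, Z, P, P, Z, Z, P, P, Z, Z, Z, Z, Z, P]"
definition a2' :: "F3 list" where "a2' = [P, Z, M, M, M, Z, M, Z, Z, M, P, Z, Z, P, M, P, Z, Z, Z]"
definition bi2 :: "F3 list" where "bi2 = [P, Z, M, M, Z, M, Z, Z, Z, Z, Z, Z, Z, Z, M, Z, M, M, Z]"
definition ci2 :: "F3 list" where "ci2 = [P, Z, P, P, P, M, P, Z, M, P, Z, Z, M, Z, P, Z, M, M, M]"
definition ba2 :: "F3 list" where "ba2 = [P, Z, Z, Z, M, M, M, Z, M, M, M, Z, M, M, Z, M, M, M, M]"
definition ba2' :: "F3 list" where "ba2' = [P, M, M, M, M, Z, M, M, Z, M, M, M, Z, M, M, M, Z, Z, Z]"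
definition cb2 :: "F3 list" where "cb2 = [P, P, P, P, M, P, M, P, Z, M, P, P, Z, P, P, P, P, P, Z]"

lemmas second_lists = a2_def b2_def a2'_def bi2_def ci2_def ba2_def ba2'_def cb2_def

lemma star_of_trits: "length l = 19 \<Longrightarrow> star (of_trits l) = of_trits (hd l # rev (tl l))"
proof -
  assume l: "length l = 19"
  have "(-1 :: 19) = of_nat 18" by simp
  then have "star (of_trits l) = of_trits (map (\<lambda>i. l ! (18 * i mod 19)) [0..<19])"
    by (simp only: affine_of_trits[OF l])
  also have "map (\<lambda>i. l ! (18 * i mod 19)) [0..<19] = hd l # rev (tl l)"
  proof (rule nth_equalityI)
    fix i assume "i < length (map (\<lambda>i. l ! (18 * i mod 19)) [0..<19])"
    then have i: "i < 19" by simp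
    have "18 * i mod 19 = (if i = 0 then 0 else 19 - i)" using i unfolding lt_19 by (elim insertE emptyE) simp_all
    then show "map (\<lambda>i. l ! (18 * i mod 19)) [0..<19] ! i = (hd l # rev (tl l)) ! i"
    proof (cases i)
      case 0
      moreover have "l \<noteq> []" using l by auto
      ultimately show ?thesis by (simp add: hd_conv_nth)
    next
      case (Suc n)
      then have "Suc (17 - n) = 18 - n" using i by simp
      then show ?thesis using Suc i l \<open>18 * i mod 19 = _\<close> by (simp add: rev_nth nth_tl)
    qed
  qed (use l in simp)
  finally show ?thesis .
qed

lemma affine7_of_trits: "length l = 19 \<Longrightarrow> affine 7 0 (of_trits l) = of_trits (permute times7 l)"
  using permute_times7[of "of_trits l"] by (metis trits_of_trits of_trits_trits)

lemma map_multiples_19: "map (\<lambda>i. l ! (k * i mod 19)) [0..<19] = permute (map (\<lambda>i. k * i mod 19) [0..<19]) l"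
  by (simp add: permute_def)

lemma multiples_19:
  "map (\<lambda>i. 4 * i mod 19) [0..<19] = [0, 4, 8, 12, 16, 1, 5, 9, 13, 17, 2, 6, 10, 14, 18, 3, 7, 11, 15 :: nat]"
  "map (\<lambda>i. 5 * i mod 19) [0..<19] = [0, 5, 10, 15, 1, 6, 11, 16, 2, 7, 12, 17, 3, 8, 13, 18, 4, 9, 14 :: nat]"
  by (simp_all add: upt_rec)

lemma affine_4_5_of_trits:
  assumes "length l = 19"
  shows "affine 4 0 (of_trits l) = of_trits (permute [0, 4, 8, 12, 16, 1, 5, 9, 13, 17, 2, 6, 10, 14, 18, 3, 7, 11, 15] l)"
    and "affine 5 0 (of_trits l) = of_trits (permute [0, 5, 10, 15, 1, 6, 11, 16, 2, 7, 12, 17, 3, 8, 13, 18, 4, 9, 14] l)"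
  using affine_of_trits[OF assms, of 4] affine_of_trits[OF assms, of 5]
  unfolding map_multiples_19 multiples_19 by (simp_all only: of_nat_numeral)

lemmas trit_rules = conv_of_trits uminus_of_trits unit_of_trits add_of_trits star_of_trits invariant7_def affine7_of_trits
  affine_4_5_of_trits permute_def times7_def list.map nth_Cons_0 nth_Cons_Suc horner.simps rotate1.simps append.simps
  add_eval neg_eval list.sel rev.simps list.size add_0_left add_Suc add_0_right add_Suc_right One_nat_def eval_nat_numeral BitM.simps replicate.simps

text \<open>As a consequence, the coefficients for all three pairings of blocks are images of each
  other under multipliers, up to order and signs, and one family of separation checks serves the
  whole first code.\<close>

lemma first_identities:
  "star (of_trits a1) = of_trits a1" "star (of_trits b1) = of_trits b1"
  "of_trits a1 \<star> of_trits a1 + of_trits b1 \<star> of_trits b1 = - unit"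
  "affine 5 0 (of_trits a1) \<star> of_trits b1 = unit" "affine 5 0 (of_trits a1) \<star> of_trits a1 = affine 5 0 (of_trits b1)"
  "affine 4 0 (of_trits b1) \<star> of_trits a1 = unit" "affine 4 0 (of_trits b1) \<star> of_trits b1 = affine 4 0 (of_trits a1)"
  by (simp_all only: a1_def b1_def trit_rules)

lemma second_identities:
  "star (of_trits a2) = of_trits a2'" "star (of_trits b2) = of_trits b2"
  "of_trits a2 \<star> of_trits a2' + of_trits b2 \<star> of_trits b2 = - unit"
  "of_trits bi2 \<star> of_trits b2 = unit" "of_trits bi2 \<star> of_trits a2 = of_trits ba2" "of_trits bi2 \<star> of_trits a2' = of_trits ba2'"
  "of_trits ci2 \<star> of_trits a2' = unit" "of_trits ci2 \<star> of_trits b2 = of_trits cb2"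
  by (simp_all only: second_lists trit_rules)

lemma invariant7_of_trits: "length l = 19 \<Longrightarrow> permute times7 l = l \<Longrightarrow> invariant7 (of_trits l)"
  by (simp add: invariant7_def affine7_of_trits)

lemma length_lists:
  "length a1 = 19" "length b1 = 19" "length a2 = 19" "length b2 = 19" "length a2' = 19" "length bi2 = 19"
  "length ci2 = 19" "length ba2 = 19" "length ba2' = 19" "length cb2 = 19"
  by (simp_all add: a1_def b1_def second_lists)

lemma invariant7_lists:
  "invariant7 (of_trits a1)" "invariant7 (of_trits b1)" "invariant7 (of_trits a2)" "invariant7 (of_trits b2)"
  "invariant7 (of_trits a2')" "invariant7 (of_trits bi2)" "invariant7 (of_trits ci2)" "invariant7 (of_trits ba2)"
  "invariant7 (of_trits ba2')" "invariant7 (of_trits cb2)"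
  by (rule invariant7_of_trits; simp only: a1_def b1_def second_lists trit_rules)+

lemma invariant7_uminus: "invariant7 p \<Longrightarrow> invariant7 (- p)"
  by (simp add: invariant7_def affine_linear)

lemmas apart_rules = apart3_def apart2_def apart1_def rows_def reps4_def reps3_def reps2_def eval_rules

lemmas count_rules = count_pairs_eval exact_eval full_words_def orbit_sums_def eval_rules F3_plus Let_def
  prod.case length_circ trits_of_trits

section \<open>Separation checks and counts for the two codes\<close>

lemma first_apart3_0: "apart3 0 13 a1 (neg b1) b1 a1"
  by (simp only: apart_rules a1_def b1_def)

lemma first_apart3_13: "apart3 13 13 a1 (neg b1) b1 a1"
  by (simp only: apart_rules a1_def b1_def)

lemma first_apart3_26: "apart3 26 12 a1 (neg b1) b1 a1"
  by (simp only: apart_rules a1_def b1_def)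

lemma first_apart1: "apart1 a1 (neg b1) b1 a1"
  by (simp only: apart_rules a1_def b1_def)

lemma first_apart2_0: "apart2 0 10 a1 (neg b1) b1 a1"
  by (simp only: apart_rules a1_def b1_def)

lemma first_apart2_10: "apart2 10 10 a1 (neg b1) b1 a1"
  by (simp only: apart_rules a1_def b1_def)

lemma first_apart2_20: "apart2 20 9 a1 (neg b1) b1 a1"
  by (simp only: apart_rules a1_def b1_def)

lemma first_apart2_29: "apart2 29 9 a1 (neg b1) b1 a1"
  by (simp only: apart_rules a1_def b1_def)

lemma second_wx_apart3_0: "apart3 0 13 a2 (neg b2) b2 a2'"
  by (simp only: apart_rules second_lists)

lemma second_wx_apart3_13: "apart3 13 13 a2 (neg b2) b2 a2'"
  by (simp only: apart_rules second_lists)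

lemma second_wx_apart3_26: "apart3 26 12 a2 (neg b2) b2 a2'"
  by (simp only: apart_rules second_lists)

lemma second_wx_apart1: "apart1 a2 (neg b2) b2 a2'"
  by (simp only: apart_rules second_lists)

lemma second_wx_apart2_0: "apart2 0 10 a2 (neg b2) b2 a2'"
  by (simp only: apart_rules second_lists)

lemma second_wx_apart2_10: "apart2 10 10 a2 (neg b2) b2 a2'"
  by (simp only: apart_rules second_lists)

lemma second_wx_apart2_20: "apart2 20 9 a2 (neg b2) b2 a2'"
  by (simp only: apart_rules second_lists)

lemma second_wx_apart2_29: "apart2 29 9 a2 (neg b2) b2 a2'"
  by (simp only: apart_rules second_lists)

lemma second_wy_apart3_0: "apart3 0 13 ba2 (neg bi2) (neg bi2) (neg ba2')"
  by (simp only: apart_rules second_lists)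

lemma second_wy_apart3_13: "apart3 13 13 ba2 (neg bi2) (neg bi2) (neg ba2')"
  by (simp only: apart_rules second_lists)

lemma second_wy_apart3_26: "apart3 26 12 ba2 (neg bi2) (neg bi2) (neg ba2')"
  by (simp only: apart_rules second_lists)

lemma second_wy_apart1: "apart1 ba2 (neg bi2) (neg bi2) (neg ba2')"
  by (simp only: apart_rules second_lists)

lemma second_wy_apart2_0: "apart2 0 10 ba2 (neg bi2) (neg bi2) (neg ba2')"
  by (simp only: apart_rules second_lists)

lemma second_wy_apart2_10: "apart2 10 10 ba2 (neg bi2) (neg bi2) (neg ba2')"
  by (simp only: apart_rules second_lists)

lemma second_wy_apart2_20: "apart2 20 9 ba2 (neg bi2) (neg bi2) (neg ba2')"
  by (simp only: apart_rules second_lists)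

lemma second_wy_apart2_29: "apart2 29 9 ba2 (neg bi2) (neg bi2) (neg ba2')"
  by (simp only: apart_rules second_lists)

text \<open>The first and last block are tested for light words only: at lightest weight 3, the
  bounds on the second and third block already bring the total to 16.\<close>

lemma second_wz_apart1: "apart1 (neg cb2) ci2 (neg ci2) (neg cb2)"
  by (simp only: apart_rules second_lists)

lemma second_wz_apart2_0: "apart2 0 10 (neg cb2) ci2 (neg ci2) (neg cb2)"
  by (simp only: apart_rules second_lists)

lemma second_wz_apart2_10: "apart2 10 10 (neg cb2) ci2 (neg ci2) (neg cb2)"
  by (simp only: apart_rules second_lists)

lemma second_wz_apart2_20: "apart2 20 9 (neg cb2) ci2 (neg ci2) (neg cb2)"
  by (simp only: apart_rules second_lists)

lemma second_wz_apart2_29: "apart2 29 9 (neg cb2) ci2 (neg ci2) (neg cb2)"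
  by (simp only: apart_rules second_lists)

text \<open>\<open>M\<close> is the residue 2, whereas the count for the second code is
  \<open>P\<close>, the residue 1.\<close>

lemma first_count: "count_pairs (full_words (circ 19 a1 b1)) (full_words (circ 19 (neg b1) a1)) = M"
  by (simp only: count_rules a1_def b1_def)

lemma second_count: "count_pairs (full_words (circ 19 a2 b2)) (full_words (circ 19 (neg b2) a2')) = P"
  by (simp only: count_rules second_lists)

lemma okI_of_trits:
  assumes "length p = 19" "length q = 19" "length r = 19" "length u = 19"
    and "invariant7 (of_trits p)" "invariant7 (of_trits q)" "invariant7 (of_trits r)" "invariant7 (of_trits u)"
  shows "apart3 0 13 p q r u \<Longrightarrow> apart3 13 13 p q r u \<Longrightarrow> apart3 26 12 p q r u
      \<Longrightarrow> heavy_ok (of_trits p) (of_trits q) (of_trits r) (of_trits u)"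
    and "apart1 p q r u \<Longrightarrow> apart2 0 10 p q r u \<Longrightarrow> apart2 10 10 p q r u \<Longrightarrow> apart2 20 9 p q r u \<Longrightarrow> apart2 29 9 p q r u
      \<Longrightarrow> light_ok (of_trits p) (of_trits q) (of_trits r) (of_trits u)"
  by (intro heavy_okI far_heavy_of_trits assms; assumption) (intro light_okI far_light_of_trits assms; assumption)

lemma invariant7_neg: "length l = 19 \<Longrightarrow> invariant7 (of_trits l) \<Longrightarrow> invariant7 (of_trits (neg l))"
  using invariant7_uminus uminus_of_trits by metis

interpretation first: circulant_code "of_trits a1" "of_trits b1" "affine 5 0 (of_trits a1)" "affine 4 0 (of_trits b1)"
  by unfold_locales (simp_all only: first_identities)

interpretation second: circulant_code "of_trits a2" "of_trits b2" "of_trits bi2" "of_trits ci2"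
  by unfold_locales (simp_all only: second_identities)

lemma first_weights:
  assumes "(w, x, y, z) \<in> code (of_trits a1) (of_trits b1)" "(w, x, y, z) \<noteq> (0, 0, 0, 0)"
  shows "15 < wt w + wt x + wt y + wt z"
proof (rule first.weights)
  let ?a = "of_trits a1" and ?b = "of_trits b1"
  let ?r = "affine 5 0" and ?s = "affine 4 0"
  have ok: "heavy_ok ?a (- ?b) ?b ?a" "light_ok ?a (- ?b) ?b ?a"
    unfolding uminus_of_trits[OF length_lists(2)]
    by (intro okI_of_trits first_apart3_0 first_apart3_13 first_apart3_26 first_apart1 first_apart2_0 first_apart2_10
        first_apart2_20 first_apart2_29; simp add: length_lists invariant7_lists invariant7_neg)+
  then show "heavy_ok ?a (- ?b) ?b (star ?a)" "light_ok ?a (- ?b) ?b (star ?a)"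
    by (simp_all only: first_identities)
  have "(5 :: 19) * 4 = 1" "(4 :: 19) * 5 = 1" by simp_all
  note 5 = ok_affine[OF this(1)] and 4 = ok_affine[OF this(2)]
  have "heavy_ok (?r ?a) (- ?r ?b) (?r ?b) (?r ?a)" "light_ok (?r ?a) (- ?r ?b) (?r ?b) (?r ?a)"
    using 5(1)[OF ok(1)] 5(2)[OF ok(2)] by (simp_all only: affine_linear)
  \<comment> \<open>With \<open>A\<close> and \<open>B\<close> for the images of \<open>?a\<close>
    and \<open>?b\<close>, the coefficients \<open>(A, - B, B, A)\<close> become
    \<open>(B, - A, - A, - B)\<close> by exchanging the rows and changing the signs of one column
    and one row.\<close>
  then have "heavy_ok (?r ?b) (- ?r ?a) (- ?r ?a) (- ?r ?b)" "light_ok (?r ?b) (- ?r ?a) (- ?r ?a) (- ?r ?b)"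
    by (metis heavy_ok_symmetries minus_minus, metis light_ok_symmetries minus_minus)
  then show "heavy_ok (?r ?a \<star> ?a) (- ?r ?a) (- ?r ?a) (- (?r ?a \<star> star ?a))"
    "light_ok (?r ?a \<star> ?a) (- ?r ?a) (- ?r ?a) (- (?r ?a \<star> star ?a))"
    by (simp_all only: first_identities)
  have "light_ok (?s ?a) (- ?s ?b) (?s ?b) (?s ?a)"
    using 4(2)[OF ok(2)] by (simp_all only: affine_linear)
  \<comment> \<open>Here both computed blocks change sign.\<close>
  then have "light_ok (- ?s ?a) (?s ?b) (- ?s ?b) (- ?s ?a)"
    by (metis light_ok_symmetries minus_minus)
  then show "light_ok (- (?s ?b \<star> ?b)) (?s ?b) (- ?s ?b) (- (?s ?b \<star> ?b))"
    by (simp_all only: first_identities)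
qed (use assms in auto)

lemma second_weights:
  assumes "(w, x, y, z) \<in> code (of_trits a2) (of_trits b2)" "(w, x, y, z) \<noteq> (0, 0, 0, 0)"
  shows "15 < wt w + wt x + wt y + wt z"
proof (rule second.weights)
  note facts = length_lists invariant7_lists invariant7_neg
  show "heavy_ok (of_trits a2) (- of_trits b2) (of_trits b2) (star (of_trits a2))"
    "light_ok (of_trits a2) (- of_trits b2) (of_trits b2) (star (of_trits a2))"
    unfolding second_identities uminus_of_trits[OF length_lists(4)]
    by (intro okI_of_trits second_wx_apart3_0 second_wx_apart3_13 second_wx_apart3_26 second_wx_apart1 second_wx_apart2_0
        second_wx_apart2_10 second_wx_apart2_20 second_wx_apart2_29; simp add: facts)+
  show "heavy_ok (of_trits bi2 \<star> of_trits a2) (- of_trits bi2) (- of_trits bi2) (- (of_trits bi2 \<star> star (of_trits a2)))"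
    "light_ok (of_trits bi2 \<star> of_trits a2) (- of_trits bi2) (- of_trits bi2) (- (of_trits bi2 \<star> star (of_trits a2)))"
    unfolding second_identities uminus_of_trits[OF length_lists(6)] uminus_of_trits[OF length_lists(9)]
    by (intro okI_of_trits second_wy_apart3_0 second_wy_apart3_13 second_wy_apart3_26 second_wy_apart1 second_wy_apart2_0
        second_wy_apart2_10 second_wy_apart2_20 second_wy_apart2_29; simp add: facts)+
  show "light_ok (- (of_trits ci2 \<star> of_trits b2)) (of_trits ci2) (- of_trits ci2) (- (of_trits ci2 \<star> of_trits b2))"
    unfolding second_identities uminus_of_trits[OF length_lists(7)] uminus_of_trits[OF length_lists(10)]
    by (intro okI_of_trits second_wz_apart1 second_wz_apart2_0 second_wz_apart2_10 second_wz_apart2_20 second_wz_apart2_29;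
        simp add: facts)
qed (use assms in auto)

lemma first_parameters: "code_with_parameters 76 38 18 first.codewords"
proof (rule first.code_with_parameters[OF first_weights])
  \<comment> \<open>A codeword of weight 3 + 3 + 6 + 6 whose blocks are constant on the orbits of
    multiplication by 7.\<close>
  define w x y z where
    "w = [Z, Z, Z, Z, Z, Z, Z, Z, Z, Z, P, Z, Z, P, Z, P, Z, Z, Z]" and
    "x = [Z, Z, Z, Z, Z, M, Z, Z, Z, Z, Z, Z, Z, Z, Z, Z, M, M, Z]" and
    "y = [Z, M, Z, Z, M, Z, M, M, Z, M, Z, M, Z, Z, Z, Z, Z, Z, Z]" and
    "z = [Z, M, Z, Z, Z, P, Z, M, Z, Z, Z, M, Z, Z, Z, Z, P, P, Z]"
  note lists = w_def x_def y_def z_def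
  show "(of_trits w, of_trits x, of_trits y, of_trits z) \<in> code (of_trits a1) (of_trits b1)"
    unfolding code_def diff_conv_add_uminus mem_Collect_eq prod.case
    by (simp only: lists a1_def b1_def trit_rules simp_thms)
  show "wt (of_trits w) + wt (of_trits x) + wt (of_trits y) + wt (of_trits z) = 18"
    by (simp add: wt_of_trits lists)
qed

lemma second_parameters: "code_with_parameters 76 38 18 second.codewords"
proof (rule second.code_with_parameters[OF second_weights])
  \<comment> \<open>A codeword of weight 0 + 6 + 6 + 6, again constant on the orbits of
    multiplication by 7 in each block.\<close>
  define w x y z where
    "w = [Z, Z, Z, Z, Z, Z, Z, Z, Z, Z, Z, Z, Z, Z, Z, Z, Z, Z, Z]" and
    "x = [Z, Z, P, P, Z, P, Z, Z, Z, Z, Z, Z, Z, Z, P, Z, P, P, Z]" and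
    "y = [Z, M, Z, Z, Z, Z, Z, M, M, Z, Z, M, M, Z, Z, Z, Z, Z, M]" and
    "z = [Z, P, Z, Z, Z, Z, Z, P, Z, Z, M, P, Z, M, Z, M, Z, Z, Z]"
  note lists = w_def x_def y_def z_def
  show "(of_trits w, of_trits x, of_trits y, of_trits z) \<in> code (of_trits a2) (of_trits b2)"
    unfolding code_def diff_conv_add_uminus mem_Collect_eq prod.case
    by (simp only: lists second_lists trit_rules simp_thms)
  show "wt (of_trits w) + wt (of_trits x) + wt (of_trits y) + wt (of_trits z) = 18"
    by (simp add: wt_of_trits lists)
qed

theorem theorem4p4:
  shows "\<exists>C D :: (F3 ^ 76) set.
           code_with_parameters 76 38 18 C \<and> self_dual C \<and>
           code_with_parameters 76 38 18 D \<and> self_dual D \<and>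
           \<not> equivalent_codes C D"
proof (intro exI conjI)
  have "card {v \<in> first.codewords. hamming_weight v = 75} mod 3 = 2 mod 3"
    by (rule first.heavy_words_mod_3[OF invariant7_lists(1,2)])
      (simp add: first_identities uminus_of_trits trits_of_trits length_lists first_count F3_constants)
  moreover have "card {v \<in> second.codewords. hamming_weight v = 75} mod 3 = 1 mod 3"
    by (rule second.heavy_words_mod_3[OF invariant7_lists(3,4)])
      (simp add: second_identities uminus_of_trits trits_of_trits length_lists second_count F3_constants)
  ultimately show "\<not> equivalent_codes first.codewords second.codewords"
    using weight_distribution_equivalent[of first.codewords second.codewords 75] by auto
qed (rule first_parameters second_parameters first.self_dual_codewords second.self_dual_codewords)+

end
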